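(* For every $N$ let $A=A(N)$ be a random Hermitian matrix of size $N$ with eigenvalues $\lambda_1(A)\le\dots\le\lambda_N(A)$. Assume that for every finite $r\in\mathbb{N}$ one has $$\lim_{N\to\infty}N\left(\frac1N\log\mathbb{E}\left[HC(x_1,\dots,x_r,0^{N-r};\lambda_1(A),\dots,\lambda_N(A))\right]-\sum_{i=1}^r\Psi(x_i)\right)=\sum_{i=1}^r\Phi(x_i),$$ where $\Psi,\Phi$ are smooth functions in a complex neighborhood of $0$ and the convergence is uniform in a complex neighborhood of $0^r$. Then for every $k\in\mathbb{N}$ $$\lim_{N\to\infty}N\left(\frac{1}{N^{k+1}}\mathbb{E}\left[\sum_{i=1}^N\lambda_i^k(A)\right]-\boldsymbol{\mu}_k\right)=\boldsymbol{\mu}'_k,$$ where $$\boldsymbol{\mu}_k=\sum_{m=0}^{k-1}\frac{k!}{m!\,(m+1)!\,(k-m)!}\left.\frac{d^m}{dx^m}\left((\Psi'(x))^{k-m}\right)\right|_{x=0},$$ $$\boldsymbol{\mu}'_k=\sum_{m=0}^{k-1}\frac{k!}{m!\,(m+1)!\,(k-m-1)!}\left.\frac{d^m}{dx^m}\left((\Psi'(x))^{k-m-1}\Phi'(x)\right)\right|_{x=0}.$$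
   Context: $\mathbb{N}=\{1,2,\dots\}$; $0^m$ denotes $m$ zeros $(0,\dots,0)$. For $x_1,\dots,x_N\in\mathbb{C}$ and $\lambda_1,\dots,\lambda_N\in\mathbb{R}$ the Harish-Chandra integral is $$HC(x_1,\dots,x_N;\lambda_1,\dots,\lambda_N)=\int_{U(N)}\exp\left(\operatorname{Tr}(D_\lambda U D_x U^* )\right)\mathbf{m}_N(dU),$$ where $D_\lambda=\operatorname{diag}(\lambda_1,\dots,\lambda_N)$, $D_x=\operatorname{diag}(x_1,\dots,x_N)$ and $\mathbf{m}_N$ is the Haar probability measure on the unitary group $U(N)$. The expectation $\mathbb{E}$ is over the random eigenvalues of $A$. The hypothesis implicitly includes that the expectations are finite and that the logarithm (the branch equal to $0$ at $x=0$) is well defined near the origin. "Smooth in a complex neighborhood" means complex differentiable (holomorphic). *)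

theory Defs
  imports "HOL-Probability.Probability" "Jordan_Normal_Form.Schur_Decomposition"
begin

definition mat_trace :: "'a::comm_monoid_add mat \<Rightarrow> 'a" where
  "mat_trace M = (\<Sum>i<dim_row M. M $$ (i, i))"

definition hermitian_mats :: "nat \<Rightarrow> complex mat set" where
  "hermitian_mats N = {M \<in> carrier_mat N N. mat_adjoint M = M}"

definition unitary_group :: "nat \<Rightarrow> complex mat set" where
  "unitary_group N =
     {U \<in> carrier_mat N N. U * mat_adjoint U = 1\<^sub>m N \<and> mat_adjoint U * U = 1\<^sub>m N}"

(* The type of matrices carries no topology. The Borel sets of the N x N matrices are those
   induced by the identification with families of N^2 complex numbers. *)
definition borel_mat :: "nat \<Rightarrow> complex mat measure" where
  "borel_mat N =
     vimage_algebra (carrier_mat N N)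
       (\<lambda>M. \<lambda>p\<in>{..<N} \<times> {..<N}. M $$ p)
       (Pi\<^sub>M ({..<N} \<times> {..<N}) (\<lambda>_. borel))"

(* Left invariance determines a probability measure on the compact group U(N) uniquely. *)
definition haar_prob :: "nat \<Rightarrow> complex mat measure \<Rightarrow> bool" where
  "haar_prob N \<mu> \<longleftrightarrow>
     prob_space \<mu> \<and>
     space \<mu> = unitary_group N \<and>
     sets \<mu> = sets (restrict_space (borel_mat N) (unitary_group N)) \<and>
     (\<forall>V\<in>unitary_group N. distr \<mu> \<mu> (\<lambda>U. V * U) = \<mu>)"

(* Only the values x 0, ..., x (N - 1) and l 0, ..., l (N - 1) matter;
   \<mu> is meant to be the Haar probability measure on U(N). *)
definition HC :: "complex mat measure \<Rightarrow> nat \<Rightarrow> (nat \<Rightarrow> complex) \<Rightarrow> (nat \<Rightarrow> real) \<Rightarrow> complex" where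
  "HC \<mu> N x l =
     (\<integral>U. exp (mat_trace (mat_diag N (\<lambda>i. complex_of_real (l i)) * U * mat_diag N x * mat_adjoint U)) \<partial>\<mu>)"

definition random_hermitian :: "nat \<Rightarrow> 'a measure \<Rightarrow> ('a \<Rightarrow> complex mat) \<Rightarrow> bool" where
  "random_hermitian N P A \<longleftrightarrow>
     prob_space P \<and> A \<in> measurable P (borel_mat N) \<and> (\<forall>\<omega>\<in>space P. A \<omega> \<in> hermitian_mats N)"

(* The roots of the characteristic polynomial with multiplicity, in increasing order, indexed
   from 0. For a Hermitian matrix they are real, so that Re is only a change of type. *)
definition eigval :: "complex mat \<Rightarrow> nat \<Rightarrow> real" where
  "eigval M i = sorted_list_of_multiset (image_mset Re (proots (char_poly M))) ! i"

(* The polydisc of radius e around 0^r in C^r. A point of C^r is identified with the sequence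
   (x_1, ..., x_r, 0, 0, ...), so that its first N entries are (x_1, ..., x_r, 0^(N-r)); the
   product topology of sequences induces the usual topology of C^r. *)
definition polydisc :: "nat \<Rightarrow> real \<Rightarrow> (nat \<Rightarrow> complex) set" where
  "polydisc r e = {x. (\<forall>i<r. cmod (x i) < e) \<and> (\<forall>i\<ge>r. x i = 0)}"

(* On a connected set S containing 0 there is at most one such L. *)
definition log_branch ::
    "(nat \<Rightarrow> complex) set \<Rightarrow> ((nat \<Rightarrow> complex) \<Rightarrow> complex) \<Rightarrow> ((nat \<Rightarrow> complex) \<Rightarrow> complex) \<Rightarrow> bool" where
  "log_branch S f L \<longleftrightarrow>
     continuous_on S L \<and> L (\<lambda>_. 0) = 0 \<and> (\<forall>x\<in>S. exp (L x) = f x)"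

definition mu_coeff :: "(complex \<Rightarrow> complex) \<Rightarrow> nat \<Rightarrow> complex" where
  "mu_coeff \<Psi> k =
     (\<Sum>m=0..k-1. fact k / (fact m * fact (m + 1) * fact (k - m)) *
        (deriv ^^ m) (\<lambda>x. deriv \<Psi> x ^ (k - m)) 0)"

definition mu'_coeff :: "(complex \<Rightarrow> complex) \<Rightarrow> (complex \<Rightarrow> complex) \<Rightarrow> nat \<Rightarrow> complex" where
  "mu'_coeff \<Psi> \<Phi> k =
     (\<Sum>m=0..k-1. fact k / (fact m * fact (m + 1) * fact (k - m - 1)) *
        (deriv ^^ m) (\<lambda>x. deriv \<Psi> x ^ (k - m - 1) * deriv \<Phi> x) 0)"

end

theory Submission
  imports Defs "HOL-Complex_Analysis.Complex_Analysis" "HOL-Combinatorics.Transposition"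
begin

text \<open>
  Let \<open>M = U^* D U\<close>, where \<open>D\<close> is the diagonal matrix of the eigenvalues
  of \<open>A\<close> and \<open>U\<close> is an independent Haar unitary matrix. Since the trace in
  the Harish-Chandra integral equals \<open>\<Sum>_j x_j M_jj\<close>, the function
  \<open>f(x) = E HC(x; \<lambda>)\<close> is the joint Laplace transform of the diagonal entries of
  \<open>M\<close>, and \<open>E \<Sum>_i \<lambda>_i^k = E Tr M^k = N E (M^k)_00\<close>. To reach
  the powers of \<open>M\<close>, consider the series
      \<open>g_(k,i)(x) = E (M^k)_ii exp(\<Sum>_j x_j M_jj), g_(0,i) = f.\<close>
  In \<open>(M^(k+1))_ii = M_ii (M^k)_ii + \<Sum>_(c \<noteq> i) M_ic (M^k)_ci\<close> the first
  term amounts to a derivative in \<open>x_i\<close>. For the others, invariance of the Haar measure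
  under rotations in the plane of the coordinates \<open>i\<close> and \<open>c\<close> gives, after
  differentiation at the identity (\<open>Schwinger_Dyson\<close>), the recursion with Dunkl
  operators
      \<open>g_(k+1,i) = \<partial>_i g_(k,i) + \<Sum>_(c \<noteq> i) (g_(k,i) - g_(k,c)) / (x_i - x_c).\<close>
  It is read as an identity of formal power series, so no integrability beyond that of the
  coefficients is required, and this follows from the recursion itself
  (\<open>integrable_mom\<close>).

  Dividing by \<open>f\<close>, one gets a recursion for \<open>h_k = g_(k,0) / f\<close> that
  involves only \<open>\<partial>_0 log f\<close>. By hypothesis the coefficients of
  \<open>log f\<close> are \<open>N a_n + b_n + o(1)\<close> at \<open>x_i^n\<close>, where
  \<open>a_n\<close> and \<open>b_n\<close> are the Taylor coefficients of \<open>\<Psi>\<close> and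
  \<open>\<Phi>\<close>, and \<open>o(1)\<close> at mixed monomials
  (\<open>log_coefficients_tendsto\<close>). For the coefficients of \<open>N^(-k) h_k\<close> this
  has the following consequence (\<open>C_constant_term\<close>): those that involve one variable
  besides \<open>x_0\<close> are of order \<open>1/N\<close>, those with more are negligible, and
  after a correction by the former the powers of \<open>x_0\<close> obey, up to
  \<open>o(1/N)\<close>, the recursion in one variable
      \<open>\<alpha>_(k+1)(z) = \<psi>(z) \<alpha>_k(z) + (\<alpha>_k(z) - \<alpha>_k(0)) / z, \<psi> = \<Psi>' + 1/N \<Phi>'.\<close>
  Hence \<open>N^(-k-1) E \<Sum>_i \<lambda>_i^k = \<alpha>_k(0) + o(1/N)\<close>. A residue
  computation in the style of Lagrange inversion (\<open>alpha_residue\<close>) gives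
  \<open>\<alpha>_k(0) = 1/(k+1) [z^(-1)] (z^(-1) + \<psi>(z))^(k+1)\<close>, which is the formula
  for \<open>\<mu>_k\<close> when \<open>\<psi> = \<Psi>'\<close>, and the derivative in
  \<open>1/N\<close> yields \<open>\<mu>'_k\<close> (\<open>alpha_perturbation\<close>).
\<close>

section \<open>Formal power series in countably many variables\<close>

definition msplits :: "'b multiset \<Rightarrow> ('b multiset \<times> 'b multiset) set" where
  "msplits m = {(u, v). u + v = m}"

lemma finite_msplits [simp]: "finite (msplits m)"
proof -
  have "msplits m \<subseteq> {u. u \<subseteq># m} \<times> {u. u \<subseteq># m}"
    unfolding msplits_def by (auto simp: mset_subset_eq_exists_conv add.commute)
  moreover have "finite {u. u \<subseteq># m}"
  proof (rule finite_subset)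
    show "{u. u \<subseteq># m} \<subseteq> mset ` {xs. set xs \<subseteq> set_mset m \<and> length xs \<le> size m}"
    proof
      fix u assume u: "u \<in> {u. u \<subseteq># m}"
      obtain xs where xs: "u = mset xs" using ex_mset by metis
      have "set_mset u \<subseteq> set_mset m" "size u \<le> size m"
        using u by (auto intro: set_mset_mono size_mset_mono mset_subset_eqD)
      with xs show "u \<in> mset ` {xs. set xs \<subseteq> set_mset m \<and> length xs \<le> size m}" by auto
    qed
  qed (simp add: finite_lists_length_le)
  ultimately show ?thesis by (meson finite_SigmaI finite_subset)
qed

lemma msplits_size_less: "p \<in> msplits m \<Longrightarrow> fst p \<noteq> {#} \<Longrightarrow> size (snd p) < size m"
  by (auto simp: msplits_def nonempty_has_size)

lemma msplits_empty [simp]: "msplits {#} = {({#}, {#})}"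
  by (auto simp: msplits_def)

lemma sum_msplits_swap: "(\<Sum>(u, v)\<in>msplits m. g u v) = (\<Sum>(u, v)\<in>msplits m. g v u)"
  by (rule sum.reindex_bij_witness[of _ "\<lambda>(u, v). (v, u)" "\<lambda>(u, v). (v, u)"])
     (auto simp: msplits_def add.commute)

lemma sum_msplits_assoc:
  "(\<Sum>(w, z)\<in>msplits m. \<Sum>(u, v)\<in>msplits w. g u v z)
    = (\<Sum>(u, w)\<in>msplits m. \<Sum>(v, z)\<in>msplits w. g u v z)"
proof -
  have "(\<Sum>(w, z)\<in>msplits m. \<Sum>(u, v)\<in>msplits w. g u v z)
      = (\<Sum>p\<in>(SIGMA p:msplits m. msplits (fst p)). g (fst (snd p)) (snd (snd p)) (snd (fst p)))"
    by (simp add: sum.Sigma case_prod_unfold)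
  also have "\<dots> = (\<Sum>p\<in>(SIGMA p:msplits m. msplits (snd p)). g (fst (fst p)) (fst (snd p)) (snd (snd p)))"
    by (rule sum.reindex_bij_witness[of _ "\<lambda>((u, w), (v, z)). ((u + v, z), (u, v))"
              "\<lambda>((w, z), (u, v)). ((u, v + z), (v, z))"])
       (auto simp: msplits_def add.assoc)
  also have "\<dots> = (\<Sum>(u, w)\<in>msplits m. \<Sum>(v, z)\<in>msplits w. g u v z)"
    by (simp add: sum.Sigma case_prod_unfold)
  finally show ?thesis .
qed

lemma sum_msplits_delta:
  fixes g :: "nat multiset \<Rightarrow> complex"
  shows "(\<Sum>(u, v)\<in>msplits m. (if u = {#} then 1 else 0) * g v) = g m"
proof -
  have "(\<Sum>(u, v)\<in>msplits m. (if u = {#} then 1 else 0) * g v)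
      = (\<Sum>p\<in>msplits m. if p = ({#}, m) then g m else 0)"
    by (rule sum.cong) (auto simp: msplits_def split: if_splits)
  also have "\<dots> = g m" unfolding sum.delta[OF finite_msplits] by (simp add: msplits_def)
  finally show ?thesis .
qed

text \<open>
  A formal power series in variables \<open>x_0, x_1, ...\<close>; the multiset \<open>m\<close>
  stands for the monomial \<open>x^m = \<Prod>_(j \<in> m) x_j\<close>. Keeping all variables at
  once, instead of one type for each number of variables, lets the number of variables grow with
  \<open>N\<close> while the coefficients at different \<open>N\<close> remain comparable.
\<close>
typedef mser = "UNIV :: (nat multiset \<Rightarrow> complex) set" morphisms mcoeff Mser
  by auto

setup_lifting type_definition_mser

lemma mser_eqI: "(\<And>m. mcoeff f m = mcoeff g m) \<Longrightarrow> f = g"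
  by transfer auto

instantiation mser :: comm_ring_1
begin
lift_definition zero_mser :: mser is "\<lambda>_. 0" .
lift_definition one_mser :: mser is "\<lambda>m. if m = {#} then 1 else 0" .
lift_definition plus_mser :: "mser \<Rightarrow> mser \<Rightarrow> mser" is "\<lambda>f g m. f m + g m" .
lift_definition minus_mser :: "mser \<Rightarrow> mser \<Rightarrow> mser" is "\<lambda>f g m. f m - g m" .
lift_definition uminus_mser :: "mser \<Rightarrow> mser" is "\<lambda>f m. - f m" .
lift_definition times_mser :: "mser \<Rightarrow> mser \<Rightarrow> mser" is
  "\<lambda>f g m. \<Sum>(u, v)\<in>msplits m. f u * g v" .
instance
proof
  fix a b c :: mser
  show "a * b * c = a * (b * c)"
  proof (rule mser_eqI)
    fix m
    show "mcoeff (a * b * c) m = mcoeff (a * (b * c)) m"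
      using sum_msplits_assoc[where g = "\<lambda>u v z. mcoeff a u * (mcoeff b v * mcoeff c z)" and m = m]
      by (simp add: times_mser.rep_eq sum_distrib_right sum_distrib_left case_prod_unfold mult.assoc)
  qed
  show "a * b = b * a"
  proof (rule mser_eqI)
    fix m
    have "mcoeff (b * a) m = (\<Sum>(u, v)\<in>msplits m. mcoeff a v * mcoeff b u)"
      by (simp add: times_mser.rep_eq mult.commute)
    then show "mcoeff (a * b) m = mcoeff (b * a) m"
      using sum_msplits_swap[where g = "\<lambda>u v. mcoeff a u * mcoeff b v" and m = m]
      by (simp add: times_mser.rep_eq)
  qed
  show "1 * a = a"
    by (rule mser_eqI) (simp add: times_mser.rep_eq one_mser.rep_eq sum_msplits_delta)
  show "(a + b) * c = a * c + b * c"
    by (rule mser_eqI) (simp add: times_mser.rep_eq plus_mser.rep_eq distrib_right sum.distrib case_prod_unfold)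
  show "(0 :: mser) \<noteq> 1"
    by (metis one_mser.rep_eq zero_mser.rep_eq zero_neq_one)
qed (auto intro!: mser_eqI simp: zero_mser.rep_eq plus_mser.rep_eq minus_mser.rep_eq uminus_mser.rep_eq)
end

lemma mcoeff_sum: "mcoeff (sum f A) m = (\<Sum>x\<in>A. mcoeff (f x) m)"
  by (induction A rule: infinite_finite_induct) (auto simp: zero_mser.rep_eq plus_mser.rep_eq)

text \<open>
  The inverse is found degree by degree, so only finitely many coefficients are involved each time.
\<close>
lemma mser_inverse:
  assumes "mcoeff f {#} = 1"
  obtains f' where "f * f' = 1"
proof -
  have "\<exists>f'. \<forall>m. size m < n \<longrightarrow> mcoeff (f * f') m = mcoeff 1 m" for n
  proof (induction n)
    case (Suc n)
    then obtain f' where f': "\<And>m. size m < n \<Longrightarrow> mcoeff (f * f') m = mcoeff 1 m" by blast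
    (* As f has constant term 1, adding e to f' changes f * f' in degree n by e and leaves the
       lower degrees alone. *)
    define e where "e = Mser (\<lambda>m. if size m = n then mcoeff (1 - f * f') m else 0)"
    have e: "mcoeff e m = (if size m = n then mcoeff (1 - f * f') m else 0)" for m
      by (simp add: e_def Mser_inverse)
    have fe: "mcoeff (f * e) m = mcoeff e m" if "size m \<le> n" for m
    proof -
      have "mcoeff (f * e) m = (\<Sum>p\<in>msplits m. if p = ({#}, m) then mcoeff e m else 0)"
        unfolding times_mser.rep_eq
      proof (rule sum.cong[OF refl])
        fix p assume p: "p \<in> msplits m"
        show "(case p of (u, v) \<Rightarrow> mcoeff f u * mcoeff e v) = (if p = ({#}, m) then mcoeff e m else 0)"
        proof (cases "fst p = {#}")
          case True
          with p show ?thesis by (auto simp: msplits_def assms)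
        next
          case False
          with p that msplits_size_less[OF p] have "mcoeff e (snd p) = 0" by (auto simp: e)
          with False show ?thesis by (auto simp: case_prod_unfold)
        qed
      qed
      also have "\<dots> = mcoeff e m" unfolding sum.delta[OF finite_msplits] by (simp add: msplits_def)
      finally show ?thesis .
    qed
    have "mcoeff (f * (f' + e)) m = mcoeff 1 m" if "size m < Suc n" for m
      using f'[of m] fe[of m] that
      by (cases "size m = n") (auto simp: distrib_left plus_mser.rep_eq minus_mser.rep_eq e)
    then show ?case by blast
  qed simp
  then obtain F where F: "\<And>n m. size m < n \<Longrightarrow> mcoeff (f * F n) m = mcoeff 1 m"
    by metis
  (* The coefficients of a up to a given degree are determined by those of f * a; this makes the
     approximate inverses of different precision compatible. *)
  have uniq: "mcoeff a m = mcoeff b m"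
    if "\<And>m'. size m' \<le> size m \<Longrightarrow> mcoeff (f * a) m' = mcoeff (f * b) m'" for a b m
    using that
  proof (induction "size m" arbitrary: m rule: less_induct)
    case less
    have *: "mcoeff (f * a) m = mcoeff a m + (\<Sum>p\<in>msplits m - {({#}, m)}. mcoeff f (fst p) * mcoeff a (snd p))"
      for a
      unfolding times_mser.rep_eq
      by (subst sum.remove[OF finite_msplits, of "({#}, m)"])
         (simp add: msplits_def, simp add: assms case_prod_unfold)
    have "(\<Sum>p\<in>msplits m - {({#}, m)}. mcoeff f (fst p) * mcoeff a (snd p))
        = (\<Sum>p\<in>msplits m - {({#}, m)}. mcoeff f (fst p) * mcoeff b (snd p))"
    proof (intro sum.cong refl)
      fix p assume "p \<in> msplits m - {({#}, m)}"
      then have sz: "size (snd p) < size m"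
        by (intro msplits_size_less) (auto simp: msplits_def)
      then have "mcoeff a (snd p) = mcoeff b (snd p)"
        by (rule less(1)) (use sz less(2) in auto)
      then show "mcoeff f (fst p) * mcoeff a (snd p) = mcoeff f (fst p) * mcoeff b (snd p)" by simp
    qed
    with less(2)[of m] *[of a] *[of b] show ?case by simp
  qed
  define f' where "f' = Mser (\<lambda>m. mcoeff (F (Suc (size m))) m)"
  have "mcoeff (f * f') m = mcoeff 1 m" for m
  proof -
    have "mcoeff (f * f') m = mcoeff (f * F (Suc (size m))) m"
      unfolding times_mser.rep_eq
    proof (intro sum.cong refl)
      fix p assume "p \<in> msplits m"
      then have le: "size (snd p) \<le> size m" by (auto simp: msplits_def)
      have "mcoeff f' (snd p) = mcoeff (F (Suc (size m))) (snd p)"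
        unfolding f'_def Mser_inverse[OF UNIV_I]
        by (rule uniq) (use F le in auto)
      then show "(case p of (u, v) \<Rightarrow> mcoeff f u * mcoeff f' v)
          = (case p of (u, v) \<Rightarrow> mcoeff f u * mcoeff (F (Suc (size m))) v)"
        by (simp add: case_prod_unfold)
    qed
    then show ?thesis using F by simp
  qed
  then have "f * f' = 1" by (rule mser_eqI)
  then show ?thesis by (rule that)
qed

lift_definition mderiv :: "nat \<Rightarrow> mser \<Rightarrow> mser" is
  "\<lambda>i f m. of_nat (Suc (count m i)) * f (add_mset i m)" .

lift_definition mEuler :: "mser \<Rightarrow> mser" is "\<lambda>f m. of_nat (size m) * f m" .

lift_definition mvar :: "nat \<Rightarrow> mser" is "\<lambda>i m. if m = {#i#} then 1 else 0" .

lemma mcoeff_mvar_mult: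
  "mcoeff (mvar i * f) m = (if i \<in># m then mcoeff f (m - {#i#}) else 0)"
proof -
  have "mcoeff (mvar i * f) m = (\<Sum>p\<in>(if i \<in># m then {({#i#}, m - {#i#})} else {}). mcoeff f (snd p))"
    unfolding times_mser.rep_eq mvar.rep_eq
  proof (rule sum.mono_neutral_cong_right[OF finite_msplits])
    show "(if i \<in># m then {({#i#}, m - {#i#})} else {}) \<subseteq> msplits m" by (simp add: msplits_def)
  qed (auto simp: msplits_def split: if_splits)
  then show ?thesis by simp
qed

lemma mEuler_mult: "mEuler (f * g) = mEuler f * g + f * mEuler g"
proof (rule mser_eqI)
  fix m
  have "of_nat (size m) * (\<Sum>(u, v)\<in>msplits m. mcoeff f u * mcoeff g v)
      = (\<Sum>(u, v)\<in>msplits m. of_nat (size u) * mcoeff f u * mcoeff g v + mcoeff f u * (of_nat (size v) * mcoeff g v))"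
    unfolding sum_distrib_left by (intro sum.cong) (auto simp: msplits_def algebra_simps)
  then show "mcoeff (mEuler (f * g)) m = mcoeff (mEuler f * g + f * mEuler g) m"
    by (simp add: mEuler.rep_eq times_mser.rep_eq plus_mser.rep_eq case_prod_unfold sum.distrib)
qed

lemma mderiv_mult: "mderiv i (f * g) = mderiv i f * g + f * mderiv i g"
proof (rule mser_eqI)
  fix m
  have key: "(\<Sum>(u, v)\<in>msplits (add_mset i m). of_nat (count u i) * mcoeff f u * mcoeff g v) = mcoeff (mderiv i f * g) m"
    for f g
  proof -
    have "(\<Sum>(u, v)\<in>msplits (add_mset i m). of_nat (count u i) * mcoeff f u * mcoeff g v)
       = (\<Sum>(u, v)\<in>{(u, v) \<in> msplits (add_mset i m). i \<in># u}. of_nat (count u i) * mcoeff f u * mcoeff g v)"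
      by (rule sum.mono_neutral_right) (auto simp: not_in_iff)
    also have "\<dots> = (\<Sum>(u, v)\<in>msplits m. of_nat (Suc (count u i)) * mcoeff f (add_mset i u) * mcoeff g v)"
      by (rule sum.reindex_bij_witness[of _ "\<lambda>(u, v). (add_mset i u, v)" "\<lambda>(u, v). (u - {#i#}, v)"])
         (auto simp: msplits_def)
    finally show ?thesis by (simp add: times_mser.rep_eq mderiv.rep_eq)
  qed
  have key2: "(\<Sum>(u, v)\<in>msplits (add_mset i m). mcoeff f u * (of_nat (count v i) * mcoeff g v)) = mcoeff (f * mderiv i g) m"
  proof -
    have "(\<Sum>(u, v)\<in>msplits (add_mset i m). mcoeff f u * (of_nat (count v i) * mcoeff g v))
        = (\<Sum>(u, v)\<in>msplits (add_mset i m). of_nat (count u i) * mcoeff g u * mcoeff f v)"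
      by (subst sum_msplits_swap) (simp add: mult.commute)
    also have "\<dots> = mcoeff (mderiv i g * f) m" by (rule key)
    finally show ?thesis by (simp add: mult.commute)
  qed
  have "mcoeff (mderiv i (f * g)) m
      = of_nat (count (add_mset i m) i) * (\<Sum>(u, v)\<in>msplits (add_mset i m). mcoeff f u * mcoeff g v)"
    by (simp add: mderiv.rep_eq times_mser.rep_eq)
  also have "\<dots> = (\<Sum>(u, v)\<in>msplits (add_mset i m). of_nat (count u i) * mcoeff f u * mcoeff g v + mcoeff f u * (of_nat (count v i) * mcoeff g v))"
    unfolding sum_distrib_left
  proof (intro sum.cong refl)
    fix p assume "p \<in> msplits (add_mset i m)"
    then have "count (add_mset i m) i = count (fst p) i + count (snd p) i"
      by (auto simp: msplits_def simp flip: count_union)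
    then show "of_nat (count (add_mset i m) i) * (case p of (u, v) \<Rightarrow> mcoeff f u * mcoeff g v)
      = (case p of (u, v) \<Rightarrow> of_nat (count u i) * mcoeff f u * mcoeff g v + mcoeff f u * (of_nat (count v i) * mcoeff g v))"
      by (simp add: case_prod_unfold algebra_simps)
  qed
  also have "\<dots> = mcoeff (mderiv i f * g + f * mderiv i g) m"
    using key[of f g] key2 by (simp add: case_prod_unfold sum.distrib plus_mser.rep_eq)
  finally show "mcoeff (mderiv i (f * g)) m = mcoeff (mderiv i f * g + f * mderiv i g) m" .
qed

text \<open>
  The Euler operator multiplies the part of degree \<open>d\<close> by \<open>d\<close>, and a
  partial derivative lowers the degree by one.
\<close>
lemma mderiv_mEuler: "mderiv i (mEuler f) = mEuler (mderiv i f) + mderiv i f"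
  by (rule mser_eqI) (simp add: mderiv.rep_eq mEuler.rep_eq plus_mser.rep_eq algebra_simps)

text \<open>
  The logarithmic derivative determines the logarithm of a series with constant term 1 up to its
  constant term, and the Euler operator \<open>E\<close> is a derivation that can be inverted on
  each positive degree: \<open>log f\<close> is the series with
  \<open>E (log f) = (E f) / f\<close>. In degree zero the division by zero yields the desired
  constant term 0.
\<close>
definition mlog :: "mser \<Rightarrow> mser" where
  "mlog f = (let f' = (SOME f'. f * f' = 1) in Mser (\<lambda>m. mcoeff (mEuler f * f') m / of_nat (size m)))"

lemma mEuler_mlog:
  assumes "mcoeff f {#} = 1"
  shows "mEuler (mlog f) * f = mEuler f"
proof -
  define f' where "f' = (SOME f'. f * f' = 1)"
  have f': "f * f' = 1"
    unfolding f'_def using mser_inverse[OF assms] by (metis (mono_tags) someI_ex)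
  have "mEuler (mlog f) = mEuler f * f'"
    unfolding mlog_def f'_def[symmetric] Let_def
    by (rule mser_eqI) (auto simp: mEuler.rep_eq Mser_inverse times_mser.rep_eq)
  then show ?thesis using f' by (simp add: mult.assoc mult.commute[of f' f])
qed

text \<open>
  The series \<open>u = \<partial>_i f - \<partial>_i(log f) f\<close> satisfies
  \<open>E u + u = E(log f) u\<close>. The right hand side in degree \<open>d\<close> involves
  \<open>u\<close> only in degrees below \<open>d\<close>, while the left hand side is
  \<open>d + 1\<close> times the part of degree \<open>d\<close>; hence \<open>u = 0\<close> by
  induction on the degree.
\<close>
lemma mderiv_mlog:
  assumes "mcoeff f {#} = 1"
  shows "mderiv i (mlog f) * f = mderiv i f"
proof -
  define L where "L = mlog f"
  define u where "u = mderiv i f - mderiv i L * f"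
  have EL: "mEuler f = mEuler L * f" using mEuler_mlog[OF assms] by (simp add: L_def)
  have diff: "mEuler (a - b) = mEuler a - mEuler b" for a b
    by (rule mser_eqI) (simp add: mEuler.rep_eq minus_mser.rep_eq algebra_simps)
  have "mderiv i (mEuler f) = mderiv i (mEuler L) * f + mEuler L * mderiv i f"
    unfolding EL mderiv_mult ..
  then have "mEuler (mderiv i f) + mderiv i f
      = (mEuler (mderiv i L) + mderiv i L) * f + mEuler L * mderiv i f"
    by (simp add: mderiv_mEuler)
  then have *: "mEuler u + u = mEuler L * u"
    unfolding u_def diff mEuler_mult EL by (simp add: algebra_simps) 
  have "mcoeff u m = 0" for m
  proof (induction "size m" arbitrary: m rule: less_induct)
    case less
    have "mcoeff (mEuler L * u) m = 0"
      unfolding times_mser.rep_eq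
    proof (intro sum.neutral ballI)
      fix p assume "p \<in> msplits m"
      then have "mcoeff (mEuler L) (fst p) * mcoeff u (snd p) = 0"
        using less[of "snd p"] msplits_size_less[of p m]
        by (cases "fst p = {#}") (auto simp: mEuler.rep_eq)
      then show "(case p of (u', v) \<Rightarrow> mcoeff (mEuler L) u' * mcoeff u v) = 0"
        by (simp add: case_prod_unfold)
    qed
    then have "of_nat (size m) * mcoeff u m + mcoeff u m = 0"
      using arg_cong[OF *, of "\<lambda>a. mcoeff a m"] by (simp add: plus_mser.rep_eq mEuler.rep_eq)
    then have "of_nat (Suc (size m)) * mcoeff u m = 0" by (simp add: algebra_simps)
    then show ?case by (simp del: of_nat_Suc)
  qed
  then have "u = 0" by (intro mser_eqI) (simp add: zero_mser.rep_eq)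
  then show ?thesis by (simp add: u_def L_def)
qed

text \<open>
  The monomial \<open>x^m x_i (x_i / x_l)^j\<close>.
\<close>
abbreviation move :: "nat \<Rightarrow> nat \<Rightarrow> nat \<Rightarrow> nat multiset \<Rightarrow> nat multiset" where
  "move j l i m \<equiv> m - replicate_mset j l + replicate_mset (Suc j) i"

text \<open>
  Multiplying by \<open>x_i - x_l\<close> relates the coefficient of \<open>q\<close> at
  \<open>x^m\<close> to the one at \<open>x^m x_i / x_l\<close>, which has one factor
  \<open>x_l\<close> less; iterating until \<open>x_l\<close> is used up expresses the coefficients
  of a divided difference by finitely many coefficients of its numerator.
\<close>
lemma mcoeff_divided_difference:
  assumes "(mvar i - mvar l) * q = w" "i \<noteq> l"
  shows "mcoeff q m = (\<Sum>j\<le>count m l. mcoeff w (move j l i m))"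
proof (induction "count m l" arbitrary: m)
  case 0
  have "mcoeff ((mvar i - mvar l) * q) (add_mset i m) = mcoeff q m"
    using 0 assms(2) by (auto simp: left_diff_distrib minus_mser.rep_eq mcoeff_mvar_mult count_eq_zero_iff)
  with 0 assms(1) show ?case by simp
next
  case (Suc c)
  have l: "l \<in># m" using Suc.hyps(2) by (metis count_eq_zero_iff nat.distinct(1))
  define m' where "m' = add_mset i (m - {#l#})"
  have c': "c = count m' l" using Suc.hyps(2) assms(2) by (simp add: m'_def)
  have "mcoeff ((mvar i - mvar l) * q) (add_mset i m) = mcoeff q m - mcoeff q m'"
    using l assms(2) by (auto simp: left_diff_distrib minus_mser.rep_eq mcoeff_mvar_mult m'_def)
  then have "mcoeff q m = mcoeff w (add_mset i m) + mcoeff q m'"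
    using assms(1) by simp
  also have "mcoeff q m' = (\<Sum>j\<le>c. mcoeff w (move j l i m'))"
    using Suc.hyps(1)[OF c'] c' by simp
  also have "\<dots> = (\<Sum>j\<le>c. mcoeff w (m - replicate_mset (Suc j) l + replicate_mset (Suc (Suc j)) i))"
  proof (intro sum.cong refl arg_cong[of _ _ "mcoeff w"])
    fix j
    show "m' - replicate_mset j l + replicate_mset (Suc j) i
        = m - replicate_mset (Suc j) l + replicate_mset (Suc (Suc j)) i"
      by (rule multiset_eqI) (use assms(2) in \<open>auto simp: m'_def\<close>)
  qed
  also have "mcoeff w (add_mset i m) + \<dots> = (\<Sum>j\<le>Suc c. mcoeff w (move j l i m))"
    unfolding sum.atMost_Suc_shift by simp
  finally show ?case using Suc.hyps(2) by simp
qed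

abbreviation msets :: "nat \<Rightarrow> nat \<Rightarrow> nat multiset set" where
  "msets r n \<equiv> {m. set_mset m \<subseteq> {..<r} \<and> size m = n}"

text \<open>
  The one-variable series \<open>t \<mapsto> f(t y_0, ..., t y_(r-1), 0, 0, ...)\<close>.
\<close>
definition mline :: "nat \<Rightarrow> (nat \<Rightarrow> complex) \<Rightarrow> mser \<Rightarrow> complex fps" where
  "mline r y f = Abs_fps (\<lambda>n. \<Sum>m\<in>msets r n. mcoeff f m * (\<Prod>i\<in>#m. y i))"

lemma finite_msets_size: "finite (msets r n)"
proof (rule finite_subset)
  show "msets r n \<subseteq> mset ` {xs. set xs \<subseteq> {..<r} \<and> length xs = n}"
  proof
    fix m :: "nat multiset" assume m: "m \<in> msets r n"
    obtain xs where "m = mset xs" using ex_mset by metis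
    with m show "m \<in> mset ` {xs. set xs \<subseteq> {..<r} \<and> length xs = n}" by auto
  qed
  show "finite (mset ` {xs. set xs \<subseteq> {..<r} \<and> length xs = n})"
    by (intro finite_imageI finite_lists_length_eq) auto
qed

lemma mline_mult: "mline r y (f * g) = mline r y f * mline r y g"
proof (rule fps_ext)
  fix n
  let ?S = "\<lambda>n. msets r n"
  let ?c = "\<lambda>f m. mcoeff f m * (\<Prod>i\<in>#m. y i)"
  have "fps_nth (mline r y (f * g)) n = (\<Sum>m\<in>?S n. \<Sum>p\<in>msplits m. ?c f (fst p) * ?c g (snd p))"
    unfolding mline_def fps_nth_Abs_fps
  proof (intro sum.cong refl)
    fix m
    show "?c (f * g) m = (\<Sum>p\<in>msplits m. ?c f (fst p) * ?c g (snd p))"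
      unfolding times_mser.rep_eq sum_distrib_right
    proof (intro sum.cong refl)
      fix p assume "p \<in> msplits m"
      then have "(\<Prod>i\<in>#m. y i) = (\<Prod>i\<in>#fst p. y i) * (\<Prod>i\<in>#snd p. y i)"
        by (auto simp: msplits_def)
      then show "(case p of (u, v) \<Rightarrow> mcoeff f u * mcoeff g v) * (\<Prod>i\<in>#m. y i) = ?c f (fst p) * ?c g (snd p)"
        by (simp add: case_prod_unfold)
    qed
  qed
  also have "\<dots> = (\<Sum>q\<in>(SIGMA m:?S n. msplits m). ?c f (fst (snd q)) * ?c g (snd (snd q)))"
    by (subst sum.Sigma) (auto simp: finite_msets_size case_prod_unfold)
  also have "\<dots> = (\<Sum>q\<in>(SIGMA k:{0..n}. ?S k \<times> ?S (n - k)). ?c f (fst (snd q)) * ?c g (snd (snd q)))"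
    by (rule sum.reindex_bij_witness[of _ "\<lambda>(k, (u, v)). (u + v, (u, v))" "\<lambda>(m, (u, v)). (size u, (u, v))"])
       (auto simp: msplits_def)
  also have "\<dots> = (\<Sum>k=0..n. \<Sum>p\<in>?S k \<times> ?S (n - k). ?c f (fst p) * ?c g (snd p))"
    by (subst sum.Sigma) (auto simp: finite_msets_size case_prod_unfold)
  also have "\<dots> = (\<Sum>k=0..n. fps_nth (mline r y f) k * fps_nth (mline r y g) (n - k))"
    unfolding mline_def fps_nth_Abs_fps sum_product sum.cartesian_product
    by (simp add: case_prod_unfold)
  finally show "fps_nth (mline r y (f * g)) n = fps_nth (mline r y f * mline r y g) n"
    by (simp add: fps_mult_nth)
qed

lemma mline_mEuler: "mline r y (mEuler f) = fps_X * fps_deriv (mline r y f)"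
proof (rule fps_ext)
  fix n
  show "fps_nth (mline r y (mEuler f)) n = fps_nth (fps_X * fps_deriv (mline r y f)) n"
    by (cases n) (auto simp: mline_def mEuler.rep_eq sum_distrib_left mult.assoc intro!: sum.cong)
qed

section \<open>Asymptotics of the coefficient recursion\<close>

text \<open>
  Quantities of order \<open>o(1/N)\<close>, which do not affect the limit in question.
\<close>
definition negl :: "(nat \<Rightarrow> complex) \<Rightarrow> bool" where
  "negl e \<longleftrightarrow> (\<lambda>N. of_nat N * e N) \<longlonglongrightarrow> 0"

lemma negl_0: "negl (\<lambda>_. 0)" by (simp add: negl_def)

lemma negl_add: "negl a \<Longrightarrow> negl b \<Longrightarrow> negl (\<lambda>N. a N + b N)"
  unfolding negl_def using tendsto_add[of "\<lambda>N. of_nat N * a N" 0 sequentially "\<lambda>N. of_nat N * b N" 0]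
  by (simp add: algebra_simps)

lemma negl_uminus: "negl a \<Longrightarrow> negl (\<lambda>N. - a N)"
  unfolding negl_def using tendsto_minus[of "\<lambda>N. of_nat N * a N" 0 sequentially] by simp

lemma negl_diff: "negl a \<Longrightarrow> negl b \<Longrightarrow> negl (\<lambda>N. a N - b N)"
  using negl_add[of a "\<lambda>N. - b N"] negl_uminus[of b] by simp

lemma negl_sum: "(\<And>i. i \<in> I \<Longrightarrow> negl (f i)) \<Longrightarrow> negl (\<lambda>N. \<Sum>i\<in>I. f i N)"
  by (induction I rule: infinite_finite_induct) (auto simp: negl_0 intro: negl_add)

lemma negl_mult: "convergent g \<Longrightarrow> negl e \<Longrightarrow> negl (\<lambda>N. g N * e N)"
  unfolding negl_def convergent_def
  using tendsto_mult[of g _ sequentially "\<lambda>N. of_nat N * e N" 0] by (auto simp: mult_ac)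

lemma negl_mult': "negl e \<Longrightarrow> convergent g \<Longrightarrow> negl (\<lambda>N. e N * g N)"
  using negl_mult[of g e] by (simp add: mult.commute)

lemma negl_cong: "\<forall>\<^sub>F N in sequentially. a N = b N \<Longrightarrow> negl a \<longleftrightarrow> negl b"
  unfolding negl_def by (intro tendsto_cong) (auto elim: eventually_mono)

lemma negl_transfer: "negl b \<Longrightarrow> \<forall>\<^sub>F N in sequentially. a N = b N \<Longrightarrow> negl a"
  by (subst negl_cong)

lemma negl_tendsto: assumes "negl e" shows "e \<longlonglongrightarrow> 0"
proof -
  have "(\<lambda>N. inverse (of_nat N) * (of_nat N * e N)) \<longlonglongrightarrow> (0::complex) * 0"
    using assms unfolding negl_def by (intro tendsto_mult lim_inverse_n)
  moreover have "\<forall>\<^sub>F N in sequentially. inverse (of_nat N) * (of_nat N * e N) = e N"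
    using eventually_gt_at_top[of 0] by eventually_elim simp
  ultimately show ?thesis by (simp add: tendsto_cong)
qed

lemma negl_inverse_n: assumes "g \<longlonglongrightarrow> 0" shows "negl (\<lambda>N. 1 / of_nat N * g N)"
proof -
  have "\<forall>\<^sub>F N in sequentially. of_nat N * (1 / of_nat N * g N) = g N"
    using eventually_gt_at_top[of 0] by eventually_elim simp
  then show ?thesis using assms unfolding negl_def by (simp add: tendsto_cong)
qed

definition others :: "nat multiset \<Rightarrow> nat set" where "others m = set_mset m - {0}"

lemma finite_others [simp]: "finite (others m)" by (simp add: others_def)

text \<open>
  The variable \<open>x_0\<close> is singled out below; \<open>others m\<close> are the further
  variables that occur in the monomial, \<open>pur p\<close> is \<open>x_0^p\<close> and
  \<open>two a s\<close> is \<open>x_0^a x_1^s\<close>.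
\<close>
abbreviation pur :: "nat \<Rightarrow> nat multiset" where "pur p \<equiv> replicate_mset p 0"

abbreviation two :: "nat \<Rightarrow> nat \<Rightarrow> nat multiset" where
  "two a s \<equiv> replicate_mset a 0 + replicate_mset s 1"

abbreviation relabel :: "nat \<Rightarrow> nat \<Rightarrow> nat multiset \<Rightarrow> nat multiset" where
  "relabel a b \<equiv> image_mset (Transposition.transpose a b)"

lemma others_empty_iff: "others m = {} \<longleftrightarrow> (\<exists>q. m = pur q)"
proof
  assume "others m = {}"
  then have "m = pur (count m 0)"
    by (intro multiset_eqI) (auto simp: others_def not_in_iff[symmetric])
  then show "\<exists>q. m = pur q" ..
qed (auto simp: others_def split: if_splits)

lemma replicate_mset_add: "replicate_mset (a + b) x = replicate_mset a x + replicate_mset b x"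
  by (induction a) auto

text \<open>
  The coefficient of \<open>z^p\<close> in the one-variable series given by
  \<open>\<alpha>_0 = 1\<close> and
  \<open>\<alpha>_(k+1)(z) = \<psi>(z) \<alpha>_k(z) + (\<alpha>_k(z) - \<alpha>_k(0)) / z\<close>.
  This is what the recursion in infinitely many variables degenerates to as
  \<open>N \<rightarrow> \<infinity>\<close>.
\<close>
fun alpha :: "(nat \<Rightarrow> complex) \<Rightarrow> nat \<Rightarrow> nat \<Rightarrow> complex" where
  "alpha \<psi> 0 p = (if p = 0 then 1 else 0)"
| "alpha \<psi> (Suc k) p = (\<Sum>q\<le>p. \<psi> q * alpha \<psi> k (p - q)) + alpha \<psi> k (Suc p)"

lemma tendsto_alpha:
  assumes "\<And>q. (\<lambda>x. f x q) \<longlonglongrightarrow> \<psi> q"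
  shows "(\<lambda>x. alpha (f x) k p) \<longlonglongrightarrow> alpha \<psi> k p"
  by (induction k arbitrary: p) (auto intro!: tendsto_intros assms)

text \<open>
  \<open>C N k m\<close> plays the role of the coefficient of \<open>x^m\<close> in
  \<open>N^(-k) h_k\<close>, where
  \<open>h_(k+1) = (\<partial>_0 log f) h_k + \<partial>_0 h_k + \<Sum>_l (h_k - s_l h_k) / (x_0 - x_l)\<close>
  with \<open>s_l\<close> the exchange of \<open>x_0\<close> and \<open>x_l\<close>, and
  \<open>lam N\<close> the role of the coefficients of \<open>N^(-1) \<partial>_0 log f\<close>. The
  latter are assumed to be known up to \<open>o(1/N)\<close>: they vanish for monomials that involve
  a variable other than \<open>x_0\<close>.
\<close>
locale coefficient_recursion =
  fixes C :: "nat \<Rightarrow> nat \<Rightarrow> nat multiset \<Rightarrow> complex"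
    and lam :: "nat \<Rightarrow> nat multiset \<Rightarrow> complex"
    and \<psi> \<phi> :: "nat \<Rightarrow> complex"
  assumes C_0: "\<forall>\<^sub>F N in sequentially. C N 0 m = (if m = {#} then 1 else 0)"
    and C_Suc: "\<forall>\<^sub>F N in sequentially. C N (Suc k) m =
        (\<Sum>(u, v)\<in>msplits m. lam N u * C N k v)
        + 1 / of_nat N * (of_nat (Suc (count m 0)) * C N k (add_mset 0 m))
        + 1 / of_nat N * (\<Sum>l\<in>{1..<N}. \<Sum>j\<le>count m l.
            C N k (move j l 0 m)
            - C N k (relabel 0 l (move j l 0 m)))"
    and C_sym: "\<forall>\<^sub>F N in sequentially. \<forall>m l l'. set_mset m \<subseteq> {..<N} \<longrightarrow> 0 < l \<longrightarrow> l < N \<longrightarrow> 0 < l' \<longrightarrow> l' < N \<longrightarrow>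
            C N k (relabel l l' m) = C N k m"
    and lam_pure: "negl (\<lambda>N. lam N (pur q) - (\<psi> q + 1 / of_nat N * \<phi> q))"
    and lam_mixed: "others u \<noteq> {} \<Longrightarrow> negl (\<lambda>N. lam N u)"
begin

definition psiN :: "nat \<Rightarrow> nat \<Rightarrow> complex" where "psiN N q = \<psi> q + 1 / of_nat N * \<phi> q"

lemma tendsto_psiN: "(\<lambda>N. psiN N q) \<longlonglongrightarrow> \<psi> q"
proof -
  have "(\<lambda>N. \<psi> q + inverse (of_nat N) * \<phi> q) \<longlonglongrightarrow> \<psi> q + 0 * \<phi> q"
    by (intro tendsto_intros lim_inverse_n)
  then show ?thesis by (simp add: psiN_def[abs_def] inverse_eq_divide)
qed

lemma tendsto_lam_pure: "(\<lambda>N. lam N (pur q)) \<longlonglongrightarrow> \<psi> q"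
  using tendsto_add[OF negl_tendsto[OF lam_pure[of q]] tendsto_psiN[of q]]
  by (simp add: psiN_def)

lemma convergent_lam: "convergent (\<lambda>N. lam N u)"
proof (cases "others u = {}")
  case True
  then show ?thesis using tendsto_lam_pure others_empty_iff by (auto simp: convergent_def)
next
  case False
  then show ?thesis using negl_tendsto[OF lam_mixed] by (auto simp: convergent_def)
qed

text \<open>
  By symmetry all the variables \<open>x_l\<close> that do not occur in \<open>x^m\<close>
  contribute the same to the sum over \<open>l\<close>. Replacing them by a single representative
  \<open>x_l0\<close> leaves a sum whose length does not depend on \<open>N\<close>, in which only
  the term for \<open>l0\<close> carries a factor of order \<open>N\<close> that cancels the
  \<open>1/N\<close>.
\<close>
lemma C_Suc_fresh:
  assumes l0: "l0 \<noteq> 0" "l0 \<notin># m"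
  shows "\<forall>\<^sub>F N in sequentially. C N (Suc k) m =
        (\<Sum>(u, v)\<in>msplits m. lam N u * C N k v)
        + 1 / of_nat N * (of_nat (Suc (count m 0)) * C N k (add_mset 0 m))
        + 1 / of_nat N * (\<Sum>l\<in>others m. \<Sum>j\<le>count m l.
            C N k (move j l 0 m)
            - C N k (relabel 0 l (move j l 0 m)))
        + (1 - 1 / of_nat N * of_nat (Suc (card (others m)))) *
            (C N k (add_mset 0 m) - C N k (relabel 0 l0 (add_mset 0 m)))"
  using C_Suc[of k m] C_sym[of k] eventually_gt_at_top[of "Max (insert l0 (set_mset m))"]
proof eventually_elim
  case (elim N)
  have N: "l0 < N" "set_mset m \<subseteq> {..<N}"
    using elim(3) by (auto simp: Max_less_iff)
  define D where "D l = (\<Sum>j\<le>count m l.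
            C N k (move j l 0 m)
            - C N k (relabel 0 l (move j l 0 m)))" for l
  define F where "F = C N k (add_mset 0 m) - C N k (relabel 0 l0 (add_mset 0 m))"
  have D: "D l = F" if l: "l \<in> {1..<N} - others m" for l
  proof -
    have lm: "l \<notin># m" "l \<noteq> 0" "l < N" using l by (auto simp: others_def)
    then have "count m l = 0" by (simp add: not_in_iff)
    then have D1: "D l = C N k (add_mset 0 m) - C N k (relabel 0 l (add_mset 0 m))"
      unfolding D_def by simp
    have "relabel 0 l (add_mset 0 m)
        = relabel l l0 (relabel 0 l0 (add_mset 0 m))"
      unfolding multiset.map_comp
      by (rule image_mset_cong) (use lm l0 in \<open>auto simp: Transposition.transpose_def\<close>)
    moreover have "set_mset (relabel 0 l0 (add_mset 0 m)) \<subseteq> {..<N}"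
      using N by (auto simp: Transposition.transpose_def)
    ultimately have "C N k (relabel 0 l (add_mset 0 m))
        = C N k (relabel 0 l0 (add_mset 0 m))"
      using elim(2) lm l0 N by (metis gr0I)
    then show ?thesis by (simp add: D1 F_def)
  qed
  have sub: "others m \<subseteq> {1..<N}" using N by (auto simp: others_def)
  have "(\<Sum>l\<in>{1..<N}. D l) = (\<Sum>l\<in>{1..<N} - others m. D l) + (\<Sum>l\<in>others m. D l)"
    using sub by (intro sum.subset_diff) auto
  also have "(\<Sum>l\<in>{1..<N} - others m. D l) = of_nat (card ({1..<N} - others m)) * F"
    using D by simp
  also have "card ({1..<N} - others m) = N - 1 - card (others m)"
    using sub by (subst card_Diff_subset) auto
  also have "of_nat (N - 1 - card (others m)) = (of_nat N - of_nat (Suc (card (others m))) :: complex)"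
  proof -
    have "Suc (card (others m)) \<le> N"
      using card_mono[OF _ sub] N by simp
    then show ?thesis by (simp add: of_nat_diff flip: of_nat_Suc del: of_nat_Suc)
  qed
  finally have *: "(\<Sum>l\<in>{1..<N}. D l) = (\<Sum>l\<in>others m. D l) + (of_nat N - of_nat (Suc (card (others m)))) * F"
    by simp
  have "N \<noteq> 0" using N by auto
  then show ?case
    unfolding elim(1) D_def[symmetric] * F_def[symmetric] by (simp add: field_simps)
qed

text \<open>
  The limit of \<open>C N k (pur p)\<close> is the coefficient \<open>alpha \<psi> k p\<close>, but
  with precision \<open>1/N\<close> the recursion for these numbers is not closed: through the
  divided differences with the \<open>N - 1\<close> other variables, each weighted by
  \<open>1/N\<close>, the coefficients of the powers \<open>x_l^(p+1)\<close> enter, which are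
  themselves of order \<open>1/N\<close>. After subtraction of the coefficients of
  \<open>x_0^(p-s) x_1^s\<close> these contributions cancel, and the corrected numbers satisfy the
  recursion of \<open>alpha\<close> up to \<open>o(1/N)\<close>. The correction is empty for
  \<open>p = 0\<close>, where the value is needed.
\<close>
definition chat :: "nat \<Rightarrow> nat \<Rightarrow> nat \<Rightarrow> complex" where
  "chat N k p = C N k (pur p) - (\<Sum>s\<in>{1..p}. C N k (two (p - s) s))"

text \<open>
  The three statements proved simultaneously by induction on \<open>k\<close>: a coefficient is
  \<open>o(1/N)\<close> if at least two variables besides \<open>x_0\<close> occur, it is
  \<open>O(1/N)\<close> (and \<open>N\<close> times it converges) if there is one, and the corrected
  coefficients of the powers of \<open>x_0\<close> follow the one-variable recursion.
\<close>
definition bound2 where "bound2 k \<longleftrightarrow> (\<forall>m. 2 \<le> card (others m) \<longrightarrow> negl (\<lambda>N. C N k m))"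
definition bound1 where "bound1 k \<longleftrightarrow> (\<forall>m. card (others m) = 1 \<longrightarrow> convergent (\<lambda>N. of_nat N * C N k m))"
definition approx where "approx k \<longleftrightarrow> (\<forall>p. negl (\<lambda>N. chat N k p - alpha (psiN N) k p))"

lemma tendsto_0_if_convergent_N:
  assumes "convergent (\<lambda>N. of_nat N * e N :: complex)"
  shows "e \<longlonglongrightarrow> 0"
proof -
  obtain d where "(\<lambda>N. of_nat N * e N) \<longlonglongrightarrow> d" using assms by (auto simp: convergent_def)
  then have "(\<lambda>N. inverse (of_nat N) * (of_nat N * e N)) \<longlonglongrightarrow> 0 * d"
    by (intro tendsto_mult lim_inverse_n)
  moreover have "\<forall>\<^sub>F N in sequentially. inverse (of_nat N) * (of_nat N * e N) = e N"
    using eventually_gt_at_top[of 0] by eventually_elim simp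
  ultimately show ?thesis by (simp add: tendsto_cong)
qed

context
  fixes k assumes IH: "bound2 k" "bound1 k" "approx k"
begin

lemma C_mixed: assumes "others m \<noteq> {}" shows "(\<lambda>N. C N k m) \<longlonglongrightarrow> 0"
proof -
  have "card (others m) \<noteq> 0" using assms by simp
  then consider "card (others m) = 1" | "2 \<le> card (others m)" by linarith
  then show ?thesis
    using IH(1,2) negl_tendsto tendsto_0_if_convergent_N by cases (auto simp: bound1_def bound2_def)
qed

lemma others_two: "s \<ge> 1 \<Longrightarrow> others (two a s) = {1}"
  by (auto simp: others_def split: if_splits)

lemma convergent_chat: "convergent (\<lambda>N. chat N k p)"
proof -
  have "(\<lambda>N. (chat N k p - alpha (psiN N) k p) + alpha (psiN N) k p) \<longlonglongrightarrow> 0 + alpha \<psi> k p"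
    using IH(3) by (intro tendsto_add negl_tendsto tendsto_alpha tendsto_psiN) (auto simp: approx_def)
  then show ?thesis by (auto simp: convergent_def)
qed

lemma convergent_C: "convergent (\<lambda>N. C N k m)"
proof (cases "others m = {}")
  case True
  then obtain p where m: "m = pur p" by (auto simp: others_empty_iff)
  have "(\<lambda>N. \<Sum>s\<in>{1..p}. C N k (two (p - s) s)) \<longlonglongrightarrow> (\<Sum>s\<in>{1..p}. 0)"
    by (intro tendsto_sum C_mixed) (simp add: others_two del: One_nat_def)
  then have "convergent (\<lambda>N. chat N k p + (\<Sum>s\<in>{1..p}. C N k (two (p - s) s)))"
    by (intro convergent_add convergent_chat) (auto simp: convergent_def)
  then show ?thesis by (simp add: m chat_def)
next
  case False
  then show ?thesis using C_mixed by (auto simp: convergent_def)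
qed

lemma mem_shift: "x \<in># m \<Longrightarrow> x \<noteq> l \<Longrightarrow> x \<in># m - replicate_mset j l + w"
  by (simp add: in_diff_count)

lemma convergent_fresh_factor: "convergent (\<lambda>N. 1 - 1 / of_nat N * c :: complex)"
  using tendsto_diff[OF tendsto_const tendsto_mult[OF lim_inverse_n tendsto_const[of c]], of 1]
  by (auto simp: convergent_def inverse_eq_divide)

text \<open>
  In the product term, either the factor from \<open>lam\<close> contains another variable and is
  \<open>o(1/N)\<close>, or all the other variables are in the factor from \<open>C\<close>. Every
  other term with a factor \<open>1/N\<close> still contains a variable besides \<open>x_0\<close>,
  since only one variable is exchanged with \<open>x_0\<close>, and the term for the representative
  \<open>x_l0\<close> keeps at least two.
\<close>
lemma bound2_Suc: "bound2 (Suc k)"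
  unfolding bound2_def
proof safe
  fix m assume m: "2 \<le> card (others m)"
  obtain l0 where l0: "l0 \<notin> insert 0 (set_mset m)"
    using ex_new_if_finite[of "insert 0 (set_mset m)"] by auto
  have negl_split: "negl (\<lambda>N. \<Sum>(u, v)\<in>msplits m. lam N u * C N k v)"
  proof (unfold case_prod_unfold, intro negl_sum)
    fix p assume p: "p \<in> msplits m"
    show "negl (\<lambda>N. lam N (fst p) * C N k (snd p))"
    proof (cases "others (fst p) = {}")
      case True
      with p have "others (snd p) = others m" by (auto simp: msplits_def others_def)
      then show ?thesis using IH(1) m by (intro negl_mult convergent_lam) (auto simp: bound2_def)
    next
      case False
      then show ?thesis by (intro negl_mult' lam_mixed convergent_C)
    qed
  qed
  have oth: "\<exists>x. x \<in> others m \<and> x \<noteq> l" for l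
    using m card_le_Suc0_iff_eq[of "others m"] by (metis finite_others not_less_eq_eq numeral_2_eq_2)
  have O1: "others (move j l 0 m) \<noteq> {}" for j l
  proof -
    obtain x where "x \<in> others m" "x \<noteq> l" using oth by blast
    then have "x \<in> others (move j l 0 m)"
      using mem_shift[of x m l] by (auto simp: others_def simp del: replicate_mset_Suc)
    then show ?thesis by auto
  qed
  have O2: "others (relabel 0 l (move j l 0 m)) \<noteq> {}" for j l
  proof -
    obtain x where x: "x \<in> others m" "x \<noteq> l" using oth by blast
    then have "x \<in># m - replicate_mset j l + replicate_mset (Suc j) 0"
      using mem_shift[of x m l] by (auto simp: others_def simp del: replicate_mset_Suc)
    moreover have "Transposition.transpose 0 l x = x" using x by (auto simp: others_def Transposition.transpose_def)
    ultimately have "x \<in># relabel 0 l (move j l 0 m)"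
      by (metis image_eqI set_image_mset)
    then have "x \<in> others (relabel 0 l (move j l 0 m))"
      using x by (simp add: others_def del: image_mset_union replicate_mset_Suc)
    then show ?thesis by auto
  qed
  have O3: "others (add_mset 0 m) = others m" by (auto simp: others_def)
  have O4: "others m \<subseteq> others (relabel 0 l0 (add_mset 0 m))"
  proof
    fix x assume x: "x \<in> others m"
    then have "Transposition.transpose 0 l0 x = x" using l0 by (auto simp: others_def Transposition.transpose_def)
    then show "x \<in> others (relabel 0 l0 (add_mset 0 m))"
      using x by (force simp: others_def)
  qed
  then have O4: "2 \<le> card (others (relabel 0 l0 (add_mset 0 m)))"
    using m card_mono[OF finite_others O4] by linarith
  have "negl (\<lambda>N. 1 / of_nat N * (of_nat (Suc (count m 0)) * C N k (add_mset 0 m)))"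
    using m O3 by (intro negl_inverse_n tendsto_mult_right_zero C_mixed) auto
  moreover have "negl (\<lambda>N. 1 / of_nat N * (\<Sum>l\<in>others m. \<Sum>j\<le>count m l.
            C N k (move j l 0 m)
            - C N k (relabel 0 l (move j l 0 m))))"
    using tendsto_diff[OF C_mixed[OF O1] C_mixed[OF O2]]
    by (intro negl_inverse_n tendsto_null_sum) simp
  moreover have "negl (\<lambda>N. (1 - 1 / of_nat N * of_nat (Suc (card (others m)))) *
            (C N k (add_mset 0 m) - C N k (relabel 0 l0 (add_mset 0 m))))"
    using m O3 O4 IH(1) by (intro negl_mult negl_diff convergent_fresh_factor) (auto simp: bound2_def)
  ultimately have "negl (\<lambda>N. (\<Sum>(u, v)\<in>msplits m. lam N u * C N k v)
        + 1 / of_nat N * (of_nat (Suc (count m 0)) * C N k (add_mset 0 m))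
        + 1 / of_nat N * (\<Sum>l\<in>others m. \<Sum>j\<le>count m l.
            C N k (move j l 0 m)
            - C N k (relabel 0 l (move j l 0 m)))
        + (1 - 1 / of_nat N * of_nat (Suc (card (others m)))) *
            (C N k (add_mset 0 m) - C N k (relabel 0 l0 (add_mset 0 m))))"
    by (intro negl_add negl_split)
  then show "negl (\<lambda>N. C N (Suc k) m)"
    using negl_cong[OF C_Suc_fresh[of l0 m k]] l0 by simp
qed

text \<open>
  Exchanging \<open>x_0\<close> with a variable \<open>x_l0\<close> that does not occur in a
  monomial \<open>x_0 x^m\<close> with exactly one further variable produces a second further
  variable, so this term is \<open>o(1/N)\<close> by \<open>bound2\<close>.
\<close>
lemma bound1_Suc: "bound1 (Suc k)"
  unfolding bound1_def
proof safe
  fix m assume m: "card (others m) = 1"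
  obtain l0 where l0: "l0 \<notin> insert 0 (set_mset m)"
    using ex_new_if_finite[of "insert 0 (set_mset m)"] by auto
  have split: "convergent (\<lambda>N. of_nat N * (\<Sum>(u, v)\<in>msplits m. lam N u * C N k v))"
  proof (unfold sum_distrib_left case_prod_unfold, intro convergent_sum)
    fix p assume p: "p \<in> msplits m"
    show "convergent (\<lambda>N. of_nat N * (lam N (fst p) * C N k (snd p)))"
    proof (cases "others (fst p) = {}")
      case True
      with p have "others (snd p) = others m" by (auto simp: msplits_def others_def)
      then have "convergent (\<lambda>N. of_nat N * C N k (snd p))"
        using IH(2) m by (simp add: bound1_def)
      then have "convergent (\<lambda>N. lam N (fst p) * (of_nat N * C N k (snd p)))"
        by (rule convergent_mult[OF convergent_lam])
      then show ?thesis by (simp add: mult_ac)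
    next
      case False
      then have "negl (\<lambda>N. lam N (fst p) * C N k (snd p))" by (intro negl_mult' lam_mixed convergent_C)
      then show ?thesis unfolding negl_def convergent_def by blast
    qed
  qed
  have fresh: "convergent (\<lambda>N. of_nat N * (C N k (add_mset 0 m) - C N k (relabel 0 l0 (add_mset 0 m))))"
  proof -
    have "others (add_mset 0 m) = others m" by (auto simp: others_def)
    then have A: "convergent (\<lambda>N. of_nat N * C N k (add_mset 0 m))" using IH(2) m by (auto simp: bound1_def)
    have "insert l0 (others m) \<subseteq> others (relabel 0 l0 (add_mset 0 m))"
    proof
      fix x assume x: "x \<in> insert l0 (others m)"
      show "x \<in> others (relabel 0 l0 (add_mset 0 m))"
      proof (cases "x = l0")
        case True
        then show ?thesis using l0 by (auto simp: others_def)
      next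
        case False
        with x have "Transposition.transpose 0 l0 x = x" by (auto simp: others_def Transposition.transpose_def)
        then show ?thesis using x False by (force simp: others_def)
      qed
    qed
    then have "card (insert l0 (others m)) \<le> card (others (relabel 0 l0 (add_mset 0 m)))"
      by (rule card_mono[OF finite_others])
    moreover have "l0 \<notin> others m" using l0 by (auto simp: others_def)
    ultimately have "2 \<le> card (others (relabel 0 l0 (add_mset 0 m)))"
      using m by simp
    then have "negl (\<lambda>N. C N k (relabel 0 l0 (add_mset 0 m)))"
      using IH(1) by (simp add: bound2_def)
    then have "convergent (\<lambda>N. of_nat N * C N k (relabel 0 l0 (add_mset 0 m)))"
      unfolding negl_def convergent_def by blast
    with A show ?thesis unfolding right_diff_distrib by (rule convergent_diff)
  qed
  have main: "convergent (\<lambda>N. of_nat N * (\<Sum>(u, v)\<in>msplits m. lam N u * C N k v)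
        + of_nat (Suc (count m 0)) * C N k (add_mset 0 m)
        + (\<Sum>l\<in>others m. \<Sum>j\<le>count m l.
            C N k (move j l 0 m)
            - C N k (relabel 0 l (move j l 0 m)))
        + (1 - 1 / of_nat N * of_nat (Suc (card (others m)))) *
            (of_nat N * (C N k (add_mset 0 m) - C N k (relabel 0 l0 (add_mset 0 m)))))"
    by (intro convergent_add convergent_mult convergent_sum convergent_diff split fresh convergent_C
          convergent_fresh_factor convergent_const)
  have ev: "\<forall>\<^sub>F N in sequentially. of_nat N * C N (Suc k) m = of_nat N * (\<Sum>(u, v)\<in>msplits m. lam N u * C N k v)
        + of_nat (Suc (count m 0)) * C N k (add_mset 0 m)
        + (\<Sum>l\<in>others m. \<Sum>j\<le>count m l.
            C N k (move j l 0 m)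
            - C N k (relabel 0 l (move j l 0 m)))
        + (1 - 1 / of_nat N * of_nat (Suc (card (others m)))) *
            (of_nat N * (C N k (add_mset 0 m) - C N k (relabel 0 l0 (add_mset 0 m))))"
  proof -
    have alg: "x * (S + 1 / x * a + 1 / x * b + c * F) = x * S + a + b + c * (x * F)"
      if "x \<noteq> 0" for x S a b c F :: complex
      using that by (simp add: distrib_left)
    have "l0 \<noteq> 0" "l0 \<notin># m" using l0 by auto
    from C_Suc_fresh[OF this, of k] eventually_gt_at_top[of 0] show ?thesis
    proof eventually_elim
      case (elim N)
      show ?case unfolding elim(1) by (rule alg) (use elim(2) in simp)
    qed
  qed
  show "convergent (\<lambda>N. of_nat N * C N (Suc k) m)"
    using main tendsto_cong[OF ev] by (simp add: convergent_def)
qed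

lemma sum_msplits_pur:
  "(\<Sum>(u, v)\<in>msplits (pur p). g u v) = (\<Sum>q\<le>p. g (pur q) (pur (p - q)) :: complex)"
proof (rule sum.reindex_bij_witness[of _ "\<lambda>q. (pur q, pur (p - q))" "\<lambda>(u, v). size u"])
  fix x assume x: "x \<in> msplits (pur p)"
  obtain u v where uv: "x = (u, v)" by (cases x)
  have sum: "u + v = pur p" using x uv by (simp add: msplits_def)
  have "set_mset (u + v) \<subseteq> {0}" unfolding sum by (simp split: if_splits)
  then have "others u = {}" "others v = {}" by (auto simp: others_def)
  then obtain a b where ab: "u = pur a" "v = pur b" by (auto simp: others_empty_iff)
  have "a + b = p" using arg_cong[OF sum, of size] ab by simp
  then have b: "b = p - a" "a \<le> p" by auto
  show "(case case x of (u, v) \<Rightarrow> size u of q \<Rightarrow> (pur q, pur (p - q))) = x"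
    "(case x of (u, v) \<Rightarrow> size u) \<in> {..p}"
    "g (pur (case x of (u, v) \<Rightarrow> size u)) (pur (p - (case x of (u, v) \<Rightarrow> size u))) = (case x of (u, v) \<Rightarrow> g u v)"
    using b by (simp_all add: uv ab)
qed (auto simp: msplits_def simp flip: replicate_mset_add)

lemma sum_msplits_two:
  assumes s: "s \<ge> 1"
  shows "(\<Sum>(u, v)\<in>{(u, v) \<in> msplits (two a s). others u = {}}. g u v)
      = (\<Sum>q\<le>a. g (pur q) (two (a - q) s) :: complex)"
proof (rule sum.reindex_bij_witness[of _ "\<lambda>q. (pur q, two (a - q) s)" "\<lambda>(u, v). size u"])
  fix x assume x: "x \<in> {(u, v) \<in> msplits (two a s). others u = {}}"
  obtain u v where uv: "x = (u, v)" by (cases x)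
  have sum: "u + v = two a s" and "others u = {}" using x uv by (auto simp: msplits_def)
  then obtain q where q: "u = pur q" by (auto simp: others_empty_iff)
  have "q \<le> a" using arg_cong[OF sum, of "\<lambda>m. count m 0"] by (simp add: q)
  then have "u + two (a - q) s = two a s"
    unfolding q add.assoc[symmetric] replicate_mset_add[symmetric] by simp
  with sum have v: "v = two (a - q) s" by (metis add_left_cancel)
  show "(case case x of (u, v) \<Rightarrow> size u of q \<Rightarrow> (pur q, two (a - q) s)) = x"
    "(case x of (u, v) \<Rightarrow> size u) \<in> {..a}"
    "g (pur (case x of (u, v) \<Rightarrow> size u)) (two (a - (case x of (u, v) \<Rightarrow> size u)) s) = (case x of (u, v) \<Rightarrow> g u v)"
    using \<open>q \<le> a\<close> by (simp_all add: uv q v)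
next
  fix q assume "q \<in> {..a}"
  then have "pur q + two (a - q) s = two a s"
    unfolding add.assoc[symmetric] replicate_mset_add[symmetric] by simp
  then show "(pur q, two (a - q) s) \<in> {(u, v) \<in> msplits (two a s). others u = {}}"
    by (auto simp: msplits_def others_empty_iff)
qed auto

text \<open>
  Among the terms of the divided difference between \<open>x_0\<close> and \<open>x_1\<close> just
  one survives to precision \<open>o(1/N)\<close>: the one where all the factors \<open>x_1\<close>
  are turned into \<open>x_0\<close>.
\<close>
lemma C_Suc_two:
  assumes s: "s \<ge> 1"
  shows "negl (\<lambda>N. C N (Suc k) (two a s) - ((\<Sum>q\<le>a. lam N (pur q) * C N k (two (a - q) s))
      + 1 / of_nat N * C N k (pur (Suc (a + s))) + C N k (two (Suc a) s)))"
proof -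
  define mj where "mj j = two a s - replicate_mset j 1 + replicate_mset (Suc j) 0" for j
  define sw where "sw l m = relabel 0 l m" for l :: nat and m
  have mj: "mj j = two (a + Suc j) (s - j)" if "j \<le> s" for j
    by (rule multiset_eqI) (use that in \<open>auto simp: mj_def\<close>)
  have O_sw: "others (sw 1 (mj j)) \<noteq> {}" for j
    by (force simp: others_def sw_def mj_def)
  have O_fresh: "2 \<le> card (others (sw 2 (two (Suc a) s)))"
  proof -
    have "{1, 2} \<subseteq> others (sw 2 (two (Suc a) s))"
      using s by (auto simp: others_def sw_def Transposition.transpose_def image_iff split: if_splits)
    from card_mono[OF finite_others this] show ?thesis by simp
  qed
  have "negl (\<lambda>N. \<Sum>x\<in>{(u, v) \<in> msplits (two a s). others u \<noteq> {}}. lam N (fst x) * C N k (snd x))"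
    by (intro negl_sum negl_mult' lam_mixed convergent_C) auto
  moreover have "negl (\<lambda>N. 1 / of_nat N * (of_nat (Suc a) * C N k (two (Suc a) s)))"
    using s by (intro negl_inverse_n tendsto_mult_right_zero C_mixed) (simp add: others_two del: One_nat_def replicate_mset_Suc)
  moreover have "negl (\<lambda>N. 1 / of_nat N * ((\<Sum>j<s. C N k (mj j) - C N k (sw 1 (mj j))) - C N k (sw 1 (mj s))))"
  proof (rule negl_inverse_n)
    have "(\<lambda>N. C N k (mj j) - C N k (sw 1 (mj j))) \<longlonglongrightarrow> 0 - 0" if "j < s" for j
      using that by (intro tendsto_diff C_mixed O_sw) (simp add: mj others_two del: One_nat_def replicate_mset_Suc add_Suc_right)
    then have "(\<lambda>N. (\<Sum>j<s. C N k (mj j) - C N k (sw 1 (mj j))) - C N k (sw 1 (mj s))) \<longlonglongrightarrow> (\<Sum>j<s. 0 - 0) - 0"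
      by (intro tendsto_diff[OF tendsto_sum C_mixed[OF O_sw]]) auto
    then show "(\<lambda>N. (\<Sum>j<s. C N k (mj j) - C N k (sw 1 (mj j))) - C N k (sw 1 (mj s))) \<longlonglongrightarrow> 0" by simp
  qed
  moreover have "negl (\<lambda>N. 1 / of_nat N * (2 * C N k (two (Suc a) s)))"
    using s by (intro negl_inverse_n tendsto_mult_right_zero C_mixed) (simp add: others_two del: One_nat_def replicate_mset_Suc)
  moreover have "negl (\<lambda>N. (1 - 1 / of_nat N * of_nat 2) * C N k (sw 2 (two (Suc a) s)))"
    using IH(1) O_fresh by (intro negl_mult convergent_fresh_factor) (auto simp: bound2_def)
  ultimately have *: "negl (\<lambda>N. (\<Sum>x\<in>{(u, v) \<in> msplits (two a s). others u \<noteq> {}}. lam N (fst x) * C N k (snd x))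
      + 1 / of_nat N * (of_nat (Suc a) * C N k (two (Suc a) s))
      + 1 / of_nat N * ((\<Sum>j<s. C N k (mj j) - C N k (sw 1 (mj j))) - C N k (sw 1 (mj s)))
      - 1 / of_nat N * (2 * C N k (two (Suc a) s))
      - (1 - 1 / of_nat N * of_nat 2) * C N k (sw 2 (two (Suc a) s)))"
    by (intro negl_add negl_diff)
  have "2 \<noteq> (0::nat)" "2 \<notin># two a s" by (auto split: if_splits)
  note rec = C_Suc_fresh[OF this, of k]
  have "\<forall>\<^sub>F N in sequentially. C N (Suc k) (two a s) - ((\<Sum>q\<le>a. lam N (pur q) * C N k (two (a - q) s))
      + 1 / of_nat N * C N k (pur (Suc (a + s))) + C N k (two (Suc a) s))
      = (\<Sum>x\<in>{(u, v) \<in> msplits (two a s). others u \<noteq> {}}. lam N (fst x) * C N k (snd x))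
      + 1 / of_nat N * (of_nat (Suc a) * C N k (two (Suc a) s))
      + 1 / of_nat N * ((\<Sum>j<s. C N k (mj j) - C N k (sw 1 (mj j))) - C N k (sw 1 (mj s)))
      - 1 / of_nat N * (2 * C N k (two (Suc a) s))
      - (1 - 1 / of_nat N * of_nat 2) * C N k (sw 2 (two (Suc a) s))"
    using rec
  proof eventually_elim
    case (elim N)
    have 1: "others (two a s) = {1}" "count (two a s) 0 = a" "count (two a s) 1 = s"
      using s by (simp_all add: others_two del: One_nat_def) 
    have 2: "add_mset 0 (two a s) = two (Suc a) s" by simp
    have "msplits (two a s) = {(u, v) \<in> msplits (two a s). others u = {}} \<union> {(u, v) \<in> msplits (two a s). others u \<noteq> {}}"
      by auto
    then have "(\<Sum>x\<in>msplits (two a s). lam N (fst x) * C N k (snd x))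
        = (\<Sum>x\<in>{(u, v) \<in> msplits (two a s). others u = {}}. lam N (fst x) * C N k (snd x))
        + (\<Sum>x\<in>{(u, v) \<in> msplits (two a s). others u \<noteq> {}}. lam N (fst x) * C N k (snd x))"
      by (subst sum.union_disjoint[symmetric]) (auto intro: finite_subset[OF _ finite_msplits[of "two a s"]])
    then have 3: "(\<Sum>(u, v)\<in>msplits (two a s). lam N u * C N k v)
        = (\<Sum>q\<le>a. lam N (pur q) * C N k (two (a - q) s))
        + (\<Sum>x\<in>{(u, v) \<in> msplits (two a s). others u \<noteq> {}}. lam N (fst x) * C N k (snd x))"
      using sum_msplits_two[OF s, of "\<lambda>u v. lam N u * C N k v" a] by (simp add: case_prod_unfold)
    have 4: "(\<Sum>j\<le>s. C N k (mj j) - C N k (sw 1 (mj j)))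
        = (\<Sum>j<s. C N k (mj j) - C N k (sw 1 (mj j))) - C N k (sw 1 (mj s)) + C N k (pur (Suc (a + s)))"
      using mj[of s] by (simp flip: lessThan_Suc_atMost)
    have 5: "Suc (card {1::nat}) = 2" by simp
    have *: "C N (Suc k) (two a s) = (\<Sum>q\<le>a. lam N (pur q) * C N k (two (a - q) s))
        + (\<Sum>x\<in>{(u, v) \<in> msplits (two a s). others u \<noteq> {}}. lam N (fst x) * C N k (snd x))
        + 1 / of_nat N * (of_nat (Suc a) * C N k (two (Suc a) s))
        + 1 / of_nat N * ((\<Sum>j<s. C N k (mj j) - C N k (sw 1 (mj j))) - C N k (sw 1 (mj s)) + C N k (pur (Suc (a + s))))
        + (1 - 1 / of_nat N * of_nat 2) * (C N k (two (Suc a) s) - C N k (sw 2 (two (Suc a) s)))"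
      unfolding elim 1 2 3 5 mj_def[symmetric] sw_def[symmetric] 4[symmetric]
      unfolding sum.insert[OF finite.emptyI, of 1, simplified] by (simp add: 1 mj_def)
    have alg: "S + M + i * x + i * (J + P) + (1 - i * 2) * (T - w) - (S + i * P + T)
        = M + i * x + i * J - i * (2 * T) - (1 - i * 2) * w" for S M i x J P T w :: complex
      by (simp add: algebra_simps)
    show ?case unfolding * of_nat_numeral by (rule alg)
  qed
  with * show ?thesis by (rule negl_transfer)
qed

text \<open>
  The term \<open>C(x_1^(p+1))\<close> that disturbs the recursion for the powers of
  \<open>x_0\<close> is the summand \<open>s = p + 1\<close> of the correction of
  \<open>chat N k (Suc p)\<close>, and the remaining summands come from the recursions for
  \<open>x_0^(p-s) x_1^s\<close>. The terms \<open>N^(-1) C(x_0^(p+1))\<close> appear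
  \<open>p + 1\<close> times with \<open>+\<close> from the derivative, once with \<open>-\<close>
  from the representative variable and \<open>p\<close> times with \<open>-\<close> from the
  correction, so they cancel.
\<close>
lemma chat_Suc:
  "negl (\<lambda>N. chat N (Suc k) p - ((\<Sum>q\<le>p. lam N (pur q) * chat N k (p - q)) + chat N k (Suc p)))"
proof -
  define e where "e s N = C N (Suc k) (two (p - s) s) - ((\<Sum>q\<le>p - s. lam N (pur q) * C N k (two (p - s - q) s))
      + 1 / of_nat N * C N k (pur (Suc (p - s + s))) + C N k (two (Suc (p - s)) s))" for s N
  have e: "negl (\<lambda>N. \<Sum>s\<in>{1..p}. e s N)"
    unfolding e_def by (intro negl_sum C_Suc_two) auto
  have "negl (\<lambda>N. 1 / of_nat N * C N k (two 0 (Suc p)) - (\<Sum>s\<in>{1..p}. e s N))"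
    by (intro negl_diff e negl_inverse_n C_mixed) (auto simp: others_def)
  moreover have "\<forall>\<^sub>F N in sequentially. chat N (Suc k) p - ((\<Sum>q\<le>p. lam N (pur q) * chat N k (p - q)) + chat N k (Suc p))
      = 1 / of_nat N * C N k (two 0 (Suc p)) - (\<Sum>s\<in>{1..p}. e s N)"
  proof -
    have "1 \<noteq> (0::nat)" "1 \<notin># pur p" by (auto split: if_splits)
    from C_Suc_fresh[OF this, of k] show ?thesis
    proof eventually_elim
      case (elim N)
      have 1: "others (pur p) = {}" "count (pur p) 0 = p" by (auto simp: others_empty_iff)
      have 2: "add_mset 0 (pur p) = pur (Suc p)" by simp
      have 3: "relabel 0 1 (pur (Suc p)) = two 0 (Suc p)" by simp
      have 4: "C N (Suc k) (pur p) = (\<Sum>q\<le>p. lam N (pur q) * C N k (pur (p - q)))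
          + 1 / of_nat N * (of_nat (Suc p) * C N k (pur (Suc p)))
          + (1 - 1 / of_nat N) * (C N k (pur (Suc p)) - C N k (two 0 (Suc p)))"
        unfolding elim sum_msplits_pur 1 2 3 by simp
      have 5: "C N (Suc k) (two (p - s) s) = (\<Sum>q\<le>p - s. lam N (pur q) * C N k (two (p - s - q) s))
            + 1 / of_nat N * C N k (pur (Suc p)) + C N k (two (Suc p - s) s) + e s N" if "s \<in> {1..p}" for s
        using that by (simp add: e_def Suc_diff_le)
      have 6: "(\<Sum>s\<in>{1..p}. \<Sum>q\<le>p - s. lam N (pur q) * C N k (two (p - s - q) s))
          = (\<Sum>q\<le>p. lam N (pur q) * (\<Sum>s\<in>{1..p - q}. C N k (two (p - q - s) s)))"
        unfolding sum_distrib_left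
        by (subst (1 2) sum.Sigma, simp, simp, simp, simp)
           (rule sum.reindex_bij_witness[of _ "\<lambda>(q, s). (s, q)" "\<lambda>(s, q). (q, s)"], auto simp: diff_right_commute add.commute)
      have 7: "(\<Sum>s\<in>{1..p}. C N (Suc k) (two (p - s) s))
          = (\<Sum>q\<le>p. lam N (pur q) * (\<Sum>s\<in>{1..p - q}. C N k (two (p - q - s) s)))
          + of_nat p * (1 / of_nat N * C N k (pur (Suc p)))
          + (\<Sum>s\<in>{1..p}. C N k (two (Suc p - s) s)) + (\<Sum>s\<in>{1..p}. e s N)"
      proof -
        have "(\<Sum>s\<in>{1..p}. C N (Suc k) (two (p - s) s)) = (\<Sum>s\<in>{1..p}. (\<Sum>q\<le>p - s. lam N (pur q) * C N k (two (p - s - q) s))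
            + 1 / of_nat N * C N k (pur (Suc p)) + C N k (two (Suc p - s) s) + e s N)"
          by (rule sum.cong[OF refl 5])
        then show ?thesis unfolding 6[symmetric] sum.distrib by simp
      qed
      have 8: "(\<Sum>q\<le>p. lam N (pur q) * chat N k (p - q)) = (\<Sum>q\<le>p. lam N (pur q) * C N k (pur (p - q)))
          - (\<Sum>q\<le>p. lam N (pur q) * (\<Sum>s\<in>{1..p - q}. C N k (two (p - q - s) s)))"
        by (simp add: chat_def right_diff_distrib sum_subtractf)
      have 9: "chat N k (Suc p) = C N k (pur (Suc p)) - ((\<Sum>s\<in>{1..p}. C N k (two (Suc p - s) s)) + C N k (two 0 (Suc p)))"
        unfolding chat_def by simp
      have 10: "chat N (Suc k) p = C N (Suc k) (pur p) - (\<Sum>s\<in>{1..p}. C N (Suc k) (two (p - s) s))"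
        by (simp add: chat_def)
      have alg: "(A + i * ((1 + n) * c) + (1 - i) * (c - t)) - (B + n * (i * c) + D + E) - ((A - B) + (c - (D + t))) = i * t - E"
        for A B D E c t i n :: complex
        by (simp add: algebra_simps)
      show ?case unfolding 8 9 10 4 7 of_nat_Suc by (rule alg)
    qed
  qed
  ultimately show ?thesis by (rule negl_transfer)
qed

lemma approx_Suc: "approx (Suc k)"
  unfolding approx_def
proof
  fix p
  have IH3: "negl (\<lambda>N. chat N k p - alpha (psiN N) k p)" for p using IH(3) by (simp add: approx_def)
  have "negl (\<lambda>N. (chat N (Suc k) p - ((\<Sum>q\<le>p. lam N (pur q) * chat N k (p - q)) + chat N k (Suc p)))
      + (\<Sum>q\<le>p. (lam N (pur q) - psiN N q) * chat N k (p - q) + psiN N q * (chat N k (p - q) - alpha (psiN N) k (p - q)))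
      + (chat N k (Suc p) - alpha (psiN N) k (Suc p)))"
    by (intro negl_add negl_sum chat_Suc negl_mult' negl_mult[OF convergentI[OF tendsto_psiN]] convergent_chat IH3
         lam_pure[folded psiN_def])
  then show "negl (\<lambda>N. chat N (Suc k) p - alpha (psiN N) (Suc k) p)"
    by (rule back_subst[of negl]) (auto simp: algebra_simps sum.distrib sum_subtractf)
qed

end

lemma bounds: "bound2 k \<and> bound1 k \<and> approx k"
proof (induction k)
  case 0
  have C0: "negl (\<lambda>N. C N 0 m)" if "m \<noteq> {#}" for m
    using negl_cong[OF C_0[of m]] that by (simp add: negl_0)
  have C0': "negl (\<lambda>N. C N 0 m)" if "card (others m) \<noteq> 0" for m
    using that by (intro C0) (auto simp: others_def)
  then have "bound2 0" unfolding bound2_def by (metis not_numeral_le_zero)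
  moreover from C0' have "bound1 0"
    unfolding bound1_def convergent_def negl_def by (metis one_neq_zero)
  moreover have "approx 0"
    unfolding approx_def
  proof
    fix p
    have "negl (\<lambda>N. (C N 0 (pur p) - alpha (psiN N) 0 p) - (\<Sum>s\<in>{1..p}. C N 0 (two (p - s) s)))"
    proof (rule negl_diff, goal_cases)
      case 1
      show ?case
        by (subst negl_cong[where b = "\<lambda>_. 0"]) (use C_0[of "pur p"] in \<open>auto simp: negl_0 elim: eventually_mono\<close>)
    next
      case 2
      show ?case by (intro negl_sum C0) auto
    qed
    then show "negl (\<lambda>N. chat N 0 p - alpha (psiN N) 0 p)"
      by (simp add: chat_def algebra_simps)
  qed
  ultimately show ?case by simp
next
  case (Suc k)
  then show ?case using bound2_Suc bound1_Suc approx_Suc by blast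
qed

theorem C_constant_term: "negl (\<lambda>N. C N k {#} - alpha (psiN N) k 0)"
  using bounds[of k] by (auto simp: approx_def chat_def dest: spec[of _ 0])

end

section \<open>The limiting numbers as residues\<close>

text \<open>
  A variant of Lagrange inversion. Put \<open>K(z) = 1/z + \<psi>(z)\<close>, so that the recursion
  reads \<open>\<alpha>_(k+1) = K \<alpha>_k - \<alpha>_k(0)/z\<close>. The numbers
  \<open>R_(n,k) = Res z K' K^n \<alpha>_k\<close> satisfy \<open>R_(n,k+1) = R_(n+1,k)\<close>,
  because \<open>K' K^n\<close> is a multiple of a derivative and has no residue. Therefore
  \<open>R_(0,k) = R_(k,0)\<close>; the former is \<open>- \<alpha>_k(0)\<close>, because the pole
  part of \<open>z K'\<close> is \<open>-1/z\<close>, and the latter is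
  \<open>Res z K' K^k = - Res K^(k+1) / (k + 1)\<close> by partial integration.
\<close>
lemma alpha_residue:
  fixes \<psi> :: "nat \<Rightarrow> complex"
  defines "K \<equiv> fls_X_inv + fps_to_fls (Abs_fps \<psi>)"
  shows "of_nat (Suc k) * alpha \<psi> k 0 = fls_nth (K ^ Suc k) (- 1)"
proof -
  define F where "F = fps_to_fls (Abs_fps \<psi>)"
  define A where "A k = fps_to_fls (Abs_fps (alpha \<psi> k))" for k
  define R where "R n k = fls_nth (fls_X * fls_deriv K * K ^ n * A k) (- 1)" for n k
  have K: "K = fls_X_inv + F" by (simp add: K_def F_def)
  have A0: "A 0 = 1" by (rule fls_eqI) (auto simp: A_def)
  have ASuc: "A (Suc k) = K * A k - fls_const (alpha \<psi> k 0) * fls_X_inv" for k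
  proof (rule fls_eqI)
    fix n :: int
    have "F * A k = fps_to_fls (Abs_fps \<psi> * Abs_fps (alpha \<psi> k))"
      by (simp add: F_def A_def fls_times_fps_to_fls)
    then have FA: "fls_nth (F * A k) n = (if n < 0 then 0 else (\<Sum>q\<le>nat n. \<psi> q * alpha \<psi> k (nat n - q)))"
      by (simp add: fps_mult_nth atMost_atLeast0)
    have XA: "fls_nth (fls_X_inv * A k) n = fls_nth (A k) (n + 1)"
      by (simp add: fls_X_inv_times_conv_shift)
    show "fls_nth (A (Suc k)) n = fls_nth (K * A k - fls_const (alpha \<psi> k 0) * fls_X_inv) n"
      unfolding K distrib_right fls_minus_nth fls_plus_nth FA XA
      by (auto simp: A_def nat_add_distrib)
  qed
  have dK: "fls_nth (fls_deriv K * K ^ n) (- 1) = 0" for n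
  proof -
    have "fls_deriv (K ^ Suc n) = of_nat (Suc n) * (fls_deriv K * K ^ n)"
      by (subst fls_deriv_power) (simp add: mult_ac)
    then have "of_nat (Suc n) * fls_nth (fls_deriv K * K ^ n) (- 1) = fls_nth (fls_deriv (K ^ Suc n)) (- 1)"
      by (simp add: fls_of_nat del: of_nat_Suc fls_deriv_nth)
    also have "\<dots> = 0" by (rule fls_deriv_residue)
    finally show ?thesis by (simp del: of_nat_Suc)
  qed
  have R: "R n (Suc k) = R (Suc n) k" for n k
  proof -
    have XX: "fls_X * fls_X_inv = (1 :: complex fls)" by (simp add: fls_X_times_conv_shift fls_X_inv_conv_shift_1)
    have "fls_X * fls_deriv K * K ^ n * A (Suc k)
        = fls_X * fls_deriv K * K ^ Suc n * A k - fls_const (alpha \<psi> k 0) * ((fls_X * fls_X_inv) * (fls_deriv K * K ^ n))"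
      unfolding ASuc by (simp add: algebra_simps)
    then show ?thesis unfolding R_def XX by (simp add: dK)
  qed
  have "R n k = R (n + k) 0" for n
    by (induction k arbitrary: n) (simp_all add: R)
  from this[of 0] have RR: "R 0 k = R k 0" by simp
  have "fls_X * fls_deriv K = - fls_X_inv + fls_X * fls_deriv F"
  proof -
    have "fls_X * fls_deriv fls_X_inv = (- fls_X_inv :: complex fls)"
      by (rule fls_eqI) (auto simp: fls_X_times_conv_shift)
    then show ?thesis unfolding K by (simp add: right_diff_distrib)
  qed
  then have "R 0 k = fls_nth (- fls_X_inv * A k) (- 1) + fls_nth (fls_X * fls_deriv F * A k) (- 1)"
    by (simp add: R_def left_diff_distrib)
  also have "fls_X * fls_deriv F * A k = fps_to_fls (fps_X * fps_deriv (Abs_fps \<psi>) * Abs_fps (alpha \<psi> k))"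
    by (simp add: F_def A_def fls_times_fps_to_fls fls_deriv_fps_to_fls)
  also have "fls_nth (- fls_X_inv * A k) (- 1) = - alpha \<psi> k 0"
    by (simp add: fls_X_inv_times_conv_shift A_def)
  finally have R0: "R 0 k = - alpha \<psi> k 0" by simp
  have "of_nat (Suc k) * R k 0 = fls_nth (fls_X * fls_deriv (K ^ Suc k)) (- 1)"
  proof -
    have "fls_X * fls_deriv (K ^ Suc k) = of_nat (Suc k) * (fls_X * fls_deriv K * K ^ k)"
      by (subst fls_deriv_power) (simp add: mult_ac)
    then show ?thesis by (simp only: R_def A0 fls_of_nat fls_mult_const_nth mult_1_right)
  qed
  also have "\<dots> = - fls_nth (K ^ Suc k) (- 1)"
    unfolding fls_X_times_conv_shift fls_shift_nth fls_deriv_nth by simp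
  finally have *: "of_nat (Suc k) * R k 0 = - fls_nth (K ^ Suc k) (- 1)" .
  have "alpha \<psi> k 0 = - R k 0" by (metis RR R0 minus_minus)
  then show ?thesis unfolding mult_minus_right by (simp only: mult_minus_right * minus_minus)
qed

text \<open>
  The binomial expansion of \<open>(1/z + \<psi>(z))^(k+1)\<close> in the residue. The summand with
  no factor \<open>\<psi>\<close> has no residue when \<open>k \<ge> 1\<close>, which is where the
  hypothesis enters.
\<close>
lemma alpha_explicit:
  fixes \<psi> :: "nat \<Rightarrow> complex"
  assumes "k \<ge> 1"
  shows "alpha \<psi> k 0 = (\<Sum>m<k. of_nat (Suc k choose Suc m) / of_nat (Suc k) * fps_nth (Abs_fps \<psi> ^ (k - m)) m)"
proof -
  define F where "F = Abs_fps \<psi>"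
  have "of_nat (Suc k) * alpha \<psi> k 0 = fls_nth ((fls_X_inv + fps_to_fls F) ^ Suc k) (- 1)"
    unfolding F_def by (rule alpha_residue)
  also have "\<dots> = (\<Sum>j\<le>Suc k. of_nat (Suc k choose j) * fls_nth (fls_X_inv ^ j * fps_to_fls (F ^ (Suc k - j))) (- 1))"
    unfolding binomial_ring
    by (simp add: fls_nth_sum fls_of_nat mult.assoc fps_to_fls_power del: sum.atMost_Suc binomial_Suc_Suc)
  also have "\<dots> = (\<Sum>j\<le>Suc k. of_nat (Suc k choose j) * (if j = 0 then 0 else fps_nth (F ^ (Suc k - j)) (j - 1)))"
    by (intro sum.cong refl) (auto simp: fls_X_inv_power_times_conv_shift nat_diff_distrib)
  also have "\<dots> = (\<Sum>m\<le>k. of_nat (Suc k choose Suc m) * fps_nth (F ^ (k - m)) m)"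
    by (subst sum.atMost_Suc_shift) simp
  also have "\<dots> = (\<Sum>m<k. of_nat (Suc k choose Suc m) * fps_nth (F ^ (k - m)) m)"
    using assms by (simp flip: lessThan_Suc_atMost)
  finally show ?thesis
    by (simp add: F_def sum_divide_distrib[symmetric] field_simps del: of_nat_Suc binomial_Suc_Suc)
qed

lemma has_field_derivative_fps_power:
  fixes P Q :: "complex fps"
  shows "((\<lambda>\<epsilon>. fps_nth ((P + fps_const \<epsilon> * Q) ^ n) m) has_field_derivative
            of_nat n * fps_nth (P ^ (n - 1) * Q) m) (at 0)"
proof (induction n arbitrary: m)
  case (Suc n)
  have "((\<lambda>\<epsilon>. \<Sum>i=0..m. fps_nth (P + fps_const \<epsilon> * Q) i * fps_nth ((P + fps_const \<epsilon> * Q) ^ n) (m - i)) has_field_derivative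
      (\<Sum>i=0..m. fps_nth (P + fps_const 0 * Q) i * (of_nat n * fps_nth (P ^ (n - 1) * Q) (m - i))
           + fps_nth Q i * fps_nth ((P + fps_const 0 * Q) ^ n) (m - i))) (at 0)"
    by (intro DERIV_sum DERIV_mult' Suc.IH) (auto intro!: derivative_eq_intros)
  also have "(\<Sum>i=0..m. fps_nth (P + fps_const 0 * Q) i * (of_nat n * fps_nth (P ^ (n - 1) * Q) (m - i))
           + fps_nth Q i * fps_nth ((P + fps_const 0 * Q) ^ n) (m - i))
      = of_nat n * fps_nth (P * (P ^ (n - 1) * Q)) m + fps_nth (Q * P ^ n) m"
    by (simp add: fps_mult_nth sum.distrib sum_distrib_left mult_ac)
  also have "of_nat n * fps_nth (P * (P ^ (n - 1) * Q)) m = of_nat n * fps_nth (P ^ n * Q) m"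
    by (cases n) (simp_all add: mult_ac)
  also have "\<dots> + fps_nth (Q * P ^ n) m = of_nat (Suc n) * fps_nth (P ^ (Suc n - 1) * Q) m"
    by (simp add: algebra_simps)
  finally show ?case by (simp add: fps_mult_nth)
qed simp

lemma has_fps_expansion_power:
  fixes f :: "complex \<Rightarrow> complex"
  assumes "f has_fps_expansion F"
  shows "(\<lambda>x. f x ^ n) has_fps_expansion F ^ n"
  by (induction n) (auto intro: fps_expansion_intros assms)

lemma mu_coeff_eq_alpha:
  assumes \<Psi>: "deriv \<Psi> has_fps_expansion Abs_fps \<psi>" and k: "k \<ge> 1"
  shows "mu_coeff \<Psi> k = alpha \<psi> k 0"
proof -
  have idx: "{0..k - 1} = {..<k}" using k by auto
  show ?thesis
    unfolding mu_coeff_def alpha_explicit[OF k] idx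
  proof (intro sum.cong refl)
    fix m assume m: "m \<in> {..<k}"
    have "(deriv ^^ m) (\<lambda>x. deriv \<Psi> x ^ (k - m)) 0 = fact m * fps_nth (Abs_fps \<psi> ^ (k - m)) m"
      using fps_nth_fps_expansion[OF has_fps_expansion_power[OF \<Psi>]] by simp
    moreover have "of_nat (Suc k choose Suc m) = (fact (Suc k) / (fact (Suc m) * fact (k - m)) :: complex)"
      using m by (subst binomial_fact) auto
    ultimately show "fact k / (fact m * fact (m + 1) * fact (k - m)) * (deriv ^^ m) (\<lambda>x. deriv \<Psi> x ^ (k - m)) 0
        = of_nat (Suc k choose Suc m) / of_nat (Suc k) * fps_nth (Abs_fps \<psi> ^ (k - m)) m"
      by (simp add: fact_Suc[of k] field_simps del: of_nat_Suc fact_Suc binomial_Suc_Suc)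
  qed
qed

text \<open>
  By the explicit formula, \<open>alpha\<close> is a polynomial in the coefficients of the series,
  so replacing \<open>\<psi>\<close> by \<open>\<psi> + \<epsilon> \<phi>\<close> with
  \<open>\<epsilon> = 1/N\<close> and rescaling by \<open>N\<close> yields a derivative in
  \<open>\<epsilon>\<close> at 0. The product rule turns \<open>\<psi>^(k-m)\<close> into
  \<open>(k - m) \<psi>^(k-m-1) \<phi>\<close>, and the factor \<open>k - m\<close> changes
  \<open>(k-m)!\<close> into \<open>(k-m-1)!\<close>.
\<close>
lemma alpha_perturbation:
  assumes \<Psi>: "deriv \<Psi> has_fps_expansion Abs_fps \<psi>" and \<Phi>: "deriv \<Phi> has_fps_expansion Abs_fps \<phi>"
    and k: "k \<ge> 1"
  shows "(\<lambda>N. of_nat N * (alpha (\<lambda>q. \<psi> q + 1 / of_nat N * \<phi> q) k 0 - alpha \<psi> k 0)) \<longlonglongrightarrow> mu'_coeff \<Psi> \<Phi> k"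
proof -
  define P where "P = Abs_fps \<psi>"
  define Q where "Q = Abs_fps \<phi>"
  define c where "c m = (of_nat (Suc k choose Suc m) / of_nat (Suc k) :: complex)" for m
  define M where "M \<epsilon> = (\<Sum>m<k. c m * fps_nth ((P + fps_const \<epsilon> * Q) ^ (k - m)) m)" for \<epsilon>
  have alpha_M: "alpha (\<lambda>q. \<psi> q + \<epsilon> * \<phi> q) k 0 = M \<epsilon>" for \<epsilon>
  proof -
    have "Abs_fps (\<lambda>q. \<psi> q + \<epsilon> * \<phi> q) = P + fps_const \<epsilon> * Q"
      by (rule fps_ext) (simp add: P_def Q_def)
    then show ?thesis unfolding alpha_explicit[OF k] M_def c_def by simp
  qed
  have idx: "{0..k - 1} = {..<k}" using k by auto
  have mu': "mu'_coeff \<Psi> \<Phi> k = (\<Sum>m<k. c m * (of_nat (k - m) * fps_nth (P ^ (k - m - 1) * Q) m))"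
    unfolding mu'_coeff_def idx
  proof (intro sum.cong refl)
    fix m assume m: "m \<in> {..<k}"
    have "(deriv ^^ m) (\<lambda>x. deriv \<Psi> x ^ (k - m - 1) * deriv \<Phi> x) 0 = fact m * fps_nth (P ^ (k - m - 1) * Q) m"
      using fps_nth_fps_expansion[OF has_fps_expansion_mult[OF has_fps_expansion_power[OF \<Psi>] \<Phi>]]
      by (simp add: P_def Q_def)
    moreover have "of_nat (Suc k choose Suc m) = (fact (Suc k) / (fact (Suc m) * fact (k - m)) :: complex)"
      using m by (subst binomial_fact) auto
    moreover have "fact (k - m) = (of_nat (k - m) * fact (k - m - 1) :: complex)"
      using m by (intro fact_reduce) auto
    moreover have "of_nat (k - m) \<noteq> (0 :: complex)" using m by simp
    ultimately show "fact k / (fact m * fact (m + 1) * fact (k - m - 1)) * (deriv ^^ m) (\<lambda>x. deriv \<Psi> x ^ (k - m - 1) * deriv \<Phi> x) 0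
        = c m * (of_nat (k - m) * fps_nth (P ^ (k - m - 1) * Q) m)"
      by (simp add: c_def fact_Suc[of k] field_simps del: of_nat_Suc fact_Suc binomial_Suc_Suc of_nat_diff)
  qed
  have "(M has_field_derivative mu'_coeff \<Psi> \<Phi> k) (at 0)"
    unfolding mu' M_def[abs_def]
    by (intro DERIV_sum DERIV_cmult has_field_derivative_fps_power)
  then have lim: "((\<lambda>h. (M h - M 0) / h) \<longlongrightarrow> mu'_coeff \<Psi> \<Phi> k) (at 0)"
    by (simp add: DERIV_def)
  have "filterlim (\<lambda>N. 1 / of_nat N :: complex) (at 0) sequentially"
    unfolding filterlim_at
  proof
    show "(\<lambda>N. 1 / of_nat N :: complex) \<longlonglongrightarrow> 0" using lim_inverse_n by (simp add: inverse_eq_divide)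
    show "\<forall>\<^sub>F N in sequentially. 1 / of_nat N \<in> UNIV \<and> 1 / of_nat N \<noteq> (0 :: complex)"
      using eventually_gt_at_top[of 0] by eventually_elim simp
  qed
  from filterlim_compose[OF lim this]
  have "(\<lambda>N. (M (1 / of_nat N) - M 0) / (1 / of_nat N)) \<longlonglongrightarrow> mu'_coeff \<Psi> \<Phi> k" .
  moreover have "alpha \<psi> k 0 = M 0" using alpha_M[of 0] by simp
  ultimately show ?thesis unfolding alpha_M by (simp add: mult.commute)
qed

section \<open>Unitary matrices and invariance of the Haar measure\<close>

lemma mat_adjoint_carrier [simp]: "A \<in> carrier_mat n m \<Longrightarrow> mat_adjoint A \<in> carrier_mat m n"
  unfolding mat_adjoint_def by (auto simp: mat_of_rows_def)

lemma dim_mat_adjoint [simp]: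
  "dim_row (mat_adjoint A) = dim_col A" "dim_col (mat_adjoint A) = dim_row A"
  unfolding mat_adjoint_def by (auto simp: mat_of_rows_def)

lemma mat_adjoint_nth:
  fixes A :: "complex mat"
  assumes "A \<in> carrier_mat n n" "i < n" "j < n"
  shows "mat_adjoint A $$ (i, j) = cnj (A $$ (j, i))"
  using assms unfolding mat_adjoint_def by (auto simp: mat_of_rows_def vec_index_def[symmetric] conjugate_vec_def)

lemma mat_mult_nth:
  fixes A B :: "complex mat"
  assumes "A \<in> carrier_mat n n" "B \<in> carrier_mat n n" "i < n" "j < n"
  shows "(A * B) $$ (i, j) = (\<Sum>k<n. A $$ (i, k) * B $$ (k, j))"
  using assms by (auto simp: scalar_prod_def atLeast0LessThan intro!: sum.cong)

lemma mat_adjoint_adjoint: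
  fixes A :: "complex mat"
  assumes "A \<in> carrier_mat n n"
  shows "mat_adjoint (mat_adjoint A) = A"
  using assms by (intro eq_matI) (auto simp: mat_adjoint_nth[of _ n] mat_adjoint_nth[OF mat_adjoint_carrier])

lemma mat_adjoint_mult:
  fixes A B :: "complex mat"
  assumes "A \<in> carrier_mat n n" "B \<in> carrier_mat n n"
  shows "mat_adjoint (A * B) = mat_adjoint B * mat_adjoint A"
proof (rule eq_matI)
  have c: "A * B \<in> carrier_mat n n" "mat_adjoint A \<in> carrier_mat n n" "mat_adjoint B \<in> carrier_mat n n"
    "mat_adjoint B * mat_adjoint A \<in> carrier_mat n n" "mat_adjoint (A * B) \<in> carrier_mat n n"
    using assms by (auto intro!: carrier_matI)
  fix i j assume "i < dim_row (mat_adjoint B * mat_adjoint A)" "j < dim_col (mat_adjoint B * mat_adjoint A)"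
  then have ij: "i < n" "j < n" using c by auto
  show "mat_adjoint (A * B) $$ (i, j) = (mat_adjoint B * mat_adjoint A) $$ (i, j)"
    unfolding mat_adjoint_nth[OF c(1) ij] mat_mult_nth[OF c(3,2) ij] mat_mult_nth[OF assms ij(2,1)]
    by (auto intro!: sum.cong simp: mat_adjoint_nth[OF assms(1)] mat_adjoint_nth[OF assms(2)] ij mult.commute)
qed (use assms mat_adjoint_carrier[OF assms(1)] mat_adjoint_carrier[OF assms(2)] mat_adjoint_carrier[of "A * B" n n] in auto)

lemma unitary_carrier: "U \<in> unitary_group n \<Longrightarrow> U \<in> carrier_mat n n"
  by (simp add: unitary_group_def)

lemma unitary_adjoint: "U \<in> unitary_group n \<Longrightarrow> mat_adjoint U \<in> unitary_group n"
  by (auto simp: unitary_group_def mat_adjoint_adjoint)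

lemma unitary_mult:
  assumes "U \<in> unitary_group n" "V \<in> unitary_group n"
  shows "U * V \<in> unitary_group n"
proof -
  note c = unitary_carrier[OF assms(1)] unitary_carrier[OF assms(2)]
  note ca = mat_adjoint_carrier[OF c(1)] mat_adjoint_carrier[OF c(2)]
  have "(U * V) * (mat_adjoint V * mat_adjoint U) = U * (V * mat_adjoint V) * mat_adjoint U"
    unfolding assoc_mult_mat[OF c(1) c(2) mult_carrier_mat[OF ca(2) ca(1)]]
      assoc_mult_mat[OF c(2) ca(2) ca(1), symmetric] assoc_mult_mat[OF c(1) mult_carrier_mat[OF c(2) ca(2)] ca(1)] ..
  also have "\<dots> = 1\<^sub>m n" using assms c by (simp add: unitary_group_def)
  finally have 1: "(U * V) * (mat_adjoint V * mat_adjoint U) = 1\<^sub>m n" .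
  have "(mat_adjoint V * mat_adjoint U) * (U * V) = mat_adjoint V * (mat_adjoint U * U) * V"
    unfolding assoc_mult_mat[OF ca(2) ca(1) mult_carrier_mat[OF c(1) c(2)]]
      assoc_mult_mat[OF ca(1) c(1) c(2), symmetric] assoc_mult_mat[OF ca(2) mult_carrier_mat[OF ca(1) c(1)] c(2)] ..
  also have "\<dots> = 1\<^sub>m n" using assms c by (simp add: unitary_group_def)
  finally show ?thesis using 1 c by (auto simp: unitary_group_def mat_adjoint_mult)
qed

lemma unitary_cols:
  assumes "U \<in> unitary_group n" "a < n" "b < n"
  shows "(\<Sum>p<n. cnj (U $$ (p, a)) * U $$ (p, b)) = (if a = b then 1 else 0)"
proof -
  note c = unitary_carrier[OF assms(1)]
  have "(mat_adjoint U * U) $$ (a, b) = (if a = b then 1 else 0)" using assms by (simp add: unitary_group_def)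
  then show ?thesis
    unfolding mat_mult_nth[OF mat_adjoint_carrier[OF c] c assms(2,3)]
    by (simp add: mat_adjoint_nth[OF c] assms)
qed

lemma unitary_rows:
  assumes "U \<in> unitary_group n" "a < n" "b < n"
  shows "(\<Sum>p<n. U $$ (a, p) * cnj (U $$ (b, p))) = (if a = b then 1 else 0)"
proof -
  note c = unitary_carrier[OF assms(1)]
  have "(U * mat_adjoint U) $$ (a, b) = (if a = b then 1 else 0)" using assms by (simp add: unitary_group_def)
  then show ?thesis
    unfolding mat_mult_nth[OF c mat_adjoint_carrier[OF c] assms(2,3)]
    by (simp add: mat_adjoint_nth[OF c] assms)
qed

lemma unitaryI:
  assumes c: "U \<in> carrier_mat n n"
    and cols: "\<And>a b. a < n \<Longrightarrow> b < n \<Longrightarrow> (\<Sum>p<n. cnj (U $$ (p, a)) * U $$ (p, b)) = (if a = b then 1 else 0)"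
    and rows: "\<And>a b. a < n \<Longrightarrow> b < n \<Longrightarrow> (\<Sum>p<n. U $$ (a, p) * cnj (U $$ (b, p))) = (if a = b then 1 else 0)"
  shows "U \<in> unitary_group n"
proof -
  note ca = mat_adjoint_carrier[OF c]
  have "U * mat_adjoint U = 1\<^sub>m n"
  proof (rule eq_matI)
    fix i j assume "i < dim_row (1\<^sub>m n :: complex mat)" "j < dim_col (1\<^sub>m n :: complex mat)"
    then have ij: "i < n" "j < n" by auto
    show "(U * mat_adjoint U) $$ (i, j) = 1\<^sub>m n $$ (i, j)"
      unfolding mat_mult_nth[OF c ca ij] using rows[OF ij] ij by (simp add: mat_adjoint_nth[OF c])
  qed (use c ca in auto)
  moreover have "mat_adjoint U * U = 1\<^sub>m n"
  proof (rule eq_matI)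
    fix i j assume "i < dim_row (1\<^sub>m n :: complex mat)" "j < dim_col (1\<^sub>m n :: complex mat)"
    then have ij: "i < n" "j < n" by auto
    show "(mat_adjoint U * U) $$ (i, j) = 1\<^sub>m n $$ (i, j)"
      unfolding mat_mult_nth[OF ca c ij] using cols[OF ij] ij by (simp add: mat_adjoint_nth[OF c])
  qed (use c ca in auto)
  ultimately show ?thesis using c by (simp add: unitary_group_def)
qed

lemma unitary_entry_le_1:
  assumes "U \<in> unitary_group n" "p < n" "a < n"
  shows "cmod (U $$ (p, a)) \<le> 1"
proof -
  have "complex_of_real (\<Sum>q<n. (cmod (U $$ (q, a)))\<^sup>2) = 1"
    using unitary_cols[OF assms(1,3,3)]
    unfolding of_real_sum complex_norm_square by (simp add: mult.commute)
  then have "(\<Sum>q<n. (cmod (U $$ (q, a)))\<^sup>2) = 1" by (metis of_real_eq_1_iff)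
  moreover have "(cmod (U $$ (p, a)))\<^sup>2 \<le> (\<Sum>q<n. (cmod (U $$ (q, a)))\<^sup>2)"
    using assms by (intro member_le_sum) auto
  ultimately have "(cmod (U $$ (p, a)))\<^sup>2 \<le> 1\<^sup>2" by simp
  then show ?thesis by (rule power2_le_imp_le) simp
qed

lemma measurable_borel_mat_entry:
  assumes "p < N" "a < N"
  shows "(\<lambda>U. U $$ (p, a)) \<in> borel_measurable (borel_mat N)"
proof -
  let ?f = "\<lambda>M :: complex mat. \<lambda>q\<in>{..<N} \<times> {..<N}. M $$ q"
  have "?f \<in> measurable (borel_mat N) (Pi\<^sub>M ({..<N} \<times> {..<N}) (\<lambda>_. borel))"
    unfolding borel_mat_def by (intro measurable_vimage_algebra1) (auto simp: space_PiM)
  from measurable_compose[OF this measurable_component_singleton[of "(p, a)"]] assms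
  show ?thesis by simp
qed

lemma measurable_borel_matI:
  assumes "\<And>\<omega>. \<omega> \<in> space M \<Longrightarrow> g \<omega> \<in> carrier_mat N N"
    and "\<And>p a. p < N \<Longrightarrow> a < N \<Longrightarrow> (\<lambda>\<omega>. g \<omega> $$ (p, a)) \<in> borel_measurable M"
  shows "g \<in> measurable M (borel_mat N)"
  unfolding borel_mat_def
proof (rule measurable_vimage_algebra2)
  show "g \<in> space M \<rightarrow> carrier_mat N N" using assms(1) by auto
  show "(\<lambda>x. \<lambda>q\<in>{..<N} \<times> {..<N}. g x $$ q) \<in> M \<rightarrow>\<^sub>M (Pi\<^sub>M ({..<N} \<times> {..<N}) (\<lambda>_. borel))"
    using assms(2) by (intro measurable_restrict) auto
qed

locale haar_measure = prob_space \<mu> for \<mu> :: "complex mat measure" +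
  fixes N :: nat
  assumes haar: "haar_prob N \<mu>"
begin

lemma space_haar: "space \<mu> = unitary_group N"
  using haar by (simp add: haar_prob_def)

lemma sets_haar: "sets \<mu> = sets (restrict_space (borel_mat N) (unitary_group N))"
  using haar by (simp add: haar_prob_def)

lemma measurable_entry [measurable]: "p < N \<Longrightarrow> a < N \<Longrightarrow> (\<lambda>U. U $$ (p, a)) \<in> borel_measurable \<mu>"
  unfolding measurable_cong_sets[OF sets_haar refl]
  by (intro measurable_restrict_space1 measurable_borel_mat_entry)

lemma measurable_haarI:
  assumes "\<And>\<omega>. \<omega> \<in> space M \<Longrightarrow> g \<omega> \<in> unitary_group N"
    and "\<And>p a. p < N \<Longrightarrow> a < N \<Longrightarrow> (\<lambda>\<omega>. g \<omega> $$ (p, a)) \<in> borel_measurable M"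
  shows "g \<in> measurable M \<mu>"
  unfolding measurable_cong_sets[OF refl sets_haar]
  using assms unitary_carrier by (intro measurable_restrict_space2 measurable_borel_matI) auto

lemma measurable_left: assumes "V \<in> unitary_group N" shows "(\<lambda>U. V * U) \<in> measurable \<mu> \<mu>"
proof (rule measurable_haarI)
  fix p a assume pa: "p < N" "a < N"
  have "(\<lambda>U. \<Sum>k<N. V $$ (p, k) * U $$ (k, a)) \<in> borel_measurable \<mu>"
    by (intro borel_measurable_sum borel_measurable_times borel_measurable_const measurable_entry) (use pa in auto)
  also have "?this \<longleftrightarrow> (\<lambda>U. (V * U) $$ (p, a)) \<in> borel_measurable \<mu>"
    by (intro measurable_cong)
       (use assms pa in \<open>auto simp del: index_mult_mat simp: space_haar mat_mult_nth[OF unitary_carrier unitary_carrier]\<close>)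
  finally show "(\<lambda>U. (V * U) $$ (p, a)) \<in> borel_measurable \<mu>" .
qed (use assms unitary_mult in \<open>auto simp: space_haar\<close>)

lemma measurable_right: assumes "V \<in> unitary_group N" shows "(\<lambda>U. U * V) \<in> measurable \<mu> \<mu>"
proof (rule measurable_haarI)
  fix p a assume pa: "p < N" "a < N"
  have "(\<lambda>U. \<Sum>k<N. U $$ (p, k) * V $$ (k, a)) \<in> borel_measurable \<mu>"
    by (intro borel_measurable_sum borel_measurable_times borel_measurable_const measurable_entry) (use pa in auto)
  also have "?this \<longleftrightarrow> (\<lambda>U. (U * V) $$ (p, a)) \<in> borel_measurable \<mu>"
    by (intro measurable_cong)
       (use assms pa in \<open>auto simp del: index_mult_mat simp: space_haar mat_mult_nth[OF unitary_carrier unitary_carrier]\<close>)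
  finally show "(\<lambda>U. (U * V) $$ (p, a)) \<in> borel_measurable \<mu>" .
qed (use assms unitary_mult in \<open>auto simp: space_haar\<close>)

lemma measurable_cnj_entry: "p < N \<Longrightarrow> a < N \<Longrightarrow> (\<lambda>U. cnj (U $$ (p, a))) \<in> borel_measurable \<mu>"
  by (rule measurable_compose[OF measurable_entry]) (auto intro: borel_measurable_continuous_onI continuous_intros)

lemma measurable_adjoint: "mat_adjoint \<in> measurable \<mu> \<mu>"
proof (rule measurable_haarI)
  fix p a assume pa: "p < N" "a < N"
  have "(\<lambda>U. cnj (U $$ (a, p))) \<in> borel_measurable \<mu>"
    by (rule measurable_cnj_entry) (use pa in auto)
  also have "?this \<longleftrightarrow> (\<lambda>U. mat_adjoint U $$ (p, a)) \<in> borel_measurable \<mu>"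
    by (intro measurable_cong) (use pa in \<open>auto simp: space_haar mat_adjoint_nth[OF unitary_carrier]\<close>)
  finally show "(\<lambda>U. mat_adjoint U $$ (p, a)) \<in> borel_measurable \<mu>" .
qed (use unitary_adjoint in \<open>auto simp: space_haar\<close>)

text \<open>
  Joint measurability of \<open>W^* U\<close>, as needed for exchanging two integrations over the
  group.
\<close>
lemma measurable_adjoint_mult: "(\<lambda>(W, U). mat_adjoint W * U) \<in> measurable (\<mu> \<Otimes>\<^sub>M \<mu>) \<mu>"
proof (rule measurable_haarI)
  fix p a assume pa: "p < N" "a < N"
  have "(\<lambda>x. \<Sum>k<N. cnj (fst x $$ (k, p)) * snd x $$ (k, a)) \<in> borel_measurable (\<mu> \<Otimes>\<^sub>M \<mu>)"
    by (intro borel_measurable_sum borel_measurable_times measurable_compose[OF measurable_fst measurable_cnj_entry]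
          measurable_compose[OF measurable_snd measurable_entry]) (use pa in auto)
  also have "?this \<longleftrightarrow> (\<lambda>x. (case x of (W, U) \<Rightarrow> mat_adjoint W * U) $$ (p, a)) \<in> borel_measurable (\<mu> \<Otimes>\<^sub>M \<mu>)"
    by (intro measurable_cong)
       (use pa in \<open>auto simp del: index_mult_mat simp: space_haar space_pair_measure mat_mult_nth[OF mat_adjoint_carrier[OF unitary_carrier] unitary_carrier]
          mat_adjoint_nth[OF unitary_carrier]\<close>)
  finally show "(\<lambda>x. (case x of (W, U) \<Rightarrow> mat_adjoint W * U) $$ (p, a)) \<in> borel_measurable (\<mu> \<Otimes>\<^sub>M \<mu>)" .
qed (use unitary_adjoint unitary_mult in \<open>auto simp: space_haar space_pair_measure\<close>)

lemma integral_left: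
  fixes h :: "complex mat \<Rightarrow> complex"
  assumes "V \<in> unitary_group N" "h \<in> borel_measurable \<mu>"
  shows "(\<integral>U. h (V * U) \<partial>\<mu>) = (\<integral>U. h U \<partial>\<mu>)"
proof -
  have "distr \<mu> \<mu> (\<lambda>U. V * U) = \<mu>" using haar assms by (simp add: haar_prob_def)
  then have "(\<integral>U. h U \<partial>\<mu>) = (\<integral>U. h U \<partial>distr \<mu> \<mu> (\<lambda>U. V * U))" by simp
  also have "\<dots> = (\<integral>U. h (V * U) \<partial>\<mu>)"
    by (intro integral_distr measurable_left assms)
  finally show ?thesis ..
qed

text \<open>
  Only left invariance is given. Integrating \<open>h(W^* U)\<close> over \<open>U\<close> first
  gives the integral of \<open>h\<close>, integrating over \<open>W\<close> first and using
  \<open>W^* U = (U^* W)^*\<close> gives the integral of \<open>h(U^*)\<close>. The two agree by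
  Fubini's theorem.
\<close>
lemma integral_adjoint:
  fixes h :: "complex mat \<Rightarrow> complex"
  assumes h: "h \<in> borel_measurable \<mu>" and B: "\<And>U. U \<in> unitary_group N \<Longrightarrow> cmod (h U) \<le> B"
  shows "(\<integral>U. h (mat_adjoint U) \<partial>\<mu>) = (\<integral>U. h U \<partial>\<mu>)"
proof -
  interpret P: pair_prob_space \<mu> \<mu> ..
  define g where "g W U = h (mat_adjoint W * U)" for W U
  have "integrable (\<mu> \<Otimes>\<^sub>M \<mu>) (\<lambda>(W, U). g W U)"
  proof (rule P.P.integrable_const_bound[where B = B])
    show "AE x in \<mu> \<Otimes>\<^sub>M \<mu>. norm (case x of (W, U) \<Rightarrow> g W U) \<le> B"
      using B unitary_adjoint unitary_mult
      by (intro AE_I2) (auto simp: g_def space_pair_measure space_haar)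
    show "(\<lambda>(W, U). g W U) \<in> borel_measurable (\<mu> \<Otimes>\<^sub>M \<mu>)"
      using measurable_compose[OF measurable_adjoint_mult h] by (simp add: g_def case_prod_unfold)
  qed
  then have "(\<integral>U. (\<integral>W. g W U \<partial>\<mu>) \<partial>\<mu>) = (\<integral>W. (\<integral>U. g W U \<partial>\<mu>) \<partial>\<mu>)"
    by (rule P.Fubini_integral)
  also have "\<dots> = (\<integral>W. (\<integral>U. h U \<partial>\<mu>) \<partial>\<mu>)"
  proof (rule Bochner_Integration.integral_cong[OF refl])
    fix W assume "W \<in> space \<mu>"
    then show "(\<integral>U. g W U \<partial>\<mu>) = (\<integral>U. h U \<partial>\<mu>)"
      unfolding g_def by (intro integral_left unitary_adjoint h) (simp add: space_haar)
  qed
  also have "\<dots> = (\<integral>U. h U \<partial>\<mu>)" by (simp add: prob_space)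
  also have "(\<integral>U. (\<integral>W. g W U \<partial>\<mu>) \<partial>\<mu>) = (\<integral>U. (\<integral>W. h (mat_adjoint W) \<partial>\<mu>) \<partial>\<mu>)"
  proof (rule Bochner_Integration.integral_cong[OF refl])
    fix U assume "U \<in> space \<mu>"
    then have U: "U \<in> unitary_group N" by (simp add: space_haar)
    have "(\<integral>W. g W U \<partial>\<mu>) = (\<integral>W. h (mat_adjoint (mat_adjoint U * W)) \<partial>\<mu>)"
      using U unitary_carrier
      by (intro Bochner_Integration.integral_cong refl)
         (auto simp: g_def space_haar mat_adjoint_mult[of _ N] mat_adjoint_adjoint[of _ N])
    also have "\<dots> = (\<integral>W. h (mat_adjoint W) \<partial>\<mu>)"
      by (rule integral_left[where h = "\<lambda>W. h (mat_adjoint W)"])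
         (use U unitary_adjoint measurable_compose[OF measurable_adjoint h] in auto)
    finally show "(\<integral>W. g W U \<partial>\<mu>) = (\<integral>W. h (mat_adjoint W) \<partial>\<mu>)" .
  qed
  finally show ?thesis by (simp add: prob_space)
qed

text \<open>
  Right multiplication is left multiplication conjugated by the inversion
  \<open>U \<mapsto> U^*\<close>.
\<close>
lemma integral_right:
  fixes h :: "complex mat \<Rightarrow> complex"
  assumes V: "V \<in> unitary_group N"
    and h: "h \<in> borel_measurable \<mu>" and B: "\<And>U. U \<in> unitary_group N \<Longrightarrow> cmod (h U) \<le> B"
  shows "(\<integral>U. h (U * V) \<partial>\<mu>) = (\<integral>U. h U \<partial>\<mu>)"
proof -
  have "(\<integral>U. h (U * V) \<partial>\<mu>) = (\<integral>U. h (mat_adjoint U * V) \<partial>\<mu>)"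
    by (rule integral_adjoint[where h = "\<lambda>U. h (U * V)" and B = B, symmetric])
       (use measurable_compose[OF measurable_right[OF V] h] B V unitary_mult in auto)
  also have "\<dots> = (\<integral>U. h (mat_adjoint (mat_adjoint V * U)) \<partial>\<mu>)"
    using V unitary_carrier
    by (intro Bochner_Integration.integral_cong refl)
       (auto simp: space_haar mat_adjoint_mult[of _ N] mat_adjoint_adjoint[of _ N])
  also have "\<dots> = (\<integral>U. h (mat_adjoint U) \<partial>\<mu>)"
    by (rule integral_left[where h = "\<lambda>W. h (mat_adjoint W)"])
       (use V unitary_adjoint measurable_compose[OF measurable_adjoint h] in auto)
  also have "\<dots> = (\<integral>U. h U \<partial>\<mu>)" by (rule integral_adjoint[OF h B])
  finally show ?thesis .
qed

end

section \<open>Invariance under rotations and the Schwinger-Dyson equation\<close>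

text \<open>
  The entry \<open>(a, b)\<close> of \<open>M^k\<close>, where \<open>M = U^* D U\<close> and
  \<open>D\<close> is the diagonal matrix with entries \<open>l 0, l 1, \<dots>\<close>.
\<close>
definition conj_pow :: "nat \<Rightarrow> (nat \<Rightarrow> real) \<Rightarrow> nat \<Rightarrow> complex mat \<Rightarrow> nat \<Rightarrow> nat \<Rightarrow> complex" where
  "conj_pow N l k U a b = (\<Sum>p<N. cnj (U $$ (p, a)) * of_real (l p ^ k) * U $$ (p, b))"

lemma conj_pow_0:
  assumes "U \<in> unitary_group N" "a < N" "b < N"
  shows "conj_pow N l 0 U a b = (if a = b then 1 else 0)"
  using unitary_cols[OF assms] by (simp add: conj_pow_def)

lemma conj_pow_mult:
  assumes "U \<in> unitary_group N" "a < N" "b < N"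
  shows "(\<Sum>c<N. conj_pow N l j U a c * conj_pow N l k U c b) = conj_pow N l (j + k) U a b"
proof -
  have "(\<Sum>c<N. conj_pow N l j U a c * conj_pow N l k U c b)
      = (\<Sum>c<N. \<Sum>p<N. \<Sum>q<N. (cnj (U $$ (p, a)) * of_real (l p ^ j) * (of_real (l q ^ k) * U $$ (q, b)))
          * (U $$ (p, c) * cnj (U $$ (q, c))))"
    by (simp add: conj_pow_def sum_product mult_ac)
  also have "\<dots> = (\<Sum>p<N. \<Sum>q<N. \<Sum>c<N. (cnj (U $$ (p, a)) * of_real (l p ^ j) * (of_real (l q ^ k) * U $$ (q, b)))
          * (U $$ (p, c) * cnj (U $$ (q, c))))"
    by (subst sum.swap, rule sum.cong[OF refl], rule sum.swap)
  also have "\<dots> = (\<Sum>p<N. \<Sum>q<N. (cnj (U $$ (p, a)) * of_real (l p ^ j) * (of_real (l q ^ k) * U $$ (q, b)))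
          * (if p = q then 1 else 0))"
    unfolding sum_distrib_left[symmetric] by (intro sum.cong refl) (simp add: unitary_rows[OF assms(1)])
  also have "\<dots> = (\<Sum>p<N. \<Sum>q<N. if p = q then cnj (U $$ (p, a)) * of_real (l p ^ j) * (of_real (l q ^ k) * U $$ (q, b)) else 0)"
    by (intro sum.cong refl) auto
  also have "\<dots> = conj_pow N l (j + k) U a b"
    by (simp add: conj_pow_def power_add mult_ac)
  finally show ?thesis .
qed

lemma conj_pow_trace:
  assumes "U \<in> unitary_group N"
  shows "(\<Sum>a<N. conj_pow N l k U a a) = of_real (\<Sum>p<N. l p ^ k)"
proof -
  have "(\<Sum>a<N. conj_pow N l k U a a) = (\<Sum>p<N. \<Sum>a<N. of_real (l p ^ k) * (U $$ (p, a) * cnj (U $$ (p, a))))"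
    unfolding conj_pow_def by (subst sum.swap) (simp add: mult_ac)
  also have "\<dots> = (\<Sum>p<N. of_real (l p ^ k) * 1)"
    unfolding sum_distrib_left[symmetric] by (intro sum.cong refl) (simp add: unitary_rows[OF assms])
  finally show ?thesis by simp
qed

lemma conj_pow_right:
  assumes "U \<in> carrier_mat N N" "V \<in> carrier_mat N N" "a < N" "b < N"
  shows "conj_pow N l k (U * V) a b
      = (\<Sum>c<N. \<Sum>d<N. cnj (V $$ (c, a)) * conj_pow N l k U c d * V $$ (d, b))"
proof -
  have "conj_pow N l k (U * V) a b
      = (\<Sum>p<N. \<Sum>c<N. \<Sum>d<N. cnj (V $$ (c, a)) * (cnj (U $$ (p, c)) * of_real (l p ^ k) * U $$ (p, d)) * V $$ (d, b))"
    unfolding conj_pow_def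
    by (intro sum.cong refl)
       (simp add: mat_mult_nth[OF assms(1,2)] assms(3,4) sum_product sum_distrib_left sum_distrib_right mult_ac del: index_mult_mat)
  also have "\<dots> = (\<Sum>c<N. \<Sum>d<N. \<Sum>p<N. cnj (V $$ (c, a)) * (cnj (U $$ (p, c)) * of_real (l p ^ k) * U $$ (p, d)) * V $$ (d, b))"
    by (subst sum.swap, rule sum.cong[OF refl], rule sum.swap)
  also have "\<dots> = (\<Sum>c<N. \<Sum>d<N. cnj (V $$ (c, a)) * conj_pow N l k U c d * V $$ (d, b))"
    by (simp add: conj_pow_def sum_distrib_left sum_distrib_right)
  finally show ?thesis .
qed

lemma norm_conj_pow_le:
  assumes "U \<in> unitary_group N" "a < N" "b < N"
  shows "cmod (conj_pow N l k U a b) \<le> (\<Sum>p<N. \<bar>l p\<bar> ^ k)"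
  unfolding conj_pow_def
proof (rule order_trans[OF norm_sum sum_mono])
  fix p assume "p \<in> {..<N}"
  then have p: "p < N" by simp
  have "cmod (cnj (U $$ (p, a)) * of_real (l p ^ k) * U $$ (p, b)) = \<bar>l p\<bar> ^ k * (cmod (U $$ (p, a)) * cmod (U $$ (p, b)))"
    by (simp add: norm_mult norm_power power_abs mult_ac)
  also have "\<dots> \<le> \<bar>l p\<bar> ^ k * (1 * 1)"
    by (intro mult_left_mono mult_mono unitary_entry_le_1[OF assms(1)] p assms) auto
  finally show "cmod (cnj (U $$ (p, a)) * of_real (l p ^ k) * U $$ (p, b)) \<le> \<bar>l p\<bar> ^ k" by simp
qed

definition diag_mon :: "nat \<Rightarrow> (nat \<Rightarrow> real) \<Rightarrow> complex mat \<Rightarrow> nat multiset \<Rightarrow> complex" where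
  "diag_mon N l U m = (\<Prod>j\<in>#m. conj_pow N l 1 U j j)"

lemma diag_mon_empty [simp]: "diag_mon N l U {#} = 1" by (simp add: diag_mon_def)

lemma diag_mon_add: "diag_mon N l U (add_mset j m) = conj_pow N l 1 U j j * diag_mon N l U m"
  by (simp add: diag_mon_def)

lemma norm_diag_mon_le:
  assumes "U \<in> unitary_group N" "set_mset m \<subseteq> {..<N}"
  shows "cmod (diag_mon N l U m) \<le> (\<Sum>p<N. \<bar>l p\<bar>) ^ size m"
  using assms(2)
proof (induction m)
  case (add j m)
  have "cmod (conj_pow N l 1 U j j) \<le> (\<Sum>p<N. \<bar>l p\<bar>)"
    using norm_conj_pow_le[OF assms(1), of j j l 1] add.prems by simp
  with add show ?case
    by (auto simp: diag_mon_add norm_mult intro!: mult_mono sum_nonneg)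
qed simp

context haar_measure
begin

lemma measurable_conj_pow: "a < N \<Longrightarrow> b < N \<Longrightarrow> (\<lambda>U. conj_pow N l k U a b) \<in> borel_measurable \<mu>"
  unfolding conj_pow_def
  by (intro borel_measurable_sum borel_measurable_times borel_measurable_const measurable_entry measurable_cnj_entry) auto

lemma measurable_diag_mon: "set_mset m \<subseteq> {..<N} \<Longrightarrow> (\<lambda>U. diag_mon N l U m) \<in> borel_measurable \<mu>"
proof (induction m)
  case (add j m)
  then show ?case
    unfolding diag_mon_add by (intro borel_measurable_times measurable_conj_pow) auto
qed simp

lemma integrable_bounded:
  fixes h :: "complex mat \<Rightarrow> complex"
  assumes "h \<in> borel_measurable \<mu>" "\<And>U. U \<in> unitary_group N \<Longrightarrow> cmod (h U) \<le> B"
  shows "integrable \<mu> h"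
  using assms by (intro integrable_const_bound[of _ B]) (auto simp: space_haar)

end

text \<open>
  \<open>\<phi> t\<close> agrees with \<open>\<phi>0 + t \<phi>1\<close> up to an error of order
  \<open>t^2\<close>, uniformly on \<open>S\<close>. This form of a derivative at
  \<open>t = 0\<close> is stable under products and permits the exchange with an integral, which is
  all that is required of it.
\<close>
definition jet :: "'u set \<Rightarrow> (real \<Rightarrow> 'u \<Rightarrow> complex) \<Rightarrow> ('u \<Rightarrow> complex) \<Rightarrow> ('u \<Rightarrow> complex) \<Rightarrow> bool" where
  "jet S \<phi> \<phi>0 \<phi>1 \<longleftrightarrow> (\<exists>C\<ge>0. \<forall>u\<in>S. cmod (\<phi>0 u) \<le> C \<and> cmod (\<phi>1 u) \<le> C \<and>
      (\<forall>t. \<bar>t\<bar> \<le> 1 \<longrightarrow> cmod (\<phi> t u - \<phi>0 u - of_real t * \<phi>1 u) \<le> C * t\<^sup>2))"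

lemma jet_cong:
  assumes "jet S \<phi> \<phi>0 \<phi>1" "\<And>t u. u \<in> S \<Longrightarrow> \<phi> t u = \<psi> t u" "\<And>u. u \<in> S \<Longrightarrow> \<phi>0 u = \<psi>0 u" "\<And>u. u \<in> S \<Longrightarrow> \<phi>1 u = \<psi>1 u"
  shows "jet S \<psi> \<psi>0 \<psi>1"
  using assms(1) unfolding jet_def by (simp add: assms(2-4)[symmetric])

lemma jet_const:
  assumes "\<And>u. u \<in> S \<Longrightarrow> cmod (g u) \<le> B"
  shows "jet S (\<lambda>_. g) g (\<lambda>_. 0)"
  unfolding jet_def
  by (rule exI[of _ "\<bar>B\<bar>"]) (auto intro: order_trans[OF assms])

lemma jet_add:
  assumes "jet S \<phi> \<phi>0 \<phi>1" "jet S \<psi> \<psi>0 \<psi>1"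
  shows "jet S (\<lambda>t u. \<phi> t u + \<psi> t u) (\<lambda>u. \<phi>0 u + \<psi>0 u) (\<lambda>u. \<phi>1 u + \<psi>1 u)"
proof -
  obtain C where C: "C \<ge> 0" "\<And>u. u \<in> S \<Longrightarrow> cmod (\<phi>0 u) \<le> C" "\<And>u. u \<in> S \<Longrightarrow> cmod (\<phi>1 u) \<le> C"
     "\<And>u t. u \<in> S \<Longrightarrow> \<bar>t\<bar> \<le> 1 \<Longrightarrow> cmod (\<phi> t u - \<phi>0 u - of_real t * \<phi>1 u) \<le> C * t\<^sup>2"
    using assms(1) unfolding jet_def by auto
  obtain D where D: "D \<ge> 0" "\<And>u. u \<in> S \<Longrightarrow> cmod (\<psi>0 u) \<le> D" "\<And>u. u \<in> S \<Longrightarrow> cmod (\<psi>1 u) \<le> D"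
     "\<And>u t. u \<in> S \<Longrightarrow> \<bar>t\<bar> \<le> 1 \<Longrightarrow> cmod (\<psi> t u - \<psi>0 u - of_real t * \<psi>1 u) \<le> D * t\<^sup>2"
    using assms(2) unfolding jet_def by auto
  show ?thesis
    unfolding jet_def
  proof (intro exI[of _ "C + D"] conjI ballI allI impI)
    fix u assume u: "u \<in> S"
    show "cmod (\<phi>0 u + \<psi>0 u) \<le> C + D" using C(2)[OF u] D(2)[OF u] by norm
    show "cmod (\<phi>1 u + \<psi>1 u) \<le> C + D" using C(3)[OF u] D(3)[OF u] by norm
    fix t :: real assume t: "\<bar>t\<bar> \<le> 1"
    have "\<phi> t u + \<psi> t u - (\<phi>0 u + \<psi>0 u) - of_real t * (\<phi>1 u + \<psi>1 u)
        = (\<phi> t u - \<phi>0 u - of_real t * \<phi>1 u) + (\<psi> t u - \<psi>0 u - of_real t * \<psi>1 u)"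
      by (simp add: algebra_simps)
    then show "cmod (\<phi> t u + \<psi> t u - (\<phi>0 u + \<psi>0 u) - of_real t * (\<phi>1 u + \<psi>1 u)) \<le> (C + D) * t\<^sup>2"
      using C(4)[OF u t] D(4)[OF u t] norm_triangle_ineq by (smt (verit) distrib_right)
  qed (use C D in auto)
qed

lemma jet_mult:
  assumes "jet S \<phi> \<phi>0 \<phi>1" "jet S \<psi> \<psi>0 \<psi>1"
  shows "jet S (\<lambda>t u. \<phi> t u * \<psi> t u) (\<lambda>u. \<phi>0 u * \<psi>0 u) (\<lambda>u. \<phi>1 u * \<psi>0 u + \<phi>0 u * \<psi>1 u)"
proof -
  obtain C where C: "C \<ge> 0" "\<And>u. u \<in> S \<Longrightarrow> cmod (\<phi>0 u) \<le> C" "\<And>u. u \<in> S \<Longrightarrow> cmod (\<phi>1 u) \<le> C"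
     "\<And>u t. u \<in> S \<Longrightarrow> \<bar>t\<bar> \<le> 1 \<Longrightarrow> cmod (\<phi> t u - \<phi>0 u - of_real t * \<phi>1 u) \<le> C * t\<^sup>2"
    using assms(1) unfolding jet_def by auto
  obtain D where D: "D \<ge> 0" "\<And>u. u \<in> S \<Longrightarrow> cmod (\<psi>0 u) \<le> D" "\<And>u. u \<in> S \<Longrightarrow> cmod (\<psi>1 u) \<le> D"
     "\<And>u t. u \<in> S \<Longrightarrow> \<bar>t\<bar> \<le> 1 \<Longrightarrow> cmod (\<psi> t u - \<psi>0 u - of_real t * \<psi>1 u) \<le> D * t\<^sup>2"
    using assms(2) unfolding jet_def by auto
  show ?thesis
    unfolding jet_def
  proof (intro exI[of _ "6 * C * D"] conjI ballI allI impI)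
    fix u assume u: "u \<in> S"
    have CD: "0 \<le> C * D" using C D by simp
    have "cmod (\<phi>0 u * \<psi>0 u) \<le> C * D" unfolding norm_mult using C D u by (intro mult_mono) auto
    then show "cmod (\<phi>0 u * \<psi>0 u) \<le> 6 * C * D" using CD by simp
    have "cmod (\<phi>1 u * \<psi>0 u) \<le> C * D" "cmod (\<phi>0 u * \<psi>1 u) \<le> C * D"
      unfolding norm_mult using C D u by (auto intro!: mult_mono)
    then show "cmod (\<phi>1 u * \<psi>0 u + \<phi>0 u * \<psi>1 u) \<le> 6 * C * D"
      using CD norm_triangle_ineq[of "\<phi>1 u * \<psi>0 u" "\<phi>0 u * \<psi>1 u"] by linarith
    fix t :: real assume t: "\<bar>t\<bar> \<le> 1"
    define r where "r = \<phi> t u - \<phi>0 u - of_real t * \<phi>1 u"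
    define s where "s = \<psi> t u - \<psi>0 u - of_real t * \<psi>1 u"
    have t2: "t\<^sup>2 \<le> 1" using t by (simp add: abs_square_le_1)
    have r: "cmod r \<le> C * t\<^sup>2" using C(4)[OF u t] by (simp add: r_def)
    have s: "cmod s \<le> D * t\<^sup>2" using D(4)[OF u t] by (simp add: s_def)
    have tr: "cmod (of_real t * x) \<le> cmod x" for x using t by (simp add: norm_mult mult_left_le_one_le)
    have "cmod (\<psi> t u) \<le> cmod s + cmod (\<psi>0 u) + cmod (\<psi>1 u)"
    proof -
      have "\<psi> t u = s + \<psi>0 u + of_real t * \<psi>1 u" by (simp add: s_def)
      then show ?thesis using tr[of "\<psi>1 u"] norm_triangle_ineq[of "s + \<psi>0 u" "of_real t * \<psi>1 u"] norm_triangle_ineq[of s "\<psi>0 u"]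
        by simp
    qed
    also have "\<dots> \<le> D * 1 + D + D"
      using s D(2,3)[OF u] mult_left_mono[OF t2 D(1)] by (intro add_mono) auto
    finally have psi: "cmod (\<psi> t u) \<le> 3 * D" by simp
    have "cmod (\<phi>0 u + of_real t * \<phi>1 u) \<le> 2 * C"
      using C(2,3)[OF u] tr[of "\<phi>1 u"] norm_triangle_ineq[of "\<phi>0 u" "of_real t * \<phi>1 u"] by linarith
    then have B: "cmod ((\<phi>0 u + of_real t * \<phi>1 u) * s) \<le> 2 * C * (D * t\<^sup>2)"
      unfolding norm_mult using s C by (intro mult_mono) auto
    have A: "cmod (r * \<psi> t u) \<le> C * t\<^sup>2 * (3 * D)"
      unfolding norm_mult using r psi C by (intro mult_mono) auto
    have "cmod (of_real (t\<^sup>2) * (\<phi>1 u * \<psi>1 u)) \<le> t\<^sup>2 * (C * D)"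
      unfolding norm_mult norm_of_real abs_power2 using C D u by (intro mult_mono) auto
    moreover have "\<phi> t u * \<psi> t u - \<phi>0 u * \<psi>0 u - of_real t * (\<phi>1 u * \<psi>0 u + \<phi>0 u * \<psi>1 u)
        = r * \<psi> t u + (\<phi>0 u + of_real t * \<phi>1 u) * s + of_real (t\<^sup>2) * (\<phi>1 u * \<psi>1 u)"
      by (simp add: r_def s_def algebra_simps power2_eq_square)
    moreover have "cmod (x + y + z) \<le> cmod x + cmod y + cmod z" for x y z :: complex
      using norm_triangle_ineq[of "x + y" z] norm_triangle_ineq[of x y] by linarith
    ultimately have "cmod (\<phi> t u * \<psi> t u - \<phi>0 u * \<psi>0 u - of_real t * (\<phi>1 u * \<psi>0 u + \<phi>0 u * \<psi>1 u))
        \<le> C * t\<^sup>2 * (3 * D) + 2 * C * (D * t\<^sup>2) + t\<^sup>2 * (C * D)"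
      using A B by (smt (verit))
    also have "\<dots> = 6 * C * D * t\<^sup>2" by (simp add: algebra_simps)
    finally show "cmod (\<phi> t u * \<psi> t u - \<phi>0 u * \<psi>0 u - of_real t * (\<phi>1 u * \<psi>0 u + \<phi>0 u * \<psi>1 u)) \<le> 6 * C * D * t\<^sup>2" .
  qed (use C D in auto)
qed

lemma jet_sum:
  assumes "\<And>i. i \<in> I \<Longrightarrow> jet S (\<phi> i) (\<phi>0 i) (\<phi>1 i)"
  shows "jet S (\<lambda>t u. \<Sum>i\<in>I. \<phi> i t u) (\<lambda>u. \<Sum>i\<in>I. \<phi>0 i u) (\<lambda>u. \<Sum>i\<in>I. \<phi>1 i u)"
  using assms
proof (induction I rule: infinite_finite_induct)
  case (insert x F)
  then show ?case by (simp add: jet_add)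
qed (auto intro: jet_const[where g = "\<lambda>_. 0" and B = 0])

text \<open>
  The derivative of a constant vanishes: \<open>t\<close> times the integral of
  \<open>\<phi>1\<close> is of order \<open>t^2\<close>.
\<close>
lemma (in prob_space) integral_jet_eq_0:
  assumes jet: "jet (space M) \<phi> \<phi>0 \<phi>1"
    and int: "\<And>t. \<bar>t\<bar> \<le> 1 \<Longrightarrow> integrable M (\<phi> t)" "integrable M \<phi>0" "integrable M \<phi>1"
    and inv: "\<And>t. \<bar>t\<bar> \<le> 1 \<Longrightarrow> (\<integral>u. \<phi> t u \<partial>M) = (\<integral>u. \<phi>0 u \<partial>M)"
  shows "(\<integral>u. \<phi>1 u \<partial>M) = 0"
proof -
  obtain C where C: "C \<ge> 0"
     "\<And>u t. u \<in> space M \<Longrightarrow> \<bar>t\<bar> \<le> 1 \<Longrightarrow> cmod (\<phi> t u - \<phi>0 u - of_real t * \<phi>1 u) \<le> C * t\<^sup>2"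
    using jet unfolding jet_def by auto
  define I where "I = (\<integral>u. \<phi>1 u \<partial>M)"
  have bd: "cmod I \<le> C * t" if t: "0 < t" "t \<le> 1" for t
  proof -
    have t': "\<bar>t\<bar> \<le> 1" using t by simp
    have "(\<integral>u. \<phi> t u - \<phi>0 u - of_real t * \<phi>1 u \<partial>M) = - (of_real t * I)"
      using int t' inv[OF t'] by (simp add: I_def)
    then have "t * cmod I = cmod (\<integral>u. \<phi> t u - \<phi>0 u - of_real t * \<phi>1 u \<partial>M)"
      using t by (simp add: norm_mult)
    also have "\<dots> \<le> C * t\<^sup>2"
    proof -
      have "cmod (\<integral>u. \<phi> t u - \<phi>0 u - of_real t * \<phi>1 u \<partial>M) \<le> (\<integral>u. C * t\<^sup>2 \<partial>M)"
        by (rule order_trans[OF integral_norm_bound], rule integral_mono) (use int t' C(2)[OF _ t'] in auto)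
      then show ?thesis by (simp add: prob_space)
    qed
    finally have "t * cmod I \<le> t * (C * t)" by (simp add: power2_eq_square mult_ac)
    then show ?thesis using t by simp
  qed
  have "((\<lambda>t. C * t) \<longlongrightarrow> C * 0) (at_right 0)" by (intro tendsto_intros)
  moreover have "\<forall>\<^sub>F t in at_right 0. cmod I \<le> C * t"
    using eventually_at_right_less[of "0::real"] eventually_at_right_field[of "\<lambda>t. t \<le> 1" 0]
    by (auto simp: eventually_at_right_field intro!: exI[of _ 1] bd)
  ultimately have "cmod I \<le> 0" by (intro tendsto_lowerbound[of _ "C * 0" "at_right 0", simplified]) auto
  then show ?thesis by (simp add: I_def)
qed

text \<open>
  The rational parametrisation of the circle, with \<open>t\<close> the tangent of half the angle.
  Its expansion to first order is elementary, at the price of the factor 2 in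
  \<open>rot_gen\<close>.
\<close>
definition rot_cos :: "real \<Rightarrow> real" where "rot_cos t = (1 - t\<^sup>2) / (1 + t\<^sup>2)"
definition rot_sin :: "real \<Rightarrow> real" where "rot_sin t = 2 * t / (1 + t\<^sup>2)"

lemma one_plus_square: "0 < 1 + (t::real)\<^sup>2" "1 + (t::real)\<^sup>2 \<noteq> 0"
  and divide_one_plus_square_le: "0 \<le> x \<Longrightarrow> x / (1 + (t::real)\<^sup>2) \<le> x"
proof -
  show 1: "0 < 1 + t\<^sup>2" by (simp add: add_pos_nonneg)
  then show "1 + t\<^sup>2 \<noteq> 0" by simp
  assume "0 \<le> x"
  then show "x / (1 + t\<^sup>2) \<le> x" using 1 mult_left_mono[of 1 "1 + t\<^sup>2" x] by (simp add: divide_le_eq)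
qed

lemma rot_cos_sin: "rot_cos t * rot_cos t + rot_sin t * rot_sin t = 1"
proof -
  have "rot_cos t * rot_cos t + rot_sin t * rot_sin t
      = ((1 - t\<^sup>2) * (1 - t\<^sup>2) + (2 * t) * (2 * t)) / ((1 + t\<^sup>2) * (1 + t\<^sup>2))"
    unfolding rot_cos_def rot_sin_def by (simp add: add_divide_distrib)
  also have "(1 - t\<^sup>2) * (1 - t\<^sup>2) + (2 * t) * (2 * t) = (1 + t\<^sup>2) * (1 + t\<^sup>2)"
    by (simp add: power2_eq_square algebra_simps)
  finally show ?thesis using one_plus_square(2)[of t] by simp
qed

lemma rot_cos_expansion: "\<bar>rot_cos t - 1\<bar> \<le> 2 * t\<^sup>2"
proof -
  have "rot_cos t - 1 = - (2 * t\<^sup>2 / (1 + t\<^sup>2))"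
    using one_plus_square(2)[of t] unfolding rot_cos_def by (simp add: field_simps)
  moreover have "2 * t\<^sup>2 / (1 + t\<^sup>2) \<le> 2 * t\<^sup>2" by (rule divide_one_plus_square_le) simp
  moreover have "0 \<le> 2 * t\<^sup>2 / (1 + t\<^sup>2)" using one_plus_square(1)[of t] by simp
  ultimately show ?thesis by linarith
qed

lemma rot_sin_expansion: assumes "\<bar>t\<bar> \<le> 1" shows "\<bar>rot_sin t - 2 * t\<bar> \<le> 2 * t\<^sup>2"
proof -
  have "rot_sin t - 2 * t = - (2 * t * t\<^sup>2 / (1 + t\<^sup>2))"
    using one_plus_square(2)[of t] unfolding rot_sin_def by (simp add: field_simps)
  then have "\<bar>rot_sin t - 2 * t\<bar> = 2 * \<bar>t\<bar> * t\<^sup>2 / (1 + t\<^sup>2)"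
    using one_plus_square(1)[of t] by (simp add: abs_mult)
  also have "\<dots> \<le> 2 * \<bar>t\<bar> * t\<^sup>2" by (rule divide_one_plus_square_le) simp
  also have "\<dots> \<le> 2 * 1 * t\<^sup>2" using assms by (intro mult_right_mono mult_left_mono) auto
  finally show ?thesis by simp
qed

text \<open>
  A rotation in the plane of the coordinates \<open>i\<close> and \<open>l\<close> with a phase
  \<open>w\<close> of modulus 1; \<open>rot_gen\<close> is its derivative at \<open>t = 0\<close>.
\<close>
definition rot :: "nat \<Rightarrow> nat \<Rightarrow> nat \<Rightarrow> complex \<Rightarrow> real \<Rightarrow> complex mat" where
  "rot N i l w t = mat N N (\<lambda>(a, b).
     if a = b then (if a = i \<or> a = l then of_real (rot_cos t) else 1)
     else if a = l \<and> b = i then w * of_real (rot_sin t)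
     else if a = i \<and> b = l then - (cnj w * of_real (rot_sin t)) else 0)"

definition rot_gen :: "nat \<Rightarrow> nat \<Rightarrow> complex \<Rightarrow> nat \<Rightarrow> nat \<Rightarrow> complex" where
  "rot_gen i l w a b = (if a = l \<and> b = i then 2 * w else if a = i \<and> b = l then - (2 * cnj w) else 0)"

lemma rot_carrier: "rot N i l w t \<in> carrier_mat N N" by (simp add: rot_def)

lemma rot_unitary:
  assumes il: "i < N" "l < N" "i \<noteq> l" and w: "w * cnj w = 1"
  shows "rot N i l w t \<in> unitary_group N"
proof (rule unitaryI[OF rot_carrier])
  define c where "c = complex_of_real (rot_cos t)"
  define s where "s = complex_of_real (rot_sin t)"
  have cs: "c * c + s * s = 1"
    unfolding c_def s_def of_real_mult[symmetric] of_real_add[symmetric] rot_cos_sin by simp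
  have sum2: "(\<Sum>p<N. f p) = f i + f l" if "\<And>p. p < N \<Longrightarrow> p \<noteq> i \<Longrightarrow> p \<noteq> l \<Longrightarrow> f p = 0" for f :: "nat \<Rightarrow> complex"
  proof -
    have "(\<Sum>p<N. f p) = (\<Sum>p\<in>{i, l}. f p)"
      by (rule sum.mono_neutral_right) (use il that in auto)
    then show ?thesis using il by simp
  qed
  have sum1: "(\<Sum>p<N. f p) = f a" if "a < N" "\<And>p. p < N \<Longrightarrow> p \<noteq> a \<Longrightarrow> f p = 0" for f :: "nat \<Rightarrow> complex" and a
  proof -
    have "(\<Sum>p<N. f p) = (\<Sum>p\<in>{a}. f p)"
      by (rule sum.mono_neutral_right) (use that in auto)
    then show ?thesis by simp
  qed
  have cc: "cnj c = c" "cnj s = s" by (simp_all add: c_def s_def)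
  fix a b assume ab: "a < N" "b < N"
  let ?R = "rot N i l w t"
  have R: "?R $$ (p, q) = (if p = q then (if p = i \<or> p = l then c else 1)
     else if p = l \<and> q = i then w * s else if p = i \<and> q = l then - (cnj w * s) else 0)" if "p < N" "q < N" for p q
    using that by (simp add: rot_def c_def s_def)
  have Rs: "?R $$ (i, i) = c" "?R $$ (l, l) = c" "?R $$ (l, i) = w * s" "?R $$ (i, l) = - (cnj w * s)"
    using il by (simp_all add: R)
  have R0: "?R $$ (i, p) = 0" "?R $$ (l, p) = 0" "?R $$ (p, i) = 0" "?R $$ (p, l) = 0"
    if "p < N" "p \<noteq> i" "p \<noteq> l" for p
    using il that by (simp_all add: R)
  have "cnj w * s * (w * s) = (w * cnj w) * (s * s)" "w * s * (cnj w * s) = (w * cnj w) * (s * s)"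
    by (simp_all only: mult_ac)
  then have e: "cnj w * s * (w * s) = s * s" "w * s * (cnj w * s) = s * s"
    by (simp_all only: w mult_1_left)
  have alg: "c * c + cnj w * s * (w * s) = 1" "w * s * (cnj w * s) + c * c = 1"
    "cnj w * s * (w * s) + c * c = 1" "c * c + w * s * (cnj w * s) = 1"
    unfolding e using cs by (simp_all only: add.commute)
  have col: "cnj (?R $$ (i, i)) * ?R $$ (i, i) + cnj (?R $$ (l, i)) * ?R $$ (l, i) = 1"
    "cnj (?R $$ (i, l)) * ?R $$ (i, l) + cnj (?R $$ (l, l)) * ?R $$ (l, l) = 1"
    "cnj (?R $$ (i, i)) * ?R $$ (i, l) + cnj (?R $$ (l, i)) * ?R $$ (l, l) = 0"
    "cnj (?R $$ (i, l)) * ?R $$ (i, i) + cnj (?R $$ (l, l)) * ?R $$ (l, i) = 0"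
    unfolding Rs complex_cnj_mult complex_cnj_minus complex_cnj_cnj cc
    by (simp_all only: minus_mult_minus alg) (simp_all add: mult.commute)
  have row: "?R $$ (i, i) * cnj (?R $$ (i, i)) + ?R $$ (i, l) * cnj (?R $$ (i, l)) = 1"
    "?R $$ (l, i) * cnj (?R $$ (l, i)) + ?R $$ (l, l) * cnj (?R $$ (l, l)) = 1"
    "?R $$ (i, i) * cnj (?R $$ (l, i)) + ?R $$ (i, l) * cnj (?R $$ (l, l)) = 0"
    "?R $$ (l, i) * cnj (?R $$ (i, i)) + ?R $$ (l, l) * cnj (?R $$ (i, l)) = 0"
    unfolding Rs complex_cnj_mult complex_cnj_minus complex_cnj_cnj cc
    by (simp_all only: minus_mult_minus alg) (simp_all add: mult.commute)
  consider "a = i" "b = i" | "a = i" "b = l" | "a = l" "b = i" | "a = l" "b = l"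
    | "a = i \<or> a = l" "b \<noteq> i" "b \<noteq> l" | "a \<noteq> i" "a \<noteq> l" by blast
  note cases = this
  show "(\<Sum>p<N. cnj (?R $$ (p, a)) * ?R $$ (p, b)) = (if a = b then 1 else 0)"
  proof (cases "a = i \<or> a = l")
    case True
    then have "(\<Sum>p<N. cnj (?R $$ (p, a)) * ?R $$ (p, b)) = cnj (?R $$ (i, a)) * ?R $$ (i, b) + cnj (?R $$ (l, a)) * ?R $$ (l, b)"
      by (intro sum2) (use ab il in \<open>auto simp: R\<close>)
    with cases show ?thesis
      by cases (use True il ab in \<open>auto simp: col row R0\<close>)
  next
    case False
    then have *: "(\<Sum>p<N. cnj (?R $$ (p, a)) * ?R $$ (p, b)) = cnj (?R $$ (a, a)) * ?R $$ (a, b)"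
      by (intro sum1) (use ab il in \<open>auto simp: R\<close>)
    show ?thesis
      unfolding * R[OF ab(1,1)] R[OF ab] R[OF ab(2,1)] using False by (cases "a = b") auto
  qed
  show "(\<Sum>p<N. ?R $$ (a, p) * cnj (?R $$ (b, p))) = (if a = b then 1 else 0)"
  proof (cases "a = i \<or> a = l")
    case True
    then have "(\<Sum>p<N. ?R $$ (a, p) * cnj (?R $$ (b, p))) = ?R $$ (a, i) * cnj (?R $$ (b, i)) + ?R $$ (a, l) * cnj (?R $$ (b, l))"
      by (intro sum2) (use ab il in \<open>auto simp: R\<close>)
    with cases show ?thesis
      by cases (use True il ab in \<open>auto simp: col row R0\<close>)
  next
    case False
    then have *: "(\<Sum>p<N. ?R $$ (a, p) * cnj (?R $$ (b, p))) = ?R $$ (a, a) * cnj (?R $$ (b, a))"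
      by (intro sum1) (use ab il in \<open>auto simp: R\<close>)
    show ?thesis
      unfolding * R[OF ab(1,1)] R[OF ab] R[OF ab(2,1)] using False by (cases "a = b") auto
  qed
qed

lemma jet_rot_entry:
  assumes "a < N" "b < N" "i \<noteq> l" and w: "cmod w = 1"
  shows "jet S (\<lambda>t _. rot N i l w t $$ (a, b)) (\<lambda>_. if a = b then 1 else 0) (\<lambda>_. rot_gen i l w a b)"
  unfolding jet_def
proof (intro exI[of _ 2] conjI ballI allI impI)
  fix t :: real assume t: "\<bar>t\<bar> \<le> 1"
  have c: "cmod (of_real (rot_cos t) - 1) \<le> 2 * t\<^sup>2"
    using rot_cos_expansion[of t] by (metis norm_of_real of_real_1 of_real_diff)
  have s: "cmod (of_real (rot_sin t) - of_real (2 * t)) \<le> 2 * t\<^sup>2"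
    using rot_sin_expansion[OF t] by (metis norm_of_real of_real_diff)
  have s1: "cmod (w * of_real (rot_sin t) - of_real t * (2 * w)) \<le> 2 * t\<^sup>2"
  proof -
    have "w * of_real (rot_sin t) - of_real t * (2 * w) = w * (of_real (rot_sin t) - of_real (2 * t))"
      by (simp add: algebra_simps)
    then show ?thesis using s w by (simp add: norm_mult)
  qed
  have s2: "cmod (- (cnj w * of_real (rot_sin t)) + of_real t * (2 * cnj w)) \<le> 2 * t\<^sup>2"
  proof -
    have "- (cnj w * of_real (rot_sin t)) + of_real t * (2 * cnj w) = - cnj w * (of_real (rot_sin t) - of_real (2 * t))"
      by (simp add: algebra_simps)
    then show ?thesis using s w by (simp add: norm_mult)
  qed
  show "cmod (rot N i l w t $$ (a, b) - (if a = b then 1 else 0) - of_real t * rot_gen i l w a b) \<le> 2 * t\<^sup>2"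
    using assms(1-3) c s1 s2 by (auto simp: rot_def rot_gen_def)
qed (auto simp: rot_gen_def norm_mult w)

lemma jet_cnj: "jet S \<phi> \<phi>0 \<phi>1 \<Longrightarrow> jet S (\<lambda>t u. cnj (\<phi> t u)) (\<lambda>u. cnj (\<phi>0 u)) (\<lambda>u. cnj (\<phi>1 u))"
proof -
  have "cmod (cnj x - cnj y - of_real t * cnj z) = cmod (x - y - of_real t * z)" for x y z and t :: real
    by (metis complex_cnj_complex_of_real complex_cnj_diff complex_cnj_mult complex_mod_cnj)
  then show "jet S \<phi> \<phi>0 \<phi>1 \<Longrightarrow> ?thesis" unfolding jet_def by simp
qed

text \<open>
  To first order, \<open>M^k\<close> changes by \<open>G^* M^k + M^k G\<close>, where
  \<open>G\<close> is the generator.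
\<close>
lemma jet_conj_pow:
  assumes il: "i < N" "l < N" "i \<noteq> l" and w: "cmod w = 1" and ab: "a < N" "b < N"
  shows "jet (unitary_group N) (\<lambda>t U. conj_pow N x k (U * rot N i l w t) a b) (\<lambda>U. conj_pow N x k U a b)
     (\<lambda>U. (\<Sum>c<N. cnj (rot_gen i l w c a) * conj_pow N x k U c b) + (\<Sum>d<N. conj_pow N x k U a d * rot_gen i l w d b))"
proof -
  let ?S = "unitary_group N"
  have jc: "jet ?S (\<lambda>_ U. conj_pow N x k U c d) (\<lambda>U. conj_pow N x k U c d) (\<lambda>_. 0)" if "c < N" "d < N" for c d
    by (rule jet_const[OF norm_conj_pow_le[OF _ that]])
  have "jet ?S (\<lambda>t U. \<Sum>c<N. \<Sum>d<N. cnj (rot N i l w t $$ (c, a)) * conj_pow N x k U c d * rot N i l w t $$ (d, b))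
    (\<lambda>U. \<Sum>c<N. \<Sum>d<N. cnj (if c = a then 1 else 0) * conj_pow N x k U c d * (if d = b then 1 else 0))
    (\<lambda>U. \<Sum>c<N. \<Sum>d<N. (cnj (rot_gen i l w c a) * conj_pow N x k U c d + cnj (if c = a then 1 else 0) * 0) * (if d = b then 1 else 0)
        + cnj (if c = a then 1 else 0) * conj_pow N x k U c d * rot_gen i l w d b)"
    by (intro jet_sum jet_mult jet_cnj jet_rot_entry jc) (use il w ab in auto)
  then show ?thesis
  proof (rule jet_cong)
    fix t :: real and U assume "U \<in> ?S"
    then show "(\<Sum>c<N. \<Sum>d<N. cnj (rot N i l w t $$ (c, a)) * conj_pow N x k U c d * rot N i l w t $$ (d, b))
        = conj_pow N x k (U * rot N i l w t) a b"
      by (intro conj_pow_right[symmetric] unitary_carrier rot_carrier ab)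
  next
    fix U assume "U \<in> ?S"
    show "(\<Sum>c<N. \<Sum>d<N. cnj (if c = a then 1 else 0) * conj_pow N x k U c d * (if d = b then 1 else 0)) = conj_pow N x k U a b"
      using ab by (simp add: if_distrib[of cnj] if_distrib[of "\<lambda>x. x * _"] if_distrib[of "\<lambda>x. _ * x"] cong: if_cong)
    show "(\<Sum>c<N. \<Sum>d<N. (cnj (rot_gen i l w c a) * conj_pow N x k U c d + cnj (if c = a then 1 else 0) * 0) * (if d = b then 1 else 0)
        + cnj (if c = a then 1 else 0) * conj_pow N x k U c d * rot_gen i l w d b)
      = (\<Sum>c<N. cnj (rot_gen i l w c a) * conj_pow N x k U c b) + (\<Sum>d<N. conj_pow N x k U a d * rot_gen i l w d b)"
    proof -
      have "(\<Sum>c<N. \<Sum>d<N. (if c = a then conj_pow N x k U c d * rot_gen i l w d b else 0)) = (\<Sum>d<N. conj_pow N x k U a d * rot_gen i l w d b)"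
        using ab by (subst sum.swap) simp
      then show ?thesis
        using ab by (simp add: sum.distrib if_distrib[of cnj] if_distrib[of "\<lambda>x. x * _"] if_distrib[of "\<lambda>x. _ * x"] cong: if_cong)
    qed
  qed
qed

lemma sum_rot_gen:
  fixes Q :: "nat \<Rightarrow> nat \<Rightarrow> complex"
  assumes il: "i < N" "l < N" "i \<noteq> l"
  shows "(\<Sum>d<N. Q a d * rot_gen i l w d b) = (if b = i then 2 * w * Q a l else if b = l then - (2 * cnj w * Q a i) else 0)"
    "(\<Sum>c<N. cnj (rot_gen i l w c a) * Q c b) = (if a = i then 2 * cnj w * Q l b else if a = l then - (2 * w * Q i b) else 0)"
proof -
  have "(\<Sum>d<N. Q a d * rot_gen i l w d b) = (\<Sum>d\<in>{i, l}. Q a d * rot_gen i l w d b)"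
    by (rule sum.mono_neutral_right) (use il in \<open>auto simp: rot_gen_def\<close>)
  then show "(\<Sum>d<N. Q a d * rot_gen i l w d b) = (if b = i then 2 * w * Q a l else if b = l then - (2 * cnj w * Q a i) else 0)"
    using il by (cases "b = i"; cases "b = l") (simp_all add: rot_gen_def mult.commute)
  have "(\<Sum>c<N. cnj (rot_gen i l w c a) * Q c b) = (\<Sum>c\<in>{i, l}. cnj (rot_gen i l w c a) * Q c b)"
    by (rule sum.mono_neutral_right) (use il in \<open>auto simp: rot_gen_def\<close>)
  then show "(\<Sum>c<N. cnj (rot_gen i l w c a) * Q c b) = (if a = i then 2 * cnj w * Q l b else if a = l then - (2 * w * Q i b) else 0)"
    using il by (cases "a = i"; cases "a = l") (simp_all add: rot_gen_def mult.commute)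
qed

lemma jet_diag_mon:
  assumes il: "i < N" "l < N" "i \<noteq> l" and w: "cmod w = 1" and m: "set_mset m \<subseteq> {..<N}"
  shows "jet (unitary_group N) (\<lambda>t U. diag_mon N x (U * rot N i l w t) m) (\<lambda>U. diag_mon N x U m)
     (\<lambda>U. 2 * (w * conj_pow N x 1 U i l + cnj w * conj_pow N x 1 U l i) *
        (of_nat (count m i) * diag_mon N x U (m - {#i#}) - of_nat (count m l) * diag_mon N x U (m - {#l#})))"
  using m
proof (induction m)
  case empty
  show ?case by (rule jet_cong[OF jet_const[where g = "\<lambda>_. 1" and B = 1]]) auto
next
  case (add j m)
  then have j: "j < N" and m: "set_mset m \<subseteq> {..<N}" by auto
  have step: "of_nat (count (add_mset j m) a) * diag_mon N x U (add_mset j m - {#a#})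
      = conj_pow N x 1 U j j * (of_nat (count m a) * diag_mon N x U (m - {#a#})) + (if a = j then diag_mon N x U m else 0)"
    for a U
  proof (cases "a \<in># m")
    case True
    then have "conj_pow N x 1 U j j * diag_mon N x U (m - {#a#}) = diag_mon N x U (add_mset j m - {#a#})"
    proof -
      have "add_mset j (m - {#a#}) = add_mset j m - {#a#}"
        using True by (intro multiset_eqI) (auto simp: count_greater_zero_iff[symmetric] simp del: count_greater_zero_iff)
      then show ?thesis by (simp only: diag_mon_add[symmetric])
    qed
    moreover have "diag_mon N x U (add_mset j m - {#a#}) = diag_mon N x U m" if "a = j" using that by simp
    ultimately show ?thesis by (auto simp: algebra_simps)
  next
    case False
    then show ?thesis by (auto simp: not_in_iff)
  qed
  have gen: "(\<Sum>c<N. cnj (rot_gen i l w c j) * conj_pow N x 1 U c j) + (\<Sum>d<N. conj_pow N x 1 U j d * rot_gen i l w d j)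
     = 2 * (w * conj_pow N x 1 U i l + cnj w * conj_pow N x 1 U l i) * ((if i = j then 1 else 0) - (if l = j then 1 else 0))" for U
    unfolding sum_rot_gen(1)[OF il, where Q = "conj_pow N x 1 U"] sum_rot_gen(2)[OF il, where Q = "conj_pow N x 1 U"]
    using il by (cases "j = i"; cases "j = l") (simp_all add: algebra_simps)
  show ?case
    unfolding diag_mon_add
  proof (rule jet_cong[OF jet_mult[OF jet_conj_pow[OF il w j j] add.IH[OF m]]])
    fix U assume "U \<in> unitary_group N"
    show "((\<Sum>c<N. cnj (rot_gen i l w c j) * conj_pow N x 1 U c j) + (\<Sum>d<N. conj_pow N x 1 U j d * rot_gen i l w d j)) * diag_mon N x U m
        + conj_pow N x 1 U j j * (2 * (w * conj_pow N x 1 U i l + cnj w * conj_pow N x 1 U l i) *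
            (of_nat (count m i) * diag_mon N x U (m - {#i#}) - of_nat (count m l) * diag_mon N x U (m - {#l#})))
      = 2 * (w * conj_pow N x 1 U i l + cnj w * conj_pow N x 1 U l i) *
         (of_nat (count (add_mset j m) i) * diag_mon N x U (add_mset j m - {#i#}) - of_nat (count (add_mset j m) l) * diag_mon N x U (add_mset j m - {#l#}))"
      unfolding step gen by (simp add: algebra_simps)
  qed (simp_all)
qed

context haar_measure
begin

text \<open>
  The integral of \<open>(M^k)_li \<Prod>_(j \<in> m) M_jj\<close> does not change when
  \<open>U\<close> is replaced by \<open>U\<close> times a rotation in the plane of \<open>i\<close>
  and \<open>l\<close>, so its derivative vanishes. The first factor contributes
  \<open>(M^k)_ll - (M^k)_ii\<close>, and the diagonal entries \<open>M_ii\<close> and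
  \<open>M_ll\<close> change by opposite multiples of a combination of \<open>M_il\<close> and
  \<open>M_li\<close>.
\<close>
lemma Schwinger_Dyson:
  assumes il: "i < N" "l < N" "i \<noteq> l" and m: "set_mset m \<subseteq> {..<N}"
  shows "(\<integral>U. (conj_pow N x k U l l - conj_pow N x k U i i) * diag_mon N x U m \<partial>\<mu>)
      + (\<integral>U. conj_pow N x k U l i * conj_pow N x 1 U i l *
          (of_nat (count m i) * diag_mon N x U (m - {#i#}) - of_nat (count m l) * diag_mon N x U (m - {#l#})) \<partial>\<mu>) = 0"
proof -
  define Q where "Q = conj_pow N x k"
  define M where "M = conj_pow N x 1"
  define T where "T U = of_nat (count m i) * diag_mon N x U (m - {#i#}) - of_nat (count m l) * diag_mon N x U (m - {#l#})" for U
  define A where "A = (\<integral>U. (Q U l l - Q U i i) * diag_mon N x U m \<partial>\<mu>)"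
  define B where "B = (\<integral>U. Q U l i * M U i l * T U \<partial>\<mu>)"
  define B' where "B' = (\<integral>U. Q U l i * M U l i * T U \<partial>\<mu>)"
  have mi: "set_mset (m - {#i#}) \<subseteq> {..<N}" "set_mset (m - {#l#}) \<subseteq> {..<N}"
    using m by (auto dest: in_diffD)
  define S where "S = (\<Sum>p<N. \<bar>x p\<bar>)"
  define K where "K = (\<Sum>p<N. \<bar>x p\<bar> ^ k)"
  have S0: "0 \<le> S" "0 \<le> K" by (auto simp: S_def K_def intro: sum_nonneg)
  have Qb: "cmod (Q U a b) \<le> K" if "U \<in> unitary_group N" "a < N" "b < N" for U a b
    using norm_conj_pow_le[OF that, of x k] by (simp add: Q_def K_def)
  have Mb: "cmod (M U a b) \<le> S" if "U \<in> unitary_group N" "a < N" "b < N" for U a b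
    using norm_conj_pow_le[OF that, of x 1] by (simp add: M_def S_def)
  have Db: "cmod (diag_mon N x U m') \<le> S ^ size m'" if "U \<in> unitary_group N" "set_mset m' \<subseteq> {..<N}" for U m'
    using norm_diag_mon_le[OF that, of x] by (simp add: S_def)
  define KT where "KT = of_nat (count m i) * S ^ size (m - {#i#}) + of_nat (count m l) * S ^ size (m - {#l#})"
  have KT0: "0 \<le> KT" using S0 by (simp add: KT_def)
  have Tb: "cmod (T U) \<le> KT" if "U \<in> unitary_group N" for U
  proof -
    have "cmod (T U) \<le> cmod (of_nat (count m i) * diag_mon N x U (m - {#i#})) + cmod (of_nat (count m l) * diag_mon N x U (m - {#l#}))"
      unfolding T_def by (rule norm_triangle_ineq4)
    also have "\<dots> \<le> KT"
      unfolding KT_def norm_mult norm_of_nat using Db[OF that mi(1)] Db[OF that mi(2)]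
      by (intro add_mono mult_left_mono) auto
    finally show ?thesis .
  qed
  have mQ: "(\<lambda>U. Q U a b) \<in> borel_measurable \<mu>" "(\<lambda>U. M U a b) \<in> borel_measurable \<mu>" if "a < N" "b < N" for a b
    unfolding Q_def M_def using that by (auto intro: measurable_conj_pow)
  have mT: "T \<in> borel_measurable \<mu>"
    unfolding T_def[abs_def]
    by (intro borel_measurable_diff borel_measurable_times borel_measurable_const measurable_diag_mon mi)
  have mD: "(\<lambda>U. diag_mon N x U m) \<in> borel_measurable \<mu>" by (rule measurable_diag_mon[OF m])
  have iQD: "integrable \<mu> (\<lambda>U. Q U a b * diag_mon N x U m)" if "a < N" "b < N" for a b
    by (rule integrable_bounded[where B = "K * S ^ size m"])
       (use that m S0 in \<open>auto simp: norm_mult intro!: borel_measurable_times mQ mD mult_mono Qb Db\<close>)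
  have iQMT: "integrable \<mu> (\<lambda>U. Q U l i * M U a b * T U)" if "a < N" "b < N" for a b
    by (rule integrable_bounded[where B = "K * S * KT"])
       (use that il m S0 KT0 in \<open>auto simp: norm_mult intro!: borel_measurable_times mQ mT mult_mono Qb Mb Tb\<close>)
  have key: "2 * w * A + 2 * w * B + 2 * cnj w * B' = 0" if w: "cmod w = 1" for w
  proof -
    define h where "h U = Q U l i * diag_mon N x U m" for U
    have hm: "h \<in> borel_measurable \<mu>" unfolding h_def[abs_def] by (intro borel_measurable_times mQ mD il)
    have hb: "cmod (h U) \<le> K * S ^ size m" if "U \<in> unitary_group N" for U
      unfolding h_def norm_mult using that il m S0 by (intro mult_mono Qb Db) auto
    have ww: "w * cnj w = 1" using w by (simp add: complex_mult_cnj cmod_power2 [symmetric])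
    note V = rot_unitary[OF il ww]
    have gen: "(\<Sum>c<N. cnj (rot_gen i l w c l) * Q U c i) + (\<Sum>d<N. Q U l d * rot_gen i l w d i)
       = 2 * w * Q U l l - 2 * w * Q U i i" for U
      unfolding sum_rot_gen(1)[OF il, where Q = "Q U"] sum_rot_gen(2)[OF il, where Q = "Q U"]
      using il by simp
    have J: "jet (space \<mu>) (\<lambda>t U. h (U * rot N i l w t)) h
      (\<lambda>U. 2 * w * (Q U l l * diag_mon N x U m) - 2 * w * (Q U i i * diag_mon N x U m)
          + 2 * w * (Q U l i * M U i l * T U) + 2 * cnj w * (Q U l i * M U l i * T U))"
      unfolding space_haar h_def Q_def
    proof (rule jet_cong[OF jet_mult[OF jet_conj_pow[OF il w il(2,1), where x = x and k = k] jet_diag_mon[OF il w m, where x = x]]],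
        fold Q_def M_def T_def)
      fix U assume "U \<in> unitary_group N"
      show "((\<Sum>c<N. cnj (rot_gen i l w c l) * Q U c i) + (\<Sum>d<N. Q U l d * rot_gen i l w d i)) * diag_mon N x U m
          + Q U l i * (2 * (w * M U i l + cnj w * M U l i) * T U)
        = 2 * w * (Q U l l * diag_mon N x U m) - 2 * w * (Q U i i * diag_mon N x U m)
          + 2 * w * (Q U l i * M U i l * T U) + 2 * cnj w * (Q U l i * M U l i * T U)"
        unfolding gen by (simp add: algebra_simps)
    qed (simp_all)
    define f1 where "f1 U = 2 * w * (Q U l l * diag_mon N x U m)" for U
    define f2 where "f2 U = 2 * w * (Q U i i * diag_mon N x U m)" for U
    define f3 where "f3 U = 2 * w * (Q U l i * M U i l * T U)" for U
    define f4 where "f4 U = 2 * cnj w * (Q U l i * M U l i * T U)" for U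
    have f: "integrable \<mu> f1" "integrable \<mu> f2" "integrable \<mu> f3" "integrable \<mu> f4"
      unfolding f1_def f2_def f3_def f4_def by (intro integrable_mult_right iQD iQMT il)+
    have If: "(\<integral>U. f1 U \<partial>\<mu>) = 2 * w * (\<integral>U. Q U l l * diag_mon N x U m \<partial>\<mu>)"
       "(\<integral>U. f2 U \<partial>\<mu>) = 2 * w * (\<integral>U. Q U i i * diag_mon N x U m \<partial>\<mu>)"
       "(\<integral>U. f3 U \<partial>\<mu>) = 2 * w * B" "(\<integral>U. f4 U \<partial>\<mu>) = 2 * cnj w * B'"
      unfolding f1_def f2_def f3_def f4_def B_def B'_def by (rule integral_mult_right_zero)+
    have AA: "A = (\<integral>U. Q U l l * diag_mon N x U m \<partial>\<mu>) - (\<integral>U. Q U i i * diag_mon N x U m \<partial>\<mu>)"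
      unfolding A_def left_diff_distrib by (intro Bochner_Integration.integral_diff iQD il)
    have "(\<integral>U. 2 * w * (Q U l l * diag_mon N x U m) - 2 * w * (Q U i i * diag_mon N x U m)
          + 2 * w * (Q U l i * M U i l * T U) + 2 * cnj w * (Q U l i * M U l i * T U) \<partial>\<mu>) = 0"
    proof (rule integral_jet_eq_0[OF J])
      fix t :: real
      show "integrable \<mu> (\<lambda>U. h (U * rot N i l w t))"
        by (rule integrable_bounded[where B = "K * S ^ size m"])
           (use measurable_compose[OF measurable_right[OF V] hm] hb unitary_mult V in auto)
      show "(\<integral>U. h (U * rot N i l w t) \<partial>\<mu>) = (\<integral>U. h U \<partial>\<mu>)"
        by (rule integral_right[OF V hm hb])
      show "integrable \<mu> h" by (rule integrable_bounded[OF hm hb])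
      show "integrable \<mu> (\<lambda>U. 2 * w * (Q U l l * diag_mon N x U m) - 2 * w * (Q U i i * diag_mon N x U m)
          + 2 * w * (Q U l i * M U i l * T U) + 2 * cnj w * (Q U l i * M U l i * T U))"
        using f unfolding f1_def f2_def f3_def f4_def
        by (intro Bochner_Integration.integrable_add Bochner_Integration.integrable_diff)
    qed
    then have "(\<integral>U. f1 U - f2 U + f3 U + f4 U \<partial>\<mu>) = 0" by (simp only: f1_def f2_def f3_def f4_def)
    moreover have "(\<integral>U. f1 U - f2 U + f3 U + f4 U \<partial>\<mu>) = 2 * w * A + 2 * w * B + 2 * cnj w * B'"
      using f by (simp add: If AA right_diff_distrib)
    ultimately show ?thesis by simp
  qed
  (* The equation is only real linear in w. Comparing the phases 1 and i removes the unwanted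
     contribution B', in which the entry (l, i) of M appears in place of (i, l). *)
  have "2 * (A + B + B') = 0" using key[of 1] by (simp add: algebra_simps)
  then have "A + B + B' = 0" by (metis mult_eq_0_iff zero_neq_numeral)
  then have e1: "Re A + Re B + Re B' = 0" "Im A + Im B + Im B' = 0"
    by (metis plus_complex.sel zero_complex.sel)+
  have "\<i> * (2 * (A + B - B')) = 0" using key[of "\<i>"] by (simp add: algebra_simps)
  then have "2 * (A + B - B') = 0" by (metis mult_eq_0_iff complex_i_not_zero)
  then have "A + B - B' = 0" by (metis mult_eq_0_iff zero_neq_numeral)
  then have e2: "Re A + Re B - Re B' = 0" "Im A + Im B - Im B' = 0"
    by (metis plus_complex.sel minus_complex.sel zero_complex.sel)+
  have "A + B = 0"
  proof (rule complex_eqI)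
    show "Re (A + B) = Re 0" unfolding plus_complex.sel zero_complex.sel using e1(1) e2(1) by linarith
    show "Im (A + B) = Im 0" unfolding plus_complex.sel zero_complex.sel using e1(2) e2(2) by linarith
  qed
  then show ?thesis by (simp add: A_def B_def Q_def M_def T_def)
qed

end

section \<open>Moment series and their Dunkl recursion\<close>

definition perm_mser :: "(nat \<Rightarrow> nat) \<Rightarrow> mser \<Rightarrow> mser" where
  "perm_mser \<pi> f = Mser (\<lambda>m. mcoeff f (image_mset \<pi> m))"

lemma mcoeff_perm_mser: "mcoeff (perm_mser \<pi> f) m = mcoeff f (image_mset \<pi> m)"
  by (simp add: perm_mser_def Mser_inverse)

lemma perm_mser_mult:
  assumes "\<And>x. \<pi> (\<pi> x) = x"
  shows "perm_mser \<pi> (f * g) = perm_mser \<pi> f * perm_mser \<pi> g"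
proof (rule mser_eqI)
  fix m
  have inv: "image_mset \<pi> (image_mset \<pi> u) = u" for u
    using assms by (simp add: multiset.map_comp comp_def)
  have *: "u + v = image_mset \<pi> m \<longleftrightarrow> image_mset \<pi> u + image_mset \<pi> v = m" for u v
    by (metis image_mset_union inv)
  show "mcoeff (perm_mser \<pi> (f * g)) m = mcoeff (perm_mser \<pi> f * perm_mser \<pi> g) m"
    unfolding mcoeff_perm_mser[of \<pi> "f * g"] times_mser.rep_eq
  proof -
    have 1: "(image_mset \<pi> u, image_mset \<pi> v) \<in> msplits m" if "(u, v) \<in> msplits (image_mset \<pi> m)" for u v
      using that * by (simp add: msplits_def)
    have 2: "(image_mset \<pi> u, image_mset \<pi> v) \<in> msplits (image_mset \<pi> m)" if "(u, v) \<in> msplits m" for u v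
      using that by (auto simp: msplits_def)
    show "(\<Sum>(u, v)\<in>msplits (image_mset \<pi> m). mcoeff f u * mcoeff g v)
        = (\<Sum>(u, v)\<in>msplits m. mcoeff (perm_mser \<pi> f) u * mcoeff (perm_mser \<pi> g) v)"
    by (rule sum.reindex_bij_witness[of _ "\<lambda>(u, v). (image_mset \<pi> u, image_mset \<pi> v)"
          "\<lambda>(u, v). (image_mset \<pi> u, image_mset \<pi> v)"])
       (auto simp: inv mcoeff_perm_mser intro: 1 2)
  qed
qed

lemma perm_mser_1: "perm_mser \<pi> 1 = 1"
  by (rule mser_eqI) (simp add: mcoeff_perm_mser one_mser.rep_eq)

text \<open>
  \<open>g k i\<close> stands for the series
  \<open>g_(k,i)(x) = E (M^k)_ii exp(\<Sum>_j x_j M_jj)\<close> and \<open>q k i c\<close> for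
  \<open>E M_ic (M^k)_ci exp(\<Sum>_j x_j M_jj)\<close>. Expanding \<open>M^(k+1) = M M^k\<close>
  gives \<open>g_Suc\<close>, and the Schwinger-Dyson equation identifies \<open>q k i c\<close>
  with the divided difference of \<open>g_(k,i)\<close> and \<open>g_(k,c)\<close>.
\<close>
locale moment_series =
  fixes N :: nat and g :: "nat \<Rightarrow> nat \<Rightarrow> mser" and q :: "nat \<Rightarrow> nat \<Rightarrow> nat \<Rightarrow> mser" and f :: mser
  assumes N_pos: "0 < N"
    and g_0: "i < N \<Longrightarrow> g 0 i = f"
    and f_0: "mcoeff f {#} = 1"
    and g_Suc: "i < N \<Longrightarrow> g (Suc k) i = mderiv i (g k i) + (\<Sum>c\<in>{..<N} - {i}. q k i c)"
    and q: "i < N \<Longrightarrow> c < N \<Longrightarrow> i \<noteq> c \<Longrightarrow> (mvar i - mvar c) * q k i c = g k i - g k c"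
    and sym: "a < N \<Longrightarrow> b < N \<Longrightarrow> i < N \<Longrightarrow>
        perm_mser (Transposition.transpose a b) (g k (Transposition.transpose a b i)) = g k i"
begin

definition f' :: mser where "f' = (SOME f'. f * f' = 1)"

lemma f': "f * f' = 1"
  unfolding f'_def using mser_inverse[OF f_0] by (metis (mono_tags) someI_ex)

text \<open>
  Dividing by \<open>f\<close> turns the derivative in the recursion into
  \<open>\<partial>_i + \<partial>_i log f\<close>, so that only the logarithm of \<open>f\<close>
  matters.
\<close>
definition h :: "nat \<Rightarrow> nat \<Rightarrow> mser" where "h k i = g k i * f'"

lemma h_0: "i < N \<Longrightarrow> h 0 i = 1"
  using f' by (simp add: h_def g_0)

lemma g_eq: "g k i = h k i * f"
  unfolding h_def mult.assoc mult.commute[of f' f] f' by simp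

lemma h_Suc:
  assumes "i < N"
  shows "h (Suc k) i = mderiv i (mlog f) * h k i + mderiv i (h k i) + (\<Sum>c\<in>{..<N} - {i}. q k i c * f')"
proof -
  have "mderiv i (g k i) * f' = (mderiv i (mlog f) * h k i + mderiv i (h k i)) * (f * f')"
    unfolding g_eq[of k i] mderiv_mult using mderiv_mlog[OF f_0, of i, symmetric] by (simp add: algebra_simps)
  then show ?thesis
    unfolding h_def[of "Suc k"] g_Suc[OF assms] distrib_right sum_distrib_right by (simp add: f' distrib_right)
qed

lemma h_sym:
  assumes ab: "a < N" "b < N" and i: "i < N"
  shows "perm_mser (Transposition.transpose a b) (h k (Transposition.transpose a b i)) = h k i"
proof -
  let ?\<pi> = "Transposition.transpose a b"
  have pi: "?\<pi> i < N" using ab i by (auto simp: Transposition.transpose_def)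
  have bij: "?\<pi> (?\<pi> x) = x" for x by simp
  have pf: "perm_mser ?\<pi> f = f" using sym[OF ab i, of 0] g_0 pi i by simp
  have "perm_mser ?\<pi> f * perm_mser ?\<pi> f' = 1"
    unfolding perm_mser_mult[OF bij, symmetric] f' perm_mser_1 ..
  then have pf': "perm_mser ?\<pi> f' = f'"
    unfolding pf using f' by (metis mult.assoc mult.commute mult_1_right)
  show ?thesis unfolding h_def perm_mser_mult[OF bij] pf' sym[OF ab i] ..
qed

lemma coeff_h_sym:
  assumes ab: "a < N" "b < N" and i: "i < N"
  shows "mcoeff (h k (Transposition.transpose a b i)) (relabel a b m) = mcoeff (h k i) m"
  using h_sym[OF assms, of k, THEN arg_cong, of "\<lambda>x. mcoeff x m"] unfolding mcoeff_perm_mser .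

lemma coeff_h_Suc:
  "mcoeff (h (Suc k) 0) m = (\<Sum>(u, v)\<in>msplits m. mcoeff (mderiv 0 (mlog f)) u * mcoeff (h k 0) v)
      + of_nat (Suc (count m 0)) * mcoeff (h k 0) (add_mset 0 m)
      + (\<Sum>l\<in>{1..<N}. \<Sum>j\<le>count m l. mcoeff (h k 0) (move j l 0 m)
          - mcoeff (h k 0) (relabel 0 l (move j l 0 m)))"
proof -
  have "mcoeff (q k 0 l * f') m = (\<Sum>j\<le>count m l. mcoeff (h k 0) (move j l 0 m)
          - mcoeff (h k 0) (relabel 0 l (move j l 0 m)))"
    if l: "l \<in> {1..<N}" for l
  proof -
    have l': "l < N" "0 \<noteq> l" using l by auto
    have "(mvar 0 - mvar l) * (q k 0 l * f') = h k 0 - h k l"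
      using q[OF N_pos l', of k] by (simp add: h_def mult.assoc[symmetric] left_diff_distrib)
    from mcoeff_divided_difference[OF this l'(2), of m]
    have "mcoeff (q k 0 l * f') m = (\<Sum>j\<le>count m l. mcoeff (h k 0) (move j l 0 m)
          - mcoeff (h k l) (move j l 0 m))"
      by (simp add: minus_mser.rep_eq del: replicate_mset_Suc)
    moreover have "mcoeff (h k l) m' = mcoeff (h k 0) (relabel 0 l m')" for m'
      using coeff_h_sym[OF N_pos l'(1,1), of k m'] by simp
    ultimately show ?thesis by simp
  qed
  moreover have "{..<N} - {0} = {1..<N}" by auto
  ultimately show ?thesis
    unfolding h_Suc[OF N_pos] plus_mser.rep_eq mcoeff_sum times_mser.rep_eq[of "mderiv 0 (mlog f)"]
    by (simp add: mderiv.rep_eq del: replicate_mset_Suc)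
qed

lemma coeff_g_empty: "mcoeff (g k i) {#} = mcoeff (h k i) {#}"
  by (simp add: g_eq[of k i] times_mser.rep_eq f_0)

end

text \<open>
  The coefficients of \<open>log f\<close> at \<open>x_0^n\<close> are of order \<open>N\<close> and
  those at mixed monomials tend to 0, so the normalised coefficients of \<open>h_k\<close> satisfy
  the assumptions of the recursion analysed above. Dividing \<open>f\<close> out does not change the
  constant term, as \<open>f\<close> has constant term 1.
\<close>
theorem moment_series_asymptotics:
  fixes g :: "nat \<Rightarrow> nat \<Rightarrow> nat \<Rightarrow> mser" and q :: "nat \<Rightarrow> nat \<Rightarrow> nat \<Rightarrow> nat \<Rightarrow> mser"
  assumes ms: "\<forall>\<^sub>F N in sequentially. moment_series N (g N) (q N) (f N)"
    and pure: "\<And>n. n \<ge> 1 \<Longrightarrow> (\<lambda>N. mcoeff (mlog (f N)) (pur n) - (of_nat N * a n + b n)) \<longlonglongrightarrow> 0"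
    and mixed: "\<And>u. others u \<noteq> {} \<Longrightarrow> 0 \<in># u \<Longrightarrow> (\<lambda>N. mcoeff (mlog (f N)) u) \<longlonglongrightarrow> 0"
  shows "(\<lambda>N. of_nat N * (mcoeff (g N k 0) {#} / of_nat N ^ k
      - alpha (\<lambda>p. of_nat (Suc p) * a (Suc p) + 1 / of_nat N * (of_nat (Suc p) * b (Suc p))) k 0)) \<longlonglongrightarrow> 0"
proof -
  define C where "C N k m = mcoeff (moment_series.h (g N) (f N) k 0) m / of_nat N ^ k" for N k m
  define lam where "lam N u = mcoeff (mderiv 0 (mlog (f N))) u / of_nat N" for N u
  interpret coefficient_recursion C lam "\<lambda>p. of_nat (Suc p) * a (Suc p)" "\<lambda>p. of_nat (Suc p) * b (Suc p)"
  proof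
    fix m
    show "\<forall>\<^sub>F N in sequentially. C N 0 m = (if m = {#} then 1 else 0)"
      using ms
    proof eventually_elim
      case (elim N)
      then interpret moment_series N "g N" "q N" "f N" .
      show ?case by (simp add: C_def h_0[OF N_pos] one_mser.rep_eq)
    qed
  next
    fix k m
    show "\<forall>\<^sub>F N in sequentially. C N (Suc k) m =
        (\<Sum>(u, v)\<in>msplits m. lam N u * C N k v)
        + 1 / of_nat N * (of_nat (Suc (count m 0)) * C N k (add_mset 0 m))
        + 1 / of_nat N * (\<Sum>l\<in>{1..<N}. \<Sum>j\<le>count m l.
            C N k (move j l 0 m)
            - C N k (relabel 0 l (move j l 0 m)))"
      using ms
    proof eventually_elim
      case (elim N)
      then interpret moment_series N "g N" "q N" "f N" .
      have split: "(x + y + z) / (n * nk) = x / (n * nk) + 1 / n * (y / nk) + 1 / n * (z / nk)" for x y z n nk :: complex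
        by (simp add: add_divide_distrib)
      show ?case
        unfolding C_def coeff_h_Suc power_Suc split
        by (simp add: lam_def sum_divide_distrib case_prod_unfold diff_divide_distrib del: replicate_mset_Suc of_nat_Suc)
    qed
  next
    fix k
    show "\<forall>\<^sub>F N in sequentially. \<forall>m l l'. set_mset m \<subseteq> {..<N} \<longrightarrow> 0 < l \<longrightarrow> l < N \<longrightarrow> 0 < l' \<longrightarrow> l' < N \<longrightarrow>
            C N k (relabel l l' m) = C N k m"
      using ms
    proof eventually_elim
      case (elim N)
      then interpret moment_series N "g N" "q N" "f N" .
      show ?case
      proof (intro allI impI)
        fix m l l' assume l: "0 < l" "l < N" "0 < l'" "l' < N"
        then have "Transposition.transpose l l' 0 = 0" by (simp add: Transposition.transpose_def)
        then show "C N k (relabel l l' m) = C N k m"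
          using coeff_h_sym[OF l(2,4) N_pos, of k m] by (simp add: C_def)
      qed
    qed
  next
    fix p
    have "(\<lambda>N. of_nat (Suc p) * (mcoeff (mlog (f N)) (pur (Suc p)) - (of_nat N * a (Suc p) + b (Suc p)))) \<longlonglongrightarrow> of_nat (Suc p) * 0"
      by (intro tendsto_intros pure) simp
    moreover have "\<forall>\<^sub>F N in sequentially. of_nat N * (lam N (pur p) - (of_nat (Suc p) * a (Suc p) + 1 / of_nat N * (of_nat (Suc p) * b (Suc p))))
        = of_nat (Suc p) * (mcoeff (mlog (f N)) (pur (Suc p)) - (of_nat N * a (Suc p) + b (Suc p)))"
      using eventually_gt_at_top[of 0]
    proof eventually_elim
      case (elim N)
      then show ?case
        by (simp add: lam_def mderiv.rep_eq field_simps del: of_nat_Suc)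
    qed
    ultimately show "negl (\<lambda>N. lam N (pur p) - (of_nat (Suc p) * a (Suc p) + 1 / of_nat N * (of_nat (Suc p) * b (Suc p))))"
      unfolding negl_def by (simp add: tendsto_cong)
  next
    fix u assume u: "others u \<noteq> {}"
    then have "(\<lambda>N. of_nat (Suc (count u 0)) * mcoeff (mlog (f N)) (add_mset 0 u)) \<longlonglongrightarrow> of_nat (Suc (count u 0)) * 0"
      by (intro tendsto_intros mixed) (auto simp: others_def)
    moreover have "\<forall>\<^sub>F N in sequentially. of_nat N * lam N u = of_nat (Suc (count u 0)) * mcoeff (mlog (f N)) (add_mset 0 u)"
      using eventually_gt_at_top[of 0] by eventually_elim (simp add: lam_def mderiv.rep_eq)
    ultimately show "negl (\<lambda>N. lam N u)"
      unfolding negl_def by (simp add: tendsto_cong)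
  qed
  have "\<forall>\<^sub>F N in sequentially. of_nat N * (C N k {#} - alpha (psiN N) k 0) = of_nat N * (mcoeff (g N k 0) {#} / of_nat N ^ k
      - alpha (\<lambda>p. of_nat (Suc p) * a (Suc p) + 1 / of_nat N * (of_nat (Suc p) * b (Suc p))) k 0)"
    using ms
  proof eventually_elim
    case (elim N)
    then interpret moment_series N "g N" "q N" "f N" .
    show ?case unfolding C_def coeff_g_empty psiN_def ..
  qed
  from tendsto_cong[OF this] C_constant_term[of k] show ?thesis unfolding negl_def by blast
qed

section \<open>Moments of the diagonal entries\<close>

definition mfact :: "nat multiset \<Rightarrow> complex" where
  "mfact m = (\<Prod>i\<in>set_mset m. fact (count m i))"

lemma mfact_nonzero: "mfact m \<noteq> 0" by (simp add: mfact_def)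

lemma mfact_empty [simp]: "mfact {#} = 1" by (simp add: mfact_def)

lemma mfact_add: "mfact (add_mset i m) = of_nat (Suc (count m i)) * mfact m"
proof -
  have "mfact m = (\<Prod>j\<in>insert i (set_mset m). fact (count m j))" 
    unfolding mfact_def by (rule prod.mono_neutral_left) (auto simp: not_in_iff)
  then have m: "mfact m = fact (count m i) * (\<Prod>j\<in>set_mset m - {i}. fact (count m j))"
    by (simp add: prod.insert_remove)
  have "mfact (add_mset i m) = fact (count (add_mset i m) i) * (\<Prod>j\<in>set_mset m - {i}. fact (count (add_mset i m) j))"
    unfolding mfact_def by (simp add: prod.insert_remove)
  also have "(\<Prod>j\<in>set_mset m - {i}. fact (count (add_mset i m) j)) = (\<Prod>j\<in>set_mset m - {i}. fact (count m j) :: complex)"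
    by (rule prod.cong) auto
  finally show ?thesis using m by (simp add: mult.assoc)
qed

lemma mfact_remove: "i \<in># m \<Longrightarrow> mfact m = of_nat (count m i) * mfact (m - {#i#})"
  using mfact_add[of i "m - {#i#}"] by (simp add: Suc_diff_Suc)

lemma mfact_image:
  assumes "\<And>x. \<pi> (\<pi> x) = x"
  shows "mfact (image_mset \<pi> m) = mfact m"
proof (induction m)
  case (add i m)
  have inj: "\<pi> x = \<pi> y \<longleftrightarrow> x = y" for x y using assms by metis
  have "count (image_mset \<pi> m) (\<pi> i) = count m i"
    by (induction m) (simp_all add: inj)
  with add show ?case by (simp add: mfact_add)
qed simp

definition swap_mat :: "nat \<Rightarrow> (nat \<Rightarrow> nat) \<Rightarrow> complex mat" where
  "swap_mat N \<pi> = mat N N (\<lambda>(a, b). if a = \<pi> b then 1 else 0)"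

lemma swap_mat_unitary:
  assumes inv: "\<And>x. \<pi> (\<pi> x) = x" and \<pi>: "\<And>x. x < N \<Longrightarrow> \<pi> x < N"
  shows "swap_mat N \<pi> \<in> unitary_group N"
proof (rule unitaryI)
  show "swap_mat N \<pi> \<in> carrier_mat N N" by (simp add: swap_mat_def)
  fix a b assume ab: "a < N" "b < N"
  have inj: "\<pi> a = \<pi> b \<longleftrightarrow> a = b" using inv by metis
  have eq: "p = \<pi> q \<longleftrightarrow> \<pi> p = q" for p q using inv by metis
  have "(\<Sum>p<N. cnj (swap_mat N \<pi> $$ (p, a)) * swap_mat N \<pi> $$ (p, b)) = (\<Sum>p<N. if p = \<pi> a then (if p = \<pi> b then 1 else 0) else 0)"
    by (intro sum.cong refl) (use ab in \<open>auto simp: swap_mat_def\<close>)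
  then show "(\<Sum>p<N. cnj (swap_mat N \<pi> $$ (p, a)) * swap_mat N \<pi> $$ (p, b)) = (if a = b then 1 else 0)"
    using \<pi>[OF ab(1)] by (simp add: inj)
  have "(\<Sum>p<N. swap_mat N \<pi> $$ (a, p) * cnj (swap_mat N \<pi> $$ (b, p))) = (\<Sum>p<N. if p = \<pi> a then (if p = \<pi> b then 1 else 0) else 0)"
    by (intro sum.cong refl) (use ab in \<open>auto simp: swap_mat_def eq inv\<close>)
  then show "(\<Sum>p<N. swap_mat N \<pi> $$ (a, p) * cnj (swap_mat N \<pi> $$ (b, p))) = (if a = b then 1 else 0)"
    using \<pi>[OF ab(1)] by (simp add: inj)
qed

lemma conj_pow_swap:
  assumes inv: "\<And>x. \<pi> (\<pi> x) = x" and \<pi>: "\<And>x. x < N \<Longrightarrow> \<pi> x < N"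
    and U: "U \<in> carrier_mat N N" and ab: "a < N" "b < N"
  shows "conj_pow N l k (U * swap_mat N \<pi>) a b = conj_pow N l k U (\<pi> a) (\<pi> b)"
proof -
  have "conj_pow N l k (U * swap_mat N \<pi>) a b
      = (\<Sum>c<N. \<Sum>d<N. if d = \<pi> b then (if c = \<pi> a then conj_pow N l k U c d else 0) else 0)"
    by (subst conj_pow_right[OF U _ ab], simp add: swap_mat_def, intro sum.cong refl)
       (auto simp: swap_mat_def ab)
  also have "\<dots> = conj_pow N l k U (\<pi> a) (\<pi> b)" using \<pi>[OF ab(1)] \<pi>[OF ab(2)] by simp
  finally show ?thesis .
qed

lemma diag_mon_swap:
  assumes inv: "\<And>x. \<pi> (\<pi> x) = x" and \<pi>: "\<And>x. x < N \<Longrightarrow> \<pi> x < N"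
    and U: "U \<in> carrier_mat N N" and m: "set_mset m \<subseteq> {..<N}"
  shows "diag_mon N l (U * swap_mat N \<pi>) m = diag_mon N l U (image_mset \<pi> m)"
  using m by (induction m) (auto simp: diag_mon_add conj_pow_swap[OF inv \<pi> U])

context haar_measure
begin

text \<open>
  The coefficients of \<open>x^m\<close> in the integrals over the unitary group of
  \<open>(M^k)_ii exp(\<Sum>_j x_j M_jj)\<close> and
  \<open>M_ic (M^k)_ci exp(\<Sum>_j x_j M_jj)\<close>. They are 0 if a variable with index at least
  \<open>N\<close> occurs, since there are only \<open>N\<close> diagonal entries.
\<close>
definition mom :: "(nat \<Rightarrow> real) \<Rightarrow> nat \<Rightarrow> nat \<Rightarrow> nat multiset \<Rightarrow> complex" where
  "mom l k i m = (if set_mset m \<subseteq> {..<N}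
     then (\<integral>U. conj_pow N l k U i i * diag_mon N l U m \<partial>\<mu>) / mfact m else 0)"

definition cross_mom :: "(nat \<Rightarrow> real) \<Rightarrow> nat \<Rightarrow> nat \<Rightarrow> nat \<Rightarrow> nat multiset \<Rightarrow> complex" where
  "cross_mom l k i c m = (if set_mset m \<subseteq> {..<N}
     then (\<integral>U. conj_pow N l 1 U i c * conj_pow N l k U c i * diag_mon N l U m \<partial>\<mu>) / mfact m else 0)"

lemma integrable_cross:
  assumes "a < N" "b < N" "c < N" "d < N" "set_mset m \<subseteq> {..<N}"
  shows "integrable \<mu> (\<lambda>U. conj_pow N l j U a b * conj_pow N l k U c d * diag_mon N l U m)"
proof (rule integrable_bounded)
  show "(\<lambda>U. conj_pow N l j U a b * conj_pow N l k U c d * diag_mon N l U m) \<in> borel_measurable \<mu>"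
    by (intro borel_measurable_times measurable_conj_pow measurable_diag_mon assms)
  fix U assume "U \<in> unitary_group N"
  then show "cmod (conj_pow N l j U a b * conj_pow N l k U c d * diag_mon N l U m)
      \<le> (\<Sum>p<N. \<bar>l p\<bar> ^ j) * (\<Sum>p<N. \<bar>l p\<bar> ^ k) * (\<Sum>p<N. \<bar>l p\<bar>) ^ size m"
    unfolding norm_mult
    by (intro mult_mono norm_conj_pow_le norm_diag_mon_le mult_nonneg_nonneg sum_nonneg) (use assms in auto)
qed

lemma integrable_diag:
  assumes "a < N" "b < N" "set_mset m \<subseteq> {..<N}"
  shows "integrable \<mu> (\<lambda>U. conj_pow N l k U a b * diag_mon N l U m)"
proof (rule integrable_bounded)
  show "(\<lambda>U. conj_pow N l k U a b * diag_mon N l U m) \<in> borel_measurable \<mu>"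
    by (intro borel_measurable_times measurable_conj_pow measurable_diag_mon assms)
  fix U assume "U \<in> unitary_group N"
  then show "cmod (conj_pow N l k U a b * diag_mon N l U m) \<le> (\<Sum>p<N. \<bar>l p\<bar> ^ k) * (\<Sum>p<N. \<bar>l p\<bar>) ^ size m"
    unfolding norm_mult
    by (intro mult_mono norm_conj_pow_le norm_diag_mon_le mult_nonneg_nonneg sum_nonneg) (use assms in auto)
qed

text \<open>
  Expansion of \<open>(M^(k+1))_ii = \<Sum>_c M_ic (M^k)_ci\<close>, where the summand
  \<open>c = i\<close> adds the factor \<open>M_ii\<close> to the monomial.
\<close>
lemma mom_Suc:
  assumes i: "i < N"
  shows "mom l (Suc k) i m = of_nat (Suc (count m i)) * mom l k i (add_mset i m) + (\<Sum>c\<in>{..<N} - {i}. cross_mom l k i c m)"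
proof (cases "set_mset m \<subseteq> {..<N}")
  case True
  have "(\<integral>U. conj_pow N l (Suc k) U i i * diag_mon N l U m \<partial>\<mu>)
      = (\<integral>U. (\<Sum>c<N. conj_pow N l 1 U i c * conj_pow N l k U c i * diag_mon N l U m) \<partial>\<mu>)"
  proof (rule Bochner_Integration.integral_cong[OF refl])
    fix U assume "U \<in> space \<mu>"
    then have "conj_pow N l (Suc k) U i i = (\<Sum>c<N. conj_pow N l 1 U i c * conj_pow N l k U c i)"
      using conj_pow_mult[of U N i i l 1 k] i by (simp add: space_haar)
    then show "conj_pow N l (Suc k) U i i * diag_mon N l U m = (\<Sum>c<N. conj_pow N l 1 U i c * conj_pow N l k U c i * diag_mon N l U m)"
      by (simp add: sum_distrib_right)
  qed
  also have "\<dots> = (\<Sum>c<N. \<integral>U. conj_pow N l 1 U i c * conj_pow N l k U c i * diag_mon N l U m \<partial>\<mu>)"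
    by (rule Bochner_Integration.integral_sum) (use i True in \<open>auto intro!: integrable_cross\<close>)
  also have "\<dots> = (\<integral>U. conj_pow N l 1 U i i * conj_pow N l k U i i * diag_mon N l U m \<partial>\<mu>)
      + (\<Sum>c\<in>{..<N} - {i}. \<integral>U. conj_pow N l 1 U i c * conj_pow N l k U c i * diag_mon N l U m \<partial>\<mu>)"
    using i by (subst sum.remove[of _ i]) auto
  also have "(\<integral>U. conj_pow N l 1 U i i * conj_pow N l k U i i * diag_mon N l U m \<partial>\<mu>)
      = (\<integral>U. conj_pow N l k U i i * diag_mon N l U (add_mset i m) \<partial>\<mu>)"
    by (simp add: diag_mon_add mult_ac)
  finally have *: "(\<integral>U. conj_pow N l (Suc k) U i i * diag_mon N l U m \<partial>\<mu>)
      = (\<integral>U. conj_pow N l k U i i * diag_mon N l U (add_mset i m) \<partial>\<mu>)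
      + (\<Sum>c\<in>{..<N} - {i}. \<integral>U. conj_pow N l 1 U i c * conj_pow N l k U c i * diag_mon N l U m \<partial>\<mu>)" .
  have "of_nat (Suc (count m i)) * mom l k i (add_mset i m) = (\<integral>U. conj_pow N l k U i i * diag_mon N l U (add_mset i m) \<partial>\<mu>) / mfact m"
    using True i by (simp add: mom_def mfact_add del: of_nat_Suc)
  moreover have "(\<Sum>c\<in>{..<N} - {i}. cross_mom l k i c m)
      = (\<Sum>c\<in>{..<N} - {i}. \<integral>U. conj_pow N l 1 U i c * conj_pow N l k U c i * diag_mon N l U m \<partial>\<mu>) / mfact m"
    using True by (simp add: cross_mom_def sum_divide_distrib)
  moreover have "mom l (Suc k) i m = (\<integral>U. conj_pow N l (Suc k) U i i * diag_mon N l U m \<partial>\<mu>) / mfact m"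
    using True by (simp add: mom_def)
  ultimately show ?thesis unfolding * by (simp only: add_divide_distrib)
qed (auto simp: mom_def cross_mom_def)

text \<open>
  The Schwinger-Dyson equation in terms of coefficients: it says that \<open>x_i - x_c\<close> times
  the series of the cross moments is the difference of the series of the moments. The combinatorial
  factors \<open>count m i\<close> are absorbed by \<open>mfact\<close>.
\<close>
lemma mom_diff:
  assumes ic: "i < N" "c < N" "i \<noteq> c"
  shows "mom l k i m - mom l k c m = (if i \<in># m then cross_mom l k i c (m - {#i#}) else 0)
      - (if c \<in># m then cross_mom l k i c (m - {#c#}) else 0)"
proof (cases "set_mset m \<subseteq> {..<N}")
  case True
  define D where "D U = diag_mon N l U m" for U
  define Q where "Q U = conj_pow N l k U c i * conj_pow N l 1 U i c" for U
  have sub: "set_mset (m - {#j#}) \<subseteq> {..<N}" for j using True by (auto dest: in_diffD)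
  have iQ: "integrable \<mu> (\<lambda>U. Q U * diag_mon N l U (m - {#j#}))" for j
    using ic sub unfolding Q_def by (intro integrable_cross) auto
  have I: "of_nat (count m j) * (\<integral>U. Q U * diag_mon N l U (m - {#j#}) \<partial>\<mu>)
      = mfact m * (if j \<in># m then cross_mom l k i c (m - {#j#}) else 0)" for j
  proof (cases "j \<in># m")
    case True
    then show ?thesis
      using sub[of j] mfact_nonzero[of "m - {#j#}"] by (simp add: cross_mom_def mfact_remove Q_def mult_ac)
  next
    case False
    moreover from False have "count m j = 0" by (simp add: not_in_iff)
    ultimately show ?thesis by simp
  qed
  have "(\<integral>U. (conj_pow N l k U c c - conj_pow N l k U i i) * D U \<partial>\<mu>)
      = (\<integral>U. conj_pow N l k U c c * D U \<partial>\<mu>) - (\<integral>U. conj_pow N l k U i i * D U \<partial>\<mu>)"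
    unfolding left_diff_distrib D_def
    by (intro Bochner_Integration.integral_diff integrable_diag ic True)
  also have "\<dots> = mfact m * (mom l k c m - mom l k i m)"
    using True mfact_nonzero[of m] by (simp add: mom_def D_def right_diff_distrib)
  finally have 1: "(\<integral>U. (conj_pow N l k U c c - conj_pow N l k U i i) * D U \<partial>\<mu>) = mfact m * (mom l k c m - mom l k i m)" .
  have "(\<integral>U. Q U * (of_nat (count m i) * diag_mon N l U (m - {#i#}) - of_nat (count m c) * diag_mon N l U (m - {#c#})) \<partial>\<mu>)
      = (\<integral>U. of_nat (count m i) * (Q U * diag_mon N l U (m - {#i#})) - of_nat (count m c) * (Q U * diag_mon N l U (m - {#c#})) \<partial>\<mu>)"
    by (simp add: right_diff_distrib mult_ac)
  also have "\<dots> = of_nat (count m i) * (\<integral>U. Q U * diag_mon N l U (m - {#i#}) \<partial>\<mu>) - of_nat (count m c) * (\<integral>U. Q U * diag_mon N l U (m - {#c#}) \<partial>\<mu>)"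
    by (subst Bochner_Integration.integral_diff) (auto intro!: iQ integrable_mult_right simp del: integrable_mult_right_iff)
  finally have 2: "(\<integral>U. Q U * (of_nat (count m i) * diag_mon N l U (m - {#i#}) - of_nat (count m c) * diag_mon N l U (m - {#c#})) \<partial>\<mu>)
      = mfact m * ((if i \<in># m then cross_mom l k i c (m - {#i#}) else 0) - (if c \<in># m then cross_mom l k i c (m - {#c#}) else 0))"
    unfolding I by (simp only: right_diff_distrib)
  have "mfact m * ((mom l k c m - mom l k i m) + ((if i \<in># m then cross_mom l k i c (m - {#i#}) else 0) - (if c \<in># m then cross_mom l k i c (m - {#c#}) else 0))) = 0"
    using Schwinger_Dyson[OF ic True, of l k] unfolding distrib_left 1[symmetric] 2[symmetric] D_def Q_def .
  then have "(mom l k c m - mom l k i m) + ((if i \<in># m then cross_mom l k i c (m - {#i#}) else 0) - (if c \<in># m then cross_mom l k i c (m - {#c#}) else 0)) = 0"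
    using mfact_nonzero[of m] by (metis mult_eq_0_iff)
  then show ?thesis by (simp add: algebra_simps)
next
  case False
  then have "\<not> set_mset (m - {#j#}) \<subseteq> {..<N}" if "j < N" for j
    using that by (auto simp: subset_iff in_diff_count)
  with False ic show ?thesis by (simp add: mom_def cross_mom_def)
qed

text \<open>
  Right multiplication of \<open>U\<close> by a permutation matrix renumbers the diagonal entries of
  \<open>U^* D U\<close>.
\<close>
lemma mom_swap:
  assumes inv: "\<And>x. \<pi> (\<pi> x) = x" and \<pi>: "\<And>x. x < N \<Longrightarrow> \<pi> x < N" and i: "i < N"
  shows "mom l k (\<pi> i) (image_mset \<pi> m) = mom l k i m"
proof (cases "set_mset m \<subseteq> {..<N}")
  case True
  then have T': "set_mset (image_mset \<pi> m) \<subseteq> {..<N}" using \<pi> by auto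
  define h where "h U = conj_pow N l k U i i * diag_mon N l U m" for U
  have V: "swap_mat N \<pi> \<in> unitary_group N" by (rule swap_mat_unitary[OF inv \<pi>])
  have "(\<integral>U. h (U * swap_mat N \<pi>) \<partial>\<mu>) = (\<integral>U. h U \<partial>\<mu>)"
  proof (rule integral_right[OF V])
    show "h \<in> borel_measurable \<mu>"
      unfolding h_def[abs_def] by (intro borel_measurable_times measurable_conj_pow measurable_diag_mon i True)
    show "cmod (h U) \<le> (\<Sum>p<N. \<bar>l p\<bar> ^ k) * (\<Sum>p<N. \<bar>l p\<bar>) ^ size m" if "U \<in> unitary_group N" for U
      unfolding h_def norm_mult
      by (intro mult_mono norm_conj_pow_le norm_diag_mon_le sum_nonneg) (use i True that in auto)
  qed
  moreover have "(\<integral>U. h (U * swap_mat N \<pi>) \<partial>\<mu>) = (\<integral>U. conj_pow N l k U (\<pi> i) (\<pi> i) * diag_mon N l U (image_mset \<pi> m) \<partial>\<mu>)"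
    by (rule Bochner_Integration.integral_cong[OF refl])
       (simp add: h_def space_haar conj_pow_swap[OF inv \<pi> unitary_carrier i i] diag_mon_swap[OF inv \<pi> unitary_carrier True])
  ultimately show ?thesis using True T' by (simp add: mom_def h_def mfact_image[OF inv])
next
  case False
  then have "\<not> set_mset (image_mset \<pi> m) \<subseteq> {..<N}"
    using \<pi> inv by (auto simp: subset_iff) (metis lessThan_iff)
  with False show ?thesis by (simp add: mom_def)
qed

lemma mom_0: assumes "i < N" shows "mom l 0 i m = (if set_mset m \<subseteq> {..<N} then (\<integral>U. diag_mon N l U m \<partial>\<mu>) / mfact m else 0)"
proof -
  have "(\<integral>U. conj_pow N l 0 U i i * diag_mon N l U m \<partial>\<mu>) = (\<integral>U. diag_mon N l U m \<partial>\<mu>)"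
    by (rule Bochner_Integration.integral_cong[OF refl]) (simp add: space_haar conj_pow_0 assms)
  then show ?thesis by (simp add: mom_def)
qed

lemma mom_0_empty: assumes "i < N" shows "mom l 0 i {#} = 1"
  using assms by (simp add: mom_0 prob_space)

lemma sum_mom: "(\<Sum>i<N. mom l k i {#}) = of_real (\<Sum>p<N. l p ^ k)"
proof -
  have "(\<Sum>i<N. mom l k i {#}) = (\<Sum>i<N. \<integral>U. conj_pow N l k U i i * diag_mon N l U {#} \<partial>\<mu>)"
    by (simp add: mom_def)
  also have "\<dots> = (\<integral>U. (\<Sum>i<N. conj_pow N l k U i i * diag_mon N l U {#}) \<partial>\<mu>)"
    by (rule Bochner_Integration.integral_sum[symmetric]) (auto intro!: integrable_diag simp del: diag_mon_empty)
  also have "\<dots> = (\<integral>U. of_real (\<Sum>p<N. l p ^ k) \<partial>\<mu>)"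
    by (rule Bochner_Integration.integral_cong[OF refl]) (simp add: space_haar conj_pow_trace)
  finally show ?thesis by (simp add: prob_space)
qed

end

section \<open>Eigenvalues of random Hermitian matrices\<close>

lemma mat_trace_mult_commute:
  fixes A B :: "complex mat"
  assumes "A \<in> carrier_mat n n" "B \<in> carrier_mat n n"
  shows "mat_trace (A * B) = mat_trace (B * A)"
proof -
  have tr: "mat_trace (X * Y) = (\<Sum>i<n. \<Sum>k<n. X $$ (i, k) * Y $$ (k, i))"
    if "X \<in> carrier_mat n n" "Y \<in> carrier_mat n n" for X Y :: "complex mat"
    unfolding mat_trace_def using that by (auto simp del: index_mult_mat(1) simp: mat_mult_nth[OF that])
  show ?thesis
    unfolding tr[OF assms] tr[OF assms(2,1)] by (subst sum.swap) (simp add: mult.commute)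
qed

lemma upper_triangular_pow:
  fixes B :: "complex mat"
  assumes B: "B \<in> carrier_mat n n" and ut: "upper_triangular B"
  shows "(\<forall>i<n. \<forall>j<i. (B ^\<^sub>m k) $$ (i, j) = 0) \<and> (\<forall>i<n. (B ^\<^sub>m k) $$ (i, i) = (B $$ (i, i)) ^ k)"
proof (induction k)
  case 0
  then show ?case using B by auto
next
  case (Suc k)
  have Bk: "B ^\<^sub>m k \<in> carrier_mat n n" using B by simp
  have ut': "B $$ (i, j) = 0" if "j < i" "i < n" for i j using ut B that by (auto dest: upper_triangularD)
  have low: "(B ^\<^sub>m Suc k) $$ (i, j) = 0" if "i < n" "j < i" for i j
  proof -
    have "(B ^\<^sub>m Suc k) $$ (i, j) = (\<Sum>c<n. (B ^\<^sub>m k) $$ (i, c) * B $$ (c, j))"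
      using mat_mult_nth[OF Bk B] that by simp
    also have "\<dots> = 0"
    proof (intro sum.neutral ballI)
      fix c assume "c \<in> {..<n}"
      then show "(B ^\<^sub>m k) $$ (i, c) * B $$ (c, j) = 0"
        using Suc that ut'[of j c] by (cases "c < i") auto
    qed
    finally show ?thesis .
  qed
  have diag: "(B ^\<^sub>m Suc k) $$ (i, i) = B $$ (i, i) ^ Suc k" if "i < n" for i
  proof -
    have "(B ^\<^sub>m Suc k) $$ (i, i) = (\<Sum>c<n. (B ^\<^sub>m k) $$ (i, c) * B $$ (c, i))"
      using mat_mult_nth[OF Bk B] that by simp
    also have "\<dots> = (\<Sum>c\<in>{i}. (B ^\<^sub>m k) $$ (i, c) * B $$ (c, i))"
    proof (intro sum.mono_neutral_right ballI)
      fix c assume "c \<in> {..<n} - {i}"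
      then show "(B ^\<^sub>m k) $$ (i, c) * B $$ (c, i) = 0"
        using Suc that ut'[of i c] by (cases "c < i") auto
    qed (use that in auto)
    finally show ?thesis using Suc that by simp
  qed
  show ?case using low diag by blast
qed

lemma hermitian_eigenvalue_real:
  assumes M: "M \<in> hermitian_mats n" and e: "eigenvalue M e"
  shows "complex_of_real (Re e) = e"
proof -
  have c: "M \<in> carrier_mat n n" and adj: "mat_adjoint M = M" using M by (auto simp: hermitian_mats_def)
  obtain v where v: "v \<in> carrier_vec n" "v \<noteq> 0\<^sub>v n" "M *\<^sub>v v = e \<cdot>\<^sub>v v"
    using e c by (auto simp: eigenvalue_def eigenvector_def)
  have Mv: "(\<Sum>j<n. M $$ (i, j) * v $ j) = e * v $ i" if "i < n" for i
  proof -
    have "(M *\<^sub>v v) $ i = (\<Sum>j<n. M $$ (i, j) * v $ j)"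
      using c v(1) that by (auto simp: scalar_prod_def atLeast0LessThan intro!: sum.cong)
    then show ?thesis using v that by simp
  qed
  have herm: "M $$ (i, j) = cnj (M $$ (j, i))" if "i < n" "j < n" for i j
    using mat_adjoint_nth[OF c that] adj by simp
  define s where "s = (\<Sum>i<n. v $ i * cnj (v $ i))"
  have "e * s = (\<Sum>i<n. (\<Sum>j<n. M $$ (i, j) * v $ j) * cnj (v $ i))"
    unfolding s_def sum_distrib_left
  proof (intro sum.cong refl)
    fix i assume "i \<in> {..<n}"
    then show "e * (v $ i * cnj (v $ i)) = (\<Sum>j<n. M $$ (i, j) * v $ j) * cnj (v $ i)" by (subst Mv) auto
  qed
  also have "\<dots> = (\<Sum>i<n. \<Sum>j<n. cnj (M $$ (j, i)) * v $ j * cnj (v $ i))"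
    unfolding sum_distrib_right
  proof (intro sum.cong refl)
    fix i j assume "i \<in> {..<n}" "j \<in> {..<n}"
    then have "M $$ (i, j) = cnj (M $$ (j, i))" by (intro herm) auto
    then show "M $$ (i, j) * v $ j * cnj (v $ i) = cnj (M $$ (j, i)) * v $ j * cnj (v $ i)" by (simp only:)
  qed
  also have "\<dots> = (\<Sum>j<n. v $ j * cnj (\<Sum>i<n. M $$ (j, i) * v $ i))"
    by (subst sum.swap) (simp add: sum_distrib_left mult_ac)
  also have "\<dots> = cnj e * s"
    unfolding s_def sum_distrib_left
  proof (intro sum.cong refl)
    fix i assume "i \<in> {..<n}"
    then show "v $ i * cnj (\<Sum>j<n. M $$ (i, j) * v $ j) = cnj e * (v $ i * cnj (v $ i))" by (subst Mv) auto
  qed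
  finally have "(e - cnj e) * s = 0" by (simp add: algebra_simps)
  moreover have "s \<noteq> 0"
  proof
    assume "s = 0"
    then have "complex_of_real (\<Sum>i<n. (cmod (v $ i))\<^sup>2) = 0"
      unfolding s_def of_real_sum complex_norm_square .
    then have "(\<Sum>i<n. (cmod (v $ i))\<^sup>2) = 0" by (metis of_real_eq_0_iff)
    then have "\<forall>i<n. v $ i = 0" by (subst (asm) sum_nonneg_eq_0_iff) auto
    then have "v = 0\<^sub>v n" using v(1) by (intro eq_vecI) auto
    with v(2) show False ..
  qed
  ultimately have "e = cnj e" by simp
  then have "Im e = 0" by (simp add: complex_eq_iff)
  then show ?thesis by (simp add: complex_eq_iff)
qed

text \<open>
  The Schur decomposition shows that the power sums of the roots of the characteristic polynomial
  are the traces of the powers of the matrix.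
\<close>
lemma eigval_sorted_list:
  assumes M: "M \<in> hermitian_mats n"
  obtains xs where "length xs = n" "sorted xs" "\<And>i. eigval M i = xs ! i"
    "\<And>k. complex_of_real (\<Sum>x\<leftarrow>xs. x ^ k) = mat_trace (M ^\<^sub>m k)"
proof -
  have c: "M \<in> carrier_mat n n" using M by (auto simp: hermitian_mats_def)
  obtain es where es: "char_poly M = (\<Prod>e\<leftarrow>es. [:- e, 1:])" "length es = n"
    using char_poly_factorized[OF c] by blast
  obtain B P Q where BPQ: "schur_decomposition M es = (B, P, Q)" by (metis prod_cases3)
  from schur_decomposition[OF c es(1) BPQ]
  have sim: "similar_mat_wit M B P Q" and ut: "upper_triangular B" and diag: "diag_mat B = es" by auto
  note D = similar_mat_witD2[OF c sim]
  have proots: "proots (char_poly M) = mset es"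
  proof -
    have "proots (\<Prod>e\<leftarrow>es. [:- e, 1:]) = mset es"
    proof (induction es)
      case (Cons a es)
      have "(\<Prod>e\<leftarrow>es. [:- e, 1:]) \<noteq> (0 :: complex poly)" by (auto simp: prod_list_zero_iff)
      then have "proots ([:- a, 1:] * (\<Prod>e\<leftarrow>es. [:- e, 1:])) = proots [:- a, 1:] + proots (\<Prod>e\<leftarrow>es. [:- e, 1:])"
        by (intro proots_mult) auto
      moreover have "proots [:- a, 1:] = {#a#}" by simp
      ultimately show ?case using Cons by (simp only: list.map prod_list.Cons mset.simps) simp
    qed simp
    then show ?thesis by (simp add: es(1))
  qed
  define xs where "xs = sort (map Re es)"
  have root: "complex_of_real (Re e) = e" if "e \<in> set es" for e
  proof -
    have "poly (char_poly M) e = 0" using that unfolding es(1) by (induction es) auto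
    then show ?thesis using hermitian_eigenvalue_real[OF M] eigenvalue_root_char_poly[OF c] by blast
  qed
  have tr: "complex_of_real (\<Sum>x\<leftarrow>xs. x ^ k) = mat_trace (M ^\<^sub>m k)" for k
  proof -
    have Bc: "B \<in> carrier_mat n n" "P \<in> carrier_mat n n" "Q \<in> carrier_mat n n" using D by auto
    have Bk: "B ^\<^sub>m k \<in> carrier_mat n n" using Bc by simp
    have "mat_trace (M ^\<^sub>m k) = mat_trace (P * B ^\<^sub>m k * Q)" using similar_mat_wit_pow_id[OF sim] by simp
    also have "\<dots> = mat_trace (Q * (P * B ^\<^sub>m k))"
      using Bc Bk by (intro mat_trace_mult_commute) auto
    also have "Q * (P * B ^\<^sub>m k) = B ^\<^sub>m k"
      using assoc_mult_mat[OF Bc(3) Bc(2) Bk, symmetric] D Bk by simp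
    also have "mat_trace (B ^\<^sub>m k) = (\<Sum>i<n. B $$ (i, i) ^ k)"
      using upper_triangular_pow[OF Bc(1) ut, of k] Bk unfolding mat_trace_def by auto
    also have "\<dots> = (\<Sum>e\<leftarrow>es. e ^ k)"
      using Bc(1) unfolding diag[symmetric] diag_mat_def
      by (simp add: sum_list_distinct_conv_sum_set atLeast0LessThan comp_def)
    also have "\<dots> = (\<Sum>e\<leftarrow>es. complex_of_real (Re e ^ k))"
      by (intro arg_cong[where f = sum_list] map_cong refl) (simp add: root)
    also have "\<dots> = complex_of_real (\<Sum>e\<leftarrow>es. Re e ^ k)" by (induction es) auto
    also have "(\<Sum>e\<leftarrow>es. Re e ^ k) = (\<Sum>x\<leftarrow>xs. x ^ k)"
    proof -
      have "(\<Sum>x\<leftarrow>xs. x ^ k) = (\<Sum>x\<in>#mset xs. x ^ k)" by (simp flip: sum_mset_sum_list)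
      also have "mset xs = mset (map Re es)" by (simp add: xs_def)
      also have "(\<Sum>x\<in>#mset (map Re es). x ^ k) = (\<Sum>x\<leftarrow>map Re es. x ^ k)" by (metis mset_map sum_mset_sum_list)
      finally show ?thesis by (simp add: comp_def)
    qed
    finally show ?thesis by simp
  qed
  show ?thesis
  proof (rule that)
    show "length xs = n" "sorted xs" using es by (auto simp: xs_def)
    show "eigval M i = xs ! i" for i
    proof -
      have "image_mset Re (mset es) = mset (map Re es)" by simp
      then show ?thesis unfolding eigval_def proots xs_def by (metis sorted_list_of_multiset_mset)
    qed
  qed (rule tr)
qed

lemma sum_eigval_pow:
  assumes "M \<in> hermitian_mats n"
  shows "(\<Sum>i<n. eigval M i ^ k) = Re (mat_trace (M ^\<^sub>m k))"
proof -
  obtain xs where xs: "length xs = n" "\<And>i. eigval M i = xs ! i"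
    "\<And>k. complex_of_real (\<Sum>x\<leftarrow>xs. x ^ k) = mat_trace (M ^\<^sub>m k)"
    using eigval_sorted_list[OF assms] by metis
  have "(\<Sum>i<n. eigval M i ^ k) = (\<Sum>x\<leftarrow>xs. x ^ k)"
    unfolding xs(2) by (simp add: sum_list_sum_nth xs(1) atLeast0LessThan)
  then show ?thesis using xs(3)[of k] by (metis Re_complex_of_real)
qed

text \<open>
  As the eigenvalues are listed in increasing order, each of them is determined by how many
  eigenvalues lie below each level.
\<close>
lemma eigval_le_iff:
  assumes "M \<in> hermitian_mats n" "i < n"
  shows "eigval M i \<le> c \<longleftrightarrow> i < card {j \<in> {..<n}. eigval M j \<le> c}"
proof -
  obtain xs where xs: "length xs = n" "sorted xs" "\<And>i. eigval M i = xs ! i"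
    using eigval_sorted_list[OF assms(1)] by metis
  show ?thesis
  proof
    assume "eigval M i \<le> c"
    then have "{..i} \<subseteq> {j \<in> {..<n}. eigval M j \<le> c}"
      using assms(2) xs by (auto intro: order_trans sorted_nth_mono)
    from card_mono[OF _ this] show "i < card {j \<in> {..<n}. eigval M j \<le> c}" by simp
  next
    assume *: "i < card {j \<in> {..<n}. eigval M j \<le> c}"
    show "eigval M i \<le> c"
    proof (rule ccontr)
      assume "\<not> eigval M i \<le> c"
      then have "{j \<in> {..<n}. eigval M j \<le> c} \<subseteq> {..<i}"
        using xs by (auto simp: not_le) (metis leD le_less_linear order_trans sorted_nth_mono)
      from card_mono[OF _ this] * show False by simp
    qed
  qed
qed

text \<open>
  Power sums determine the sums of all polynomial functions, and polynomials approximate a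
  continuous function uniformly on the interval \<open>[-m, m]\<close> with error below
  \<open>1/(m+1)\<close>, hence pointwise as \<open>m \<rightarrow> \<infinity>\<close>.
\<close>
lemma measurable_sum_continuous_comp:
  fixes f :: "nat \<Rightarrow> 'a \<Rightarrow> real" and \<phi> :: "real \<Rightarrow> real"
  assumes pow: "\<And>k. (\<lambda>\<omega>. \<Sum>i<n. f i \<omega> ^ k) \<in> borel_measurable P" and \<phi>: "continuous_on UNIV \<phi>"
  shows "(\<lambda>\<omega>. \<Sum>i<n. \<phi> (f i \<omega>)) \<in> borel_measurable P"
proof -
  have "\<exists>g. real_polynomial_function g \<and> (\<forall>x\<in>{- real m..real m}. \<bar>\<phi> x - g x\<bar> < 1 / real (Suc m))" for m
  proof -
    have "continuous_on {- real m..real m} \<phi>" using \<phi> continuous_on_subset by blast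
    from Stone_Weierstrass_real_polynomial_function[OF compact_Icc this, of "1 / real (Suc m)"]
    show ?thesis by (metis of_nat_0_less_iff zero_less_Suc zero_less_divide_1_iff)
  qed
  then obtain g where g: "\<And>m. real_polynomial_function (g m)"
    "\<And>m x. x \<in> {- real m..real m} \<Longrightarrow> \<bar>\<phi> x - g m x\<bar> < 1 / real (Suc m)" by metis
  have gm: "(\<lambda>\<omega>. \<Sum>i<n. g m (f i \<omega>)) \<in> borel_measurable P" for m
  proof -
    obtain a d where gd: "g m = (\<lambda>x. \<Sum>k\<le>d. a k * x ^ k)" using g(1) real_polynomial_function_iff_sum by metis
    have "(\<lambda>\<omega>. \<Sum>i<n. g m (f i \<omega>)) = (\<lambda>\<omega>. \<Sum>k\<le>d. a k * (\<Sum>i<n. f i \<omega> ^ k))"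
      unfolding gd by (subst sum.swap) (simp add: sum_distrib_left)
    then show ?thesis using pow by simp
  qed
  have lim: "(\<lambda>m. g m x) \<longlonglongrightarrow> \<phi> x" for x
  proof (rule LIM_zero_cancel, rule Lim_null_comparison)
    show "\<forall>\<^sub>F m in sequentially. norm (g m x - \<phi> x) \<le> 1 / real (Suc m)"
    proof -
      obtain m0 where m0: "\<bar>x\<bar> \<le> real m0" using real_arch_simple by blast
      show ?thesis
        using eventually_ge_at_top[of m0]
      proof eventually_elim
        case (elim m)
        then have "x \<in> {- real m..real m}" using m0 by auto
        from g(2)[OF this] show ?case by (simp add: abs_minus_commute)
      qed
    qed
    show "(\<lambda>m. 1 / real (Suc m)) \<longlonglongrightarrow> 0" by (rule lim_1_over_n[THEN LIMSEQ_Suc])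
  qed
  show ?thesis
  proof (rule borel_measurable_LIMSEQ_real)
    show "(\<lambda>m. \<Sum>i<n. g m (f i \<omega>)) \<longlonglongrightarrow> (\<Sum>i<n. \<phi> (f i \<omega>))" for \<omega>
      by (intro tendsto_sum lim)
  qed (rule gm)
qed

lemma measurable_card_le:
  fixes f :: "nat \<Rightarrow> 'a \<Rightarrow> real"
  assumes pow: "\<And>k. (\<lambda>\<omega>. \<Sum>i<n. f i \<omega> ^ k) \<in> borel_measurable P"
  shows "(\<lambda>\<omega>. real (card {j \<in> {..<n}. f j \<omega> \<le> c})) \<in> borel_measurable P"
proof -
  (* Continuous piecewise linear functions that decrease to the indicator of the half line up to
     c. *)
  define \<phi> where "\<phi> m x = max 0 (min 1 (1 - real m * (x - c)))" for m x
  have lim: "(\<lambda>m. \<phi> m x) \<longlonglongrightarrow> (if x \<le> c then 1 else 0)" for x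
  proof (cases "x \<le> c")
    case True
    then have "\<phi> m x = 1" for m by (simp add: \<phi>_def mult_nonneg_nonpos)
    with True show ?thesis by simp
  next
    case False
    obtain m0 where m0: "1 / (x - c) \<le> real m0" using real_arch_simple by blast
    have "\<forall>\<^sub>F m in sequentially. \<phi> m x = 0"
      using eventually_ge_at_top[of m0]
    proof eventually_elim
      case (elim m)
      then have "1 / (x - c) \<le> real m" using m0 by linarith
      then have "1 \<le> real m * (x - c)" using False by (simp add: field_simps)
      then show ?case by (simp add: \<phi>_def)
    qed
    with False show ?thesis by (simp add: tendsto_eventually)
  qed
  have meas: "(\<lambda>\<omega>. \<Sum>i<n. \<phi> m (f i \<omega>)) \<in> borel_measurable P" for m
    by (rule measurable_sum_continuous_comp[OF pow]) (auto simp: \<phi>_def intro!: continuous_intros)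
  have "(\<lambda>\<omega>. \<Sum>i<n. if f i \<omega> \<le> c then 1 else 0 :: real) \<in> borel_measurable P"
  proof (rule borel_measurable_LIMSEQ_real)
    show "(\<lambda>m. \<Sum>i<n. \<phi> m (f i \<omega>)) \<longlonglongrightarrow> (\<Sum>i<n. if f i \<omega> \<le> c then 1 else 0)" for \<omega>
      by (intro tendsto_sum lim)
  qed (rule meas)
  also have "(\<lambda>\<omega>. \<Sum>i<n. if f i \<omega> \<le> c then 1 else 0 :: real) = (\<lambda>\<omega>. real (card {j \<in> {..<n}. f j \<omega> \<le> c}))"
    by (simp add: sum.If_cases Int_def)
  finally show ?thesis .
qed

text \<open>
  The entries of the powers of a random matrix are measurable, hence so are their traces, which are
  the power sums of the eigenvalues; from these, the number of eigenvalues below a level is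
  obtained.
\<close>
lemma measurable_eigval:
  assumes A: "random_hermitian N P A" and i: "i < N"
  shows "(\<lambda>\<omega>. eigval (A \<omega>) i) \<in> borel_measurable P"
proof -
  have Am: "A \<in> measurable P (borel_mat N)" and Ah: "\<And>\<omega>. \<omega> \<in> space P \<Longrightarrow> A \<omega> \<in> hermitian_mats N"
    using A by (auto simp: random_hermitian_def)
  then have Ac: "A \<omega> \<in> carrier_mat N N" if "\<omega> \<in> space P" for \<omega> using that by (auto simp: hermitian_mats_def)
  have entry: "(\<lambda>\<omega>. A \<omega> $$ (a, b)) \<in> borel_measurable P" if "a < N" "b < N" for a b
    using measurable_compose[OF Am measurable_borel_mat_entry[OF that]] .
  have pow_entry: "(\<lambda>\<omega>. (A \<omega> ^\<^sub>m k) $$ (a, b)) \<in> borel_measurable P" if "a < N" "b < N" for a b k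
    using that
  proof (induction k arbitrary: a b)
    case 0
    have "(\<lambda>\<omega>. if a = b then 1 else 0 :: complex) \<in> borel_measurable P" by simp
    also have "?this \<longleftrightarrow> (\<lambda>\<omega>. (A \<omega> ^\<^sub>m 0) $$ (a, b)) \<in> borel_measurable P"
      using 0 by (intro measurable_cong) (simp add: carrier_matD(1)[OF Ac])
    finally show ?case .
  next
    case (Suc k)
    have "(\<lambda>\<omega>. \<Sum>c<N. (A \<omega> ^\<^sub>m k) $$ (a, c) * A \<omega> $$ (c, b)) \<in> borel_measurable P"
      using Suc by (intro borel_measurable_sum borel_measurable_times Suc.IH entry) auto
    also have "?this \<longleftrightarrow> (\<lambda>\<omega>. (A \<omega> ^\<^sub>m Suc k) $$ (a, b)) \<in> borel_measurable P"
    proof (intro measurable_cong)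
      fix \<omega> assume "\<omega> \<in> space P"
      from mat_mult_nth[OF pow_carrier_mat[OF Ac[OF this]] Ac[OF this] Suc.prems]
      show "(\<Sum>c<N. (A \<omega> ^\<^sub>m k) $$ (a, c) * A \<omega> $$ (c, b)) = (A \<omega> ^\<^sub>m Suc k) $$ (a, b)" by simp
    qed
    finally show ?case .
  qed
  have pow: "(\<lambda>\<omega>. \<Sum>i<N. eigval (A \<omega>) i ^ k) \<in> borel_measurable P" for k
  proof -
    have "(\<lambda>\<omega>. Re (\<Sum>a<N. (A \<omega> ^\<^sub>m k) $$ (a, a))) \<in> borel_measurable P"
      by (rule measurable_compose[OF _ borel_measurable_continuous_onI[of Re]])
         (auto intro!: borel_measurable_sum pow_entry continuous_intros)
    also have "?this \<longleftrightarrow> ?thesis"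
      by (intro measurable_cong) (use Ac in \<open>auto simp: sum_eigval_pow[OF Ah] mat_trace_def\<close>)
    finally show ?thesis .
  qed
  show ?thesis
  proof (rule borel_measurableI_le)
    fix c
    have "{\<omega> \<in> space P. eigval (A \<omega>) i \<le> c} = {\<omega> \<in> space P. real i < real (card {j \<in> {..<N}. eigval (A \<omega>) j \<le> c})}"
      using eigval_le_iff[OF Ah i] by auto
    also have "\<dots> \<in> sets P"
      by (intro borel_measurable_less measurable_card_le pow) simp
    finally show "{\<omega> \<in> space P. eigval (A \<omega>) i \<le> c} \<in> sets P" .
  qed
qed

section \<open>The expected Harish-Chandra integral as a power series\<close>

lemma multinomial_expansion:
  fixes z :: "nat \<Rightarrow> complex"
  shows "(\<Sum>j<r. z j) ^ n / fact n = (\<Sum>m\<in>msets r n. (\<Prod>j\<in>#m. z j) / mfact m)"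
proof (induction n)
  case 0
  have "msets r 0 = {{#}}" by auto
  then show ?case by simp
next
  case (Suc n)
  let ?S = "\<lambda>n. msets r n"
  have "(\<Sum>j<r. z j) * (\<Sum>m\<in>?S n. (\<Prod>j\<in>#m. z j) / mfact m)
      = (\<Sum>(j, m)\<in>{..<r} \<times> ?S n. (\<Prod>i\<in>#add_mset j m. z i) / mfact m)"
    by (simp add: sum_product sum.cartesian_product)
  also have "\<dots> = (\<Sum>(m, j)\<in>(SIGMA m:?S (Suc n). set_mset m). (\<Prod>i\<in>#m. z i) / mfact m * of_nat (count m j))"
  proof (rule sum.reindex_bij_witness[of _ "\<lambda>(m, j). (j, m - {#j#})" "\<lambda>(j, m). (add_mset j m, j)"], goal_cases)
    case (5 a)
    have "x * of_nat (Suc k) / (of_nat (Suc k) * y) = x / y" for k and x y :: complex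
      by (simp del: of_nat_Suc)
    then show ?case by (cases a) (simp add: mfact_add del: of_nat_Suc)
  qed (auto dest: in_diffD simp: size_Diff_singleton)
  also have "\<dots> = (\<Sum>m\<in>?S (Suc n). \<Sum>j\<in>set_mset m. (\<Prod>i\<in>#m. z i) / mfact m * of_nat (count m j))"
    by (subst sum.Sigma) (auto simp: finite_msets_size)
  also have "\<dots> = (\<Sum>m\<in>?S (Suc n). (\<Prod>i\<in>#m. z i) / mfact m * of_nat (Suc n))"
  proof (intro sum.cong refl)
    fix m assume "m \<in> ?S (Suc n)"
    then have "(\<Sum>j\<in>set_mset m. count m j) = Suc n" by (simp add: size_multiset_overloaded_eq)
    then show "(\<Sum>j\<in>set_mset m. (\<Prod>i\<in>#m. z i) / mfact m * of_nat (count m j)) = (\<Prod>i\<in>#m. z i) / mfact m * of_nat (Suc n)"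
      unfolding sum_distrib_left[symmetric] of_nat_sum[symmetric] by simp
  qed
  also have "\<dots> = of_nat (Suc n) * (\<Sum>m\<in>?S (Suc n). (\<Prod>i\<in>#m. z i) / mfact m)"
    by (simp add: sum_distrib_left mult.commute del: of_nat_Suc)
  finally have "of_nat (Suc n) * (\<Sum>m\<in>?S (Suc n). (\<Prod>i\<in>#m. z i) / mfact m) = (\<Sum>j<r. z j) * ((\<Sum>j<r. z j) ^ n / fact n)"
    using Suc by simp
  then show ?case by (simp add: field_simps del: of_nat_Suc)
qed

lemma exp_series_integral:
  fixes X :: "'u \<Rightarrow> complex"
  assumes X [measurable]: "X \<in> borel_measurable Q" and int: "integrable Q (\<lambda>u. exp (cmod (X u)))"
  shows "integrable Q (\<lambda>u. X u ^ n / fact n)" "(\<lambda>n. \<integral>u. X u ^ n / fact n \<partial>Q) sums (\<integral>u. exp (X u) \<partial>Q)"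
proof -
  have partial: "(\<Sum>i<n. cmod (X u ^ i / fact i)) \<le> exp (cmod (X u))" for u n
    unfolding norm_divide norm_power norm_fact
    using sum_le_suminf[OF summable_exp_generic[of "cmod (X u)"], of "{..<n}"]
    by (simp add: exp_def field_simps)
  have le: "cmod (X u ^ n / fact n) \<le> exp (cmod (X u))" for u n
    using partial[of u "Suc n"] sum_nonneg[of "{..<n}" "\<lambda>i. cmod (X u ^ i / fact i)"] by simp
  show i: "integrable Q (\<lambda>u. X u ^ n / fact n)" for n
    by (rule Bochner_Integration.integrable_bound[OF int]) (auto intro: le)
  have summ: "summable (\<lambda>n. cmod (X u ^ n / fact n))" for u
    by (rule summableI_nonneg_bounded[OF _ partial]) simp
  have "summable (\<lambda>n. \<integral>u. cmod (X u ^ n / fact n) \<partial>Q)"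
  proof (rule summableI_nonneg_bounded)
    fix n
    have "(\<Sum>i<n. \<integral>u. cmod (X u ^ i / fact i) \<partial>Q) = (\<integral>u. (\<Sum>i<n. cmod (X u ^ i / fact i)) \<partial>Q)"
      by (intro Bochner_Integration.integral_sum[symmetric] integrable_norm i)
    also have "\<dots> \<le> (\<integral>u. exp (cmod (X u)) \<partial>Q)"
      by (intro integral_mono Bochner_Integration.integrable_sum integrable_norm i int partial)
    finally show "(\<Sum>i<n. \<integral>u. cmod (X u ^ i / fact i) \<partial>Q) \<le> (\<integral>u. exp (cmod (X u)) \<partial>Q)" .
  qed simp
  from sums_integral[OF i _ this] summ
  have "(\<lambda>n. \<integral>u. X u ^ n / fact n \<partial>Q) sums (\<integral>u. (\<Sum>n. X u ^ n / fact n) \<partial>Q)" by simp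
  also have "(\<lambda>u. \<Sum>n. X u ^ n / fact n) = (\<lambda>u. exp (X u))"
    by (simp add: exp_def scaleR_conv_of_real field_simps)
  finally show "(\<lambda>n. \<integral>u. X u ^ n / fact n \<partial>Q) sums (\<integral>u. exp (X u) \<partial>Q)" .
qed

abbreviation (input) only0 :: "complex \<Rightarrow> nat \<Rightarrow> complex" where
  "only0 z \<equiv> \<lambda>i. if i = 0 then z else 0"

lemma conj_pow_diag: "conj_pow N l k U a a = of_real (\<Sum>p<N. l p ^ k * (cmod (U $$ (p, a)))\<^sup>2)"
  unfolding conj_pow_def of_real_sum of_real_mult complex_norm_square by (simp add: mult_ac)

lemma mat_diag_carrier: "mat_diag n f \<in> carrier_mat n n"
  by (simp add: mat_diag_def)

text \<open>
  The trace depends on \<open>x\<close> only through the diagonal of \<open>M = U^* D U\<close>, so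
  the Harish-Chandra integral is the joint Laplace transform of the diagonal entries of
  \<open>M\<close>.
\<close>
lemma HC_trace:
  assumes U: "U \<in> carrier_mat N N"
  shows "mat_trace (mat_diag N (\<lambda>i. complex_of_real (l i)) * U * mat_diag N x * mat_adjoint U)
       = (\<Sum>a<N. x a * conj_pow N l 1 U a a)"
proof -
  let ?D = "mat_diag N (\<lambda>i. complex_of_real (l i))" and ?X = "mat_diag N x"
  note cD = mat_diag_carrier[of N "\<lambda>i. complex_of_real (l i)"] and cX = mat_diag_carrier[of N x]
  note cDU = mult_carrier_mat[OF cD U] and cUa = mat_adjoint_carrier[OF U]
  note cDUX = mult_carrier_mat[OF cDU cX]
  have Xe: "?X $$ (k, a) = (if k = a then x a else 0)" if "k < N" "a < N" for k a
    using that by (simp add: mat_diag_def)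
  have DU: "(?D * U) $$ (p, a) = of_real (l p) * U $$ (p, a)" if "p < N" "a < N" for p a
  proof -
    have "(?D * U) $$ (p, a) = (\<Sum>k<N. if k = p then of_real (l p) * U $$ (p, a) else 0)"
      unfolding mat_mult_nth[OF cD U that] by (intro sum.cong refl) (use that in \<open>auto simp: mat_diag_def\<close>)
    then show ?thesis using that by simp
  qed
  have DUX: "(?D * U * ?X) $$ (p, a) = of_real (l p) * U $$ (p, a) * x a" if "p < N" "a < N" for p a
  proof -
    have "(?D * U * ?X) $$ (p, a) = (\<Sum>k<N. if k = a then of_real (l p) * U $$ (p, a) * x a else 0)"
      unfolding mat_mult_nth[OF cDU cX that] by (intro sum.cong refl) (use that in \<open>auto simp: Xe DU[OF that(1)] simp del: index_mult_mat\<close>)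
    then show ?thesis using that by simp
  qed
  have "mat_trace (?D * U * ?X * mat_adjoint U) = (\<Sum>p<N. (?D * U * ?X * mat_adjoint U) $$ (p, p))"
    unfolding mat_trace_def carrier_matD(1)[OF mult_carrier_mat[OF cDUX cUa]] ..
  also have "\<dots> = (\<Sum>p<N. \<Sum>a<N. of_real (l p) * U $$ (p, a) * x a * cnj (U $$ (p, a)))"
  proof (intro sum.cong refl)
    fix p assume "p \<in> {..<N}"
    then have p: "p < N" by simp
    show "(?D * U * ?X * mat_adjoint U) $$ (p, p) = (\<Sum>a<N. of_real (l p) * U $$ (p, a) * x a * cnj (U $$ (p, a)))"
      unfolding mat_mult_nth[OF cDUX cUa p p]
      by (intro sum.cong refl) (use p in \<open>auto simp: DUX mat_adjoint_nth[OF U]\<close>)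
  qed
  also have "\<dots> = (\<Sum>a<N. x a * conj_pow N l 1 U a a)"
    unfolding conj_pow_def by (subst sum.swap) (simp add: sum_distrib_left mult_ac)
  finally show ?thesis .
qed

context haar_measure
begin

lemma HC_eq: "HC \<mu> N x l = (\<integral>U. exp (\<Sum>a<N. x a * conj_pow N l 1 U a a) \<partial>\<mu>)"
  unfolding HC_def by (rule Bochner_Integration.integral_cong[OF refl]) (simp add: HC_trace unitary_carrier space_haar)

lemma integral_exp_diag:
  assumes N: "0 < N" and a: "a < N"
  shows "(\<integral>U. exp (z * conj_pow N l 1 U a a) \<partial>\<mu>) = HC \<mu> N (only0 z) l"
proof -
  let ?\<pi> = "Transposition.transpose 0 a"
  have pi: "\<And>x. ?\<pi> (?\<pi> x) = x" "\<And>x. x < N \<Longrightarrow> ?\<pi> x < N" using N a by (auto simp: Transposition.transpose_def)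
  define h where "h U = exp (z * conj_pow N l 1 U 0 0)" for U
  have "(\<integral>U. h (U * swap_mat N ?\<pi>) \<partial>\<mu>) = (\<integral>U. h U \<partial>\<mu>)"
  proof (rule integral_right[OF swap_mat_unitary[OF pi]])
    show "h \<in> borel_measurable \<mu>"
      unfolding h_def[abs_def]
      by (rule measurable_compose[OF _ borel_measurable_continuous_onI[of exp]])
         (auto intro!: continuous_intros measurable_conj_pow borel_measurable_times N)
    fix U assume U: "U \<in> unitary_group N"
    have "cmod (h U) \<le> exp (cmod (z * conj_pow N l 1 U 0 0))" unfolding h_def by (rule norm_exp)
    also have "cmod (z * conj_pow N l 1 U 0 0) \<le> cmod z * (\<Sum>p<N. \<bar>l p\<bar> ^ 1)"
      unfolding norm_mult by (intro mult_left_mono norm_conj_pow_le U N) auto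
    finally show "cmod (h U) \<le> exp (cmod z * (\<Sum>p<N. \<bar>l p\<bar> ^ 1))" by simp
  qed
  moreover have "(\<integral>U. h (U * swap_mat N ?\<pi>) \<partial>\<mu>) = (\<integral>U. exp (z * conj_pow N l 1 U a a) \<partial>\<mu>)"
    by (rule Bochner_Integration.integral_cong[OF refl])
       (simp add: h_def space_haar conj_pow_swap[OF pi unitary_carrier N N])
  moreover have "(\<Sum>a<N. (if a = 0 then z else 0) * conj_pow N l 1 U a a) = z * conj_pow N l 1 U 0 0" for U
  proof -
    have "(\<Sum>a<N. (if a = 0 then z else 0) * conj_pow N l 1 U a a) = (\<Sum>a<N. if a = 0 then z * conj_pow N l 1 U 0 0 else 0)"
      by (intro sum.cong) auto
    then show ?thesis using N by simp
  qed
  ultimately show ?thesis unfolding HC_eq h_def by simp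
qed

end

text \<open>
  A random spectrum that is independent of the unitary matrix, the two living on the product of
  \<open>P\<close> and \<open>\<mu>\<close>. Integrability of the Harish-Chandra integral at two
  opposite points of the first axis amounts to exponential moments of \<open>M_00\<close>, and by
  symmetry of all the diagonal entries of \<open>M\<close>.
\<close>
locale random_spectrum = haar_measure \<mu> N + P: prob_space P
  for \<mu> :: "complex mat measure" and N :: nat and P :: "'a measure" +
  fixes l :: "'a \<Rightarrow> nat \<Rightarrow> real" and \<rho> :: real
  assumes N_pos: "0 < N" and \<rho>_pos: "0 < \<rho>"
    and measurable_l: "i < N \<Longrightarrow> (\<lambda>\<omega>. l \<omega> i) \<in> borel_measurable P"
    and HC_int: "integrable P (\<lambda>\<omega>. HC \<mu> N (only0 (of_real \<rho>)) (l \<omega>))"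
      "integrable P (\<lambda>\<omega>. HC \<mu> N (only0 (of_real (- \<rho>))) (l \<omega>))"
begin

sublocale PU: pair_prob_space P \<mu> ..

definition diag_entry :: "'a \<times> complex mat \<Rightarrow> nat \<Rightarrow> real" where
  "diag_entry u a = (\<Sum>p<N. l (fst u) p * (cmod (snd u $$ (p, a)))\<^sup>2)"

lemma conj_pow_diag_entry: "conj_pow N (l (fst u)) 1 (snd u) a a = of_real (diag_entry u a)"
  unfolding conj_pow_diag diag_entry_def by simp

text \<open>
  An integrable function that dominates the exponential of \<open>\<rho>\<close> times the absolute
  value of each diagonal entry.
\<close>
definition exp_bound :: "'a \<times> complex mat \<Rightarrow> real" where
  "exp_bound u = (\<Sum>a<N. exp (\<rho> * diag_entry u a) + exp (- \<rho> * diag_entry u a))"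

lemma measurable_pair_entry:
  "p < N \<Longrightarrow> a < N \<Longrightarrow> (\<lambda>u. snd u $$ (p, a)) \<in> borel_measurable (P \<Otimes>\<^sub>M \<mu>)"
  by (rule measurable_compose[OF measurable_snd measurable_entry])

lemma measurable_pair_cnj_entry:
  "p < N \<Longrightarrow> a < N \<Longrightarrow> (\<lambda>u. cnj (snd u $$ (p, a))) \<in> borel_measurable (P \<Otimes>\<^sub>M \<mu>)"
  by (rule measurable_compose[OF measurable_snd measurable_cnj_entry])

lemma measurable_pair_l: "p < N \<Longrightarrow> (\<lambda>u. l (fst u) p) \<in> borel_measurable (P \<Otimes>\<^sub>M \<mu>)"
  by (rule measurable_compose[OF measurable_fst measurable_l])

lemma measurable_pair_conj_pow:
  assumes "a < N" "b < N"
  shows "(\<lambda>u. conj_pow N (l (fst u)) k (snd u) a b) \<in> borel_measurable (P \<Otimes>\<^sub>M \<mu>)"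
proof -
  have lk: "(\<lambda>u. of_real (l (fst u) p ^ k) :: complex) \<in> borel_measurable (P \<Otimes>\<^sub>M \<mu>)" if "p < N" for p
    using measurable_pair_l[OF that] by measurable
  show ?thesis
    unfolding conj_pow_def using assms
    by (intro borel_measurable_sum borel_measurable_times measurable_pair_entry measurable_pair_cnj_entry lk) auto
qed

lemma measurable_pair_diag_mon:
  "set_mset m \<subseteq> {..<N} \<Longrightarrow> (\<lambda>u. diag_mon N (l (fst u)) (snd u) m) \<in> borel_measurable (P \<Otimes>\<^sub>M \<mu>)"
proof (induction m)
  case (add j m)
  then show ?case unfolding diag_mon_add by (intro borel_measurable_times measurable_pair_conj_pow) auto
qed simp

lemma measurable_diag_entry: "a < N \<Longrightarrow> (\<lambda>u. diag_entry u a) \<in> borel_measurable (P \<Otimes>\<^sub>M \<mu>)"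
  unfolding diag_entry_def
  by (intro borel_measurable_sum borel_measurable_times borel_measurable_power measurable_pair_l
        borel_measurable_norm measurable_pair_entry) auto

lemma measurable_exp_bound: "exp_bound \<in> borel_measurable (P \<Otimes>\<^sub>M \<mu>)"
proof -
  have E: "(\<lambda>u. exp (c * diag_entry u a)) \<in> borel_measurable (P \<Otimes>\<^sub>M \<mu>)" if "a < N" for a c
    using measurable_diag_entry[OF that] by measurable
  show ?thesis unfolding exp_bound_def[abs_def] by (intro borel_measurable_sum borel_measurable_add E) auto
qed

lemma exp_bound_nonneg: "0 \<le> exp_bound u" unfolding exp_bound_def by (intro sum_nonneg) auto

lemma exp_diag_entry_le_exp_bound:
  assumes "a < N" "0 \<le> s" "s \<le> \<rho>"
  shows "exp (s * \<bar>diag_entry u a\<bar>) \<le> exp_bound u"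
proof -
  have "exp (s * \<bar>diag_entry u a\<bar>) \<le> exp (\<rho> * \<bar>diag_entry u a\<bar>)" using assms by (simp add: mult_right_mono)
  also have "\<dots> \<le> exp (\<rho> * diag_entry u a) + exp (- \<rho> * diag_entry u a)" by (cases "0 \<le> diag_entry u a") auto
  also have "\<dots> \<le> exp_bound u"
    unfolding exp_bound_def using assms by (intro member_le_sum) (auto simp: add_nonneg_nonneg)
  finally show ?thesis .
qed

lemma integrable_exp_bound: "integrable (P \<Otimes>\<^sub>M \<mu>) exp_bound"
proof (rule PU.Fubini_integrable[OF measurable_exp_bound])
  have exp_int: "integrable \<mu> (\<lambda>U. exp (c * diag_entry (\<omega>, U) a))"
    and exp_eq: "of_real (\<integral>U. exp (c * diag_entry (\<omega>, U) a) \<partial>\<mu>) = HC \<mu> N (only0 (of_real c)) (l \<omega>)"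
    if a: "a < N" for a c \<omega>
  proof -
    have eq: "exp (of_real c * conj_pow N (l \<omega>) 1 U a a) = of_real (exp (c * diag_entry (\<omega>, U) a))" for U
      using conj_pow_diag_entry[of "(\<omega>, U)" a] by (simp add: exp_of_real flip: of_real_mult)
    have "integrable \<mu> (\<lambda>U. exp (of_real c * conj_pow N (l \<omega>) 1 U a a))"
    proof (rule integrable_bounded)
      show "(\<lambda>U. exp (of_real c * conj_pow N (l \<omega>) 1 U a a)) \<in> borel_measurable \<mu>"
        by (rule measurable_compose[OF _ borel_measurable_continuous_onI[of exp]])
           (auto intro!: continuous_intros measurable_conj_pow borel_measurable_times a)
      fix U assume U: "U \<in> unitary_group N"
      have "cmod (exp (of_real c * conj_pow N (l \<omega>) 1 U a a)) \<le> exp (cmod (of_real c * conj_pow N (l \<omega>) 1 U a a))" by (rule norm_exp)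
      also have "cmod (of_real c * conj_pow N (l \<omega>) 1 U a a) \<le> \<bar>c\<bar> * (\<Sum>p<N. \<bar>l \<omega> p\<bar> ^ 1)"
        unfolding norm_mult norm_of_real by (intro mult_left_mono norm_conj_pow_le U a) auto
      finally show "cmod (exp (of_real c * conj_pow N (l \<omega>) 1 U a a)) \<le> exp (\<bar>c\<bar> * (\<Sum>p<N. \<bar>l \<omega> p\<bar> ^ 1))" by simp
    qed
    then show "integrable \<mu> (\<lambda>U. exp (c * diag_entry (\<omega>, U) a))"
      unfolding eq complex_of_real_integrable_eq .
    show "of_real (\<integral>U. exp (c * diag_entry (\<omega>, U) a) \<partial>\<mu>) = HC \<mu> N (only0 (of_real c)) (l \<omega>)"
      unfolding integral_exp_diag[OF N_pos a, symmetric] eq by (rule integral_complex_of_real[symmetric])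
  qed
  have inner: "(\<integral>U. norm (exp_bound (\<omega>, U)) \<partial>\<mu>) = Re (of_nat N * (HC \<mu> N (only0 (of_real \<rho>)) (l \<omega>)
      + HC \<mu> N (only0 (of_real (- \<rho>))) (l \<omega>)))" for \<omega>
  proof -
    have "(\<integral>U. norm (exp_bound (\<omega>, U)) \<partial>\<mu>) = (\<integral>U. exp_bound (\<omega>, U) \<partial>\<mu>)" using exp_bound_nonneg by simp
    also have "\<dots> = (\<Sum>a<N. (\<integral>U. exp (\<rho> * diag_entry (\<omega>, U) a) \<partial>\<mu>) + (\<integral>U. exp (- \<rho> * diag_entry (\<omega>, U) a) \<partial>\<mu>))"
      unfolding exp_bound_def
      by (subst Bochner_Integration.integral_sum) (auto simp: exp_int[of _ "- \<rho>", simplified] exp_int Bochner_Integration.integral_add)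
    also have "\<dots> = Re (\<Sum>a<N. HC \<mu> N (only0 (of_real \<rho>)) (l \<omega>)
      + HC \<mu> N (only0 (of_real (- \<rho>))) (l \<omega>))"
      unfolding Re_sum by (intro sum.cong refl) (simp only: exp_eq[symmetric] lessThan_iff plus_complex.sel Re_complex_of_real)
    finally show ?thesis by simp
  qed
  show "integrable P (\<lambda>\<omega>. \<integral>U. norm (exp_bound (\<omega>, U)) \<partial>\<mu>)"
    unfolding inner
    by (intro integrable_Re integrable_mult_right Bochner_Integration.integrable_add HC_int)
  show "AE \<omega> in P. integrable \<mu> (\<lambda>U. exp_bound (\<omega>, U))"
    unfolding exp_bound_def
    by (intro AE_I2 Bochner_Integration.integrable_sum Bochner_Integration.integrable_add exp_int) auto
qed

text \<open>
  With \<open>d\<close> the largest absolute value of a diagonal entry,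
  \<open>(\<rho> d)^n / n!\<close> is a term of the series of \<open>exp(\<rho> d)\<close>.
\<close>
lemma norm_diag_mon_le_exp_bound:
  assumes m: "set_mset m \<subseteq> {..<N}"
  shows "cmod (diag_mon N (l (fst u)) (snd u) m) \<le> fact (size m) / \<rho> ^ size m * exp_bound u"
proof -
  define d where "d = Max ((\<lambda>a. \<bar>diag_entry u a\<bar>) ` {..<N})"
  have fin: "finite ((\<lambda>a. \<bar>diag_entry u a\<bar>) ` {..<N})" "(\<lambda>a. \<bar>diag_entry u a\<bar>) ` {..<N} \<noteq> {}" using N_pos by auto
  have d: "\<bar>diag_entry u a\<bar> \<le> d" if "a < N" for a unfolding d_def using fin that by (intro Max_ge) auto
  obtain a where a: "a < N" "d = \<bar>diag_entry u a\<bar>" using Max_in[OF fin] unfolding d_def by auto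
  have d0: "0 \<le> d" using a by simp
  have "cmod (diag_mon N (l (fst u)) (snd u) m) \<le> d ^ size m"
    using m
  proof (induction m)
    case (add j m)
    then have "cmod (conj_pow N (l (fst u)) 1 (snd u) j j) \<le> d" using d[of j] by (simp add: conj_pow_diag_entry del: One_nat_def)
    with add d0 show ?case by (auto simp: diag_mon_add norm_mult intro!: mult_mono)
  qed simp
  also have "d ^ size m = fact (size m) / \<rho> ^ size m * ((\<rho> * d) ^ size m / fact (size m))"
    using \<rho>_pos by (simp add: power_mult_distrib)
  also have "\<dots> \<le> fact (size m) / \<rho> ^ size m * exp_bound u"
  proof (rule mult_left_mono)
    have "(\<rho> * d) ^ size m / fact (size m) = (\<Sum>n\<in>{size m}. (\<rho> * d) ^ n / fact n)" by simp
    also have "\<dots> \<le> (\<Sum>n. (\<rho> * d) ^ n / fact n)"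
      using summable_exp[of "\<rho> * d"] \<rho>_pos d0 by (intro sum_le_suminf) (auto simp: field_simps)
    also have "\<dots> = exp (\<rho> * d)" by (simp add: exp_def field_simps)
    also have "\<dots> \<le> exp_bound u" using exp_diag_entry_le_exp_bound[OF a(1), of \<rho> u] \<rho>_pos a(2) by simp
    finally show "(\<rho> * d) ^ size m / fact (size m) \<le> exp_bound u" .
  qed (use \<rho>_pos in simp)
  finally show ?thesis .
qed

lemma integrable_pair_diag_mon:
  assumes "set_mset m \<subseteq> {..<N}"
  shows "integrable (P \<Otimes>\<^sub>M \<mu>) (\<lambda>u. diag_mon N (l (fst u)) (snd u) m)"
proof (rule Bochner_Integration.integrable_bound[where g = "\<lambda>u. diag_mon N (l (fst u)) (snd u) m"
      and f = "\<lambda>u. fact (size m) / \<rho> ^ size m * exp_bound u"])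
  show "integrable (P \<Otimes>\<^sub>M \<mu>) (\<lambda>u. fact (size m) / \<rho> ^ size m * exp_bound u)"
    by (intro integrable_mult_right integrable_exp_bound)
  show "AE u in P \<Otimes>\<^sub>M \<mu>. norm (diag_mon N (l (fst u)) (snd u) m) \<le> norm (fact (size m) / \<rho> ^ size m * exp_bound u)"
    using norm_diag_mon_le_exp_bound[OF assms] exp_bound_nonneg \<rho>_pos by (intro AE_I2) simp
qed (rule measurable_pair_diag_mon[OF assms])

lemma integrable_mom_0:
  assumes "i < N"
  shows "integrable P (\<lambda>\<omega>. mom (l \<omega>) 0 i m)"
proof (cases "set_mset m \<subseteq> {..<N}")
  case True
  from PU.integrable_fst'[OF integrable_pair_diag_mon[OF True]] True
  show ?thesis unfolding mom_0[OF assms] by simp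
qed (simp add: mom_0 assms)

text \<open>
  The cross moments are divided differences of the moments, hence finite linear combinations of
  them.
\<close>
lemma cross_mom_eq:
  assumes "i < N" "c < N" "i \<noteq> c"
  shows "cross_mom x k i c m = (\<Sum>j\<le>count m c. mom x k i (move j c i m)
      - mom x k c (move j c i m))"
proof -
  have "(mvar i - mvar c) * Mser (cross_mom x k i c) = Mser (\<lambda>m. mom x k i m - mom x k c m)"
    by (rule mser_eqI) (simp add: left_diff_distrib minus_mser.rep_eq mcoeff_mvar_mult Mser_inverse mom_diff[OF assms])
  from mcoeff_divided_difference[OF this assms(3), of m]
  show ?thesis by (simp add: Mser_inverse del: replicate_mset_Suc)
qed

text \<open>
  For \<open>k = 0\<close> only diagonal entries of \<open>M\<close> are involved, which have all
  moments. The recursion writes the moments for \<open>k + 1\<close> as linear combinations of those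
  for \<open>k\<close> (with larger \<open>m\<close>), so integrability propagates to the powers of
  \<open>M\<close> and thereby to the power sums of the eigenvalues.
\<close>
lemma integrable_mom: "i < N \<Longrightarrow> integrable P (\<lambda>\<omega>. mom (l \<omega>) k i m)"
  and integrable_cross_mom: "i < N \<Longrightarrow> c < N \<Longrightarrow> i \<noteq> c \<Longrightarrow> integrable P (\<lambda>\<omega>. cross_mom (l \<omega>) k i c m)"
proof -
  have cross: "integrable P (\<lambda>\<omega>. cross_mom (l \<omega>) k i c m)"
    if "\<And>i m. i < N \<Longrightarrow> integrable P (\<lambda>\<omega>. mom (l \<omega>) k i m)" "i < N" "c < N" "i \<noteq> c" for k i c m
    unfolding cross_mom_eq[OF that(2-4)]
    by (intro Bochner_Integration.integrable_sum Bochner_Integration.integrable_diff that)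
  have mom: "i < N \<Longrightarrow> integrable P (\<lambda>\<omega>. mom (l \<omega>) k i m)" for k i m
  proof (induction k arbitrary: i m)
    case 0
    then show ?case by (rule integrable_mom_0)
  next
    case (Suc k)
    show ?case
      unfolding mom_Suc[OF Suc.prems]
      by (intro Bochner_Integration.integrable_add integrable_mult_right Bochner_Integration.integrable_sum Suc cross) auto
  qed
  show "i < N \<Longrightarrow> integrable P (\<lambda>\<omega>. mom (l \<omega>) k i m)" by (rule mom)
  show "i < N \<Longrightarrow> c < N \<Longrightarrow> i \<noteq> c \<Longrightarrow> integrable P (\<lambda>\<omega>. cross_mom (l \<omega>) k i c m)"
    by (rule cross[OF mom])
qed

definition gser :: "nat \<Rightarrow> nat \<Rightarrow> mser" where
  "gser k i = Mser (\<lambda>m. \<integral>\<omega>. mom (l \<omega>) k i m \<partial>P)"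

definition qser :: "nat \<Rightarrow> nat \<Rightarrow> nat \<Rightarrow> mser" where
  "qser k i c = Mser (\<lambda>m. \<integral>\<omega>. cross_mom (l \<omega>) k i c m \<partial>P)"

lemma moment_series: "moment_series N gser qser (gser 0 0)"
proof
  show "0 < N" by (rule N_pos)
  show "gser 0 i = gser 0 0" if "i < N" for i
    unfolding gser_def mom_0[OF that] mom_0[OF N_pos] ..
  show "mcoeff (gser 0 0) {#} = 1"
    by (simp add: gser_def Mser_inverse mom_0_empty[OF N_pos] P.prob_space)
  show "gser (Suc k) i = mderiv i (gser k i) + (\<Sum>c\<in>{..<N} - {i}. qser k i c)" if i: "i < N" for i k
  proof (rule mser_eqI)
    fix m
    have "(\<integral>\<omega>. mom (l \<omega>) (Suc k) i m \<partial>P) = of_nat (Suc (count m i)) * (\<integral>\<omega>. mom (l \<omega>) k i (add_mset i m) \<partial>P)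
        + (\<Sum>c\<in>{..<N} - {i}. \<integral>\<omega>. cross_mom (l \<omega>) k i c m \<partial>P)"
      unfolding mom_Suc[OF i]
      by (subst Bochner_Integration.integral_add; (subst Bochner_Integration.integral_sum)?;
          (intro integrable_mult_right Bochner_Integration.integrable_sum integrable_mom integrable_cross_mom)?)
         (use i in \<open>auto simp del: of_nat_Suc\<close>)
    then show "mcoeff (gser (Suc k) i) m = mcoeff (mderiv i (gser k i) + (\<Sum>c\<in>{..<N} - {i}. qser k i c)) m"
      by (simp add: plus_mser.rep_eq mderiv.rep_eq mcoeff_sum gser_def qser_def Mser_inverse del: of_nat_Suc)
  qed
  show "(mvar i - mvar c) * qser k i c = gser k i - gser k c" if ic: "i < N" "c < N" "i \<noteq> c" for i c k
  proof (rule mser_eqI)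
    fix m
    have "(\<integral>\<omega>. mom (l \<omega>) k i m \<partial>P) - (\<integral>\<omega>. mom (l \<omega>) k c m \<partial>P) = (\<integral>\<omega>. mom (l \<omega>) k i m - mom (l \<omega>) k c m \<partial>P)"
      by (rule Bochner_Integration.integral_diff[symmetric]) (intro integrable_mom ic)+
    also have "\<dots> = (if i \<in># m then \<integral>\<omega>. cross_mom (l \<omega>) k i c (m - {#i#}) \<partial>P else 0) - (if c \<in># m then \<integral>\<omega>. cross_mom (l \<omega>) k i c (m - {#c#}) \<partial>P else 0)"
      unfolding mom_diff[OF ic] using integrable_cross_mom[OF ic] by simp
    finally show "mcoeff ((mvar i - mvar c) * qser k i c) m = mcoeff (gser k i - gser k c) m"
      by (simp add: left_diff_distrib minus_mser.rep_eq mcoeff_mvar_mult gser_def qser_def Mser_inverse)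
  qed
  show "perm_mser (Transposition.transpose a b) (gser k (Transposition.transpose a b i)) = gser k i"
    if "a < N" "b < N" "i < N" for a b i k
  proof (rule mser_eqI)
    fix m
    have pi: "\<And>x. Transposition.transpose a b (Transposition.transpose a b x) = x"
      "\<And>x. x < N \<Longrightarrow> Transposition.transpose a b x < N" using that by (auto simp: Transposition.transpose_def)
    have "mom x k (Transposition.transpose a b i) (relabel a b m) = mom x k i m" for x
      by (rule mom_swap[OF pi that(3)])
    then show "mcoeff (perm_mser (Transposition.transpose a b) (gser k (Transposition.transpose a b i))) m = mcoeff (gser k i) m"
      unfolding mcoeff_perm_mser gser_def Mser_inverse[OF UNIV_I] by simp
  qed
qed

text \<open>
  The trace is the sum of the diagonal entries, which are exchangeable.
\<close>
lemma expected_power_sum: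
  shows "integrable P (\<lambda>\<omega>. \<Sum>i<N. l \<omega> i ^ k)"
    and "of_real (\<integral>\<omega>. (\<Sum>i<N. l \<omega> i ^ k) \<partial>P) = of_nat N * mcoeff (gser k 0) {#}"
proof -
  have "integrable P (\<lambda>\<omega>. \<Sum>i<N. mom (l \<omega>) k i {#})"
    by (intro Bochner_Integration.integrable_sum integrable_mom) auto
  then show "integrable P (\<lambda>\<omega>. \<Sum>i<N. l \<omega> i ^ k)"
    unfolding sum_mom complex_of_real_integrable_eq .
  have "of_real (\<integral>\<omega>. (\<Sum>i<N. l \<omega> i ^ k) \<partial>P) = (\<integral>\<omega>. (\<Sum>i<N. mom (l \<omega>) k i {#}) \<partial>P)"
    unfolding sum_mom by (rule integral_complex_of_real[symmetric])
  also have "\<dots> = (\<Sum>i<N. \<integral>\<omega>. mom (l \<omega>) k i {#} \<partial>P)"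
    by (intro Bochner_Integration.integral_sum integrable_mom) auto
  also have "\<dots> = (\<Sum>i<N. \<integral>\<omega>. mom (l \<omega>) k 0 {#} \<partial>P)"
  proof (intro sum.cong refl)
    fix i assume "i \<in> {..<N}"
    then have i: "i < N" by simp
    let ?\<pi> = "Transposition.transpose 0 i"
    have pi: "\<And>x. ?\<pi> (?\<pi> x) = x" "\<And>x. x < N \<Longrightarrow> ?\<pi> x < N" using i N_pos by (auto simp: Transposition.transpose_def)
    show "(\<integral>\<omega>. mom (l \<omega>) k i {#} \<partial>P) = (\<integral>\<omega>. mom (l \<omega>) k 0 {#} \<partial>P)"
      using mom_swap[OF pi N_pos, where m = "{#}"] by simp
  qed
  finally show "of_real (\<integral>\<omega>. (\<Sum>i<N. l \<omega> i ^ k) \<partial>P) = of_nat N * mcoeff (gser k 0) {#}"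
    by (simp add: gser_def Mser_inverse)
qed

text \<open>
  The convergence is that of the exponential series, which may be integrated term by term because
  \<open>exp |X|\<close> is integrable for \<open>|t| r \<le> \<rho>\<close>.
\<close>
lemma expected_HC_series:
  assumes r: "r \<le> N" and y: "\<And>i. i < r \<Longrightarrow> cmod (y i) \<le> 1" "\<And>i. r \<le> i \<Longrightarrow> y i = 0"
    and t: "cmod t * real r \<le> \<rho>"
  shows "(\<lambda>n. fps_nth (mline r y (gser 0 0)) n * t ^ n) sums (\<integral>\<omega>. HC \<mu> N (\<lambda>i. t * y i) (l \<omega>) \<partial>P)"
proof -
  define X where "X u = (\<Sum>j<r. t * y j * conj_pow N (l (fst u)) 1 (snd u) j j)" for u
  have Xm: "X \<in> borel_measurable (P \<Otimes>\<^sub>M \<mu>)"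
    unfolding X_def[abs_def] using r
    by (intro borel_measurable_sum borel_measurable_times borel_measurable_const measurable_pair_conj_pow) auto
  have Xle: "exp (cmod (X u)) \<le> exp_bound u" for u
  proof -
    define d where "d = Max ((\<lambda>a. \<bar>diag_entry u a\<bar>) ` {..<N})"
    have fin: "finite ((\<lambda>a. \<bar>diag_entry u a\<bar>) ` {..<N})" "(\<lambda>a. \<bar>diag_entry u a\<bar>) ` {..<N} \<noteq> {}" using N_pos by auto
    have d: "\<bar>diag_entry u a\<bar> \<le> d" if "a < N" for a unfolding d_def using fin that by (intro Max_ge) auto
    obtain a where a: "a < N" "d = \<bar>diag_entry u a\<bar>" using Max_in[OF fin] unfolding d_def by auto
    have "cmod (X u) \<le> (\<Sum>j<r. cmod t * d)"
      unfolding X_def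
    proof (rule order_trans[OF norm_sum sum_mono])
      fix j assume "j \<in> {..<r}"
      then have j: "j < r" "j < N" using r by auto
      have "cmod (t * y j * conj_pow N (l (fst u)) 1 (snd u) j j) = cmod t * (cmod (y j) * \<bar>diag_entry u j\<bar>)"
        unfolding conj_pow_diag_entry by (simp add: norm_mult)
      also have "\<dots> \<le> cmod t * (1 * d)" using y(1)[OF j(1)] d[OF j(2)] by (intro mult_left_mono mult_mono) auto
      finally show "cmod (t * y j * conj_pow N (l (fst u)) 1 (snd u) j j) \<le> cmod t * d" by simp
    qed
    also have "\<dots> = (cmod t * real r) * \<bar>diag_entry u a\<bar>" using a(2) by (simp add: mult_ac)
    finally have "exp (cmod (X u)) \<le> exp ((cmod t * real r) * \<bar>diag_entry u a\<bar>)" by simp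
    also have "\<dots> \<le> exp_bound u" by (rule exp_diag_entry_le_exp_bound[OF a(1) _ t]) simp
    finally show ?thesis .
  qed
  have Xint: "integrable (P \<Otimes>\<^sub>M \<mu>) (\<lambda>u. exp (cmod (X u)))"
  proof (rule Bochner_Integration.integrable_bound[OF integrable_exp_bound])
    show "(\<lambda>u. exp (cmod (X u))) \<in> borel_measurable (P \<Otimes>\<^sub>M \<mu>)" using Xm by measurable
  qed (use Xle exp_bound_nonneg in auto)
  note S = exp_series_integral[OF Xm Xint]
  have term_eq: "(\<integral>u. X u ^ n / fact n \<partial>(P \<Otimes>\<^sub>M \<mu>)) = fps_nth (mline r y (gser 0 0)) n * t ^ n" for n
  proof -
    let ?S = "msets r n"
    have sub: "set_mset m \<subseteq> {..<N}" if "m \<in> ?S" for m using that r by auto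
    have "X u ^ n / fact n = (\<Sum>m\<in>?S. t ^ n * (\<Prod>j\<in>#m. y j) / mfact m * diag_mon N (l (fst u)) (snd u) m)" for u
      unfolding X_def multinomial_expansion
      by (intro sum.cong refl) (auto simp: diag_mon_def prod_mset.distrib image_mset_const_eq)
    then have "(\<integral>u. X u ^ n / fact n \<partial>(P \<Otimes>\<^sub>M \<mu>))
        = (\<Sum>m\<in>?S. t ^ n * (\<Prod>j\<in>#m. y j) / mfact m * (\<integral>u. diag_mon N (l (fst u)) (snd u) m \<partial>(P \<Otimes>\<^sub>M \<mu>)))"
      using sub by (simp add: Bochner_Integration.integral_sum integrable_pair_diag_mon)
    also have "\<dots> = (\<Sum>m\<in>?S. mcoeff (gser 0 0) m * (\<Prod>j\<in>#m. y j)) * t ^ n"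
      unfolding sum_distrib_right
    proof (intro sum.cong refl)
      fix m assume m: "m \<in> ?S"
      have "(\<integral>u. diag_mon N (l (fst u)) (snd u) m \<partial>(P \<Otimes>\<^sub>M \<mu>)) = (\<integral>\<omega>. (\<integral>U. diag_mon N (l \<omega>) U m \<partial>\<mu>) \<partial>P)"
        using PU.integral_fst'[OF integrable_pair_diag_mon[OF sub[OF m]]] by simp
      also have "\<dots> = mfact m * mcoeff (gser 0 0) m"
        using sub[OF m] mfact_nonzero[of m] by (simp add: gser_def Mser_inverse mom_0[OF N_pos])
      finally show "t ^ n * (\<Prod>j\<in>#m. y j) / mfact m * (\<integral>u. diag_mon N (l (fst u)) (snd u) m \<partial>(P \<Otimes>\<^sub>M \<mu>))
          = mcoeff (gser 0 0) m * (\<Prod>j\<in>#m. y j) * t ^ n"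
        using mfact_nonzero[of m] by simp
    qed
    finally show ?thesis by (simp add: mline_def)
  qed
  have Xexp: "integrable (P \<Otimes>\<^sub>M \<mu>) (\<lambda>u. exp (X u))"
  proof (rule Bochner_Integration.integrable_bound[OF Xint])
    show "(\<lambda>u. exp (X u)) \<in> borel_measurable (P \<Otimes>\<^sub>M \<mu>)" using Xm by measurable
  qed (auto intro!: AE_I2 complex_Re_le_cmod)
  have "(\<integral>u. exp (X u) \<partial>(P \<Otimes>\<^sub>M \<mu>)) = (\<integral>\<omega>. HC \<mu> N (\<lambda>i. t * y i) (l \<omega>) \<partial>P)"
  proof -
    have "(\<Sum>a<N. t * y a * conj_pow N x 1 U a a) = (\<Sum>a<r. t * y a * conj_pow N x 1 U a a)" for x U
      using r y(2) by (intro sum.mono_neutral_right) auto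
    then have "HC \<mu> N (\<lambda>i. t * y i) (l \<omega>) = (\<integral>U. exp (X (\<omega>, U)) \<partial>\<mu>)" for \<omega>
      unfolding HC_eq X_def by simp
    then show ?thesis using PU.integral_fst'[OF Xexp] by simp
  qed
  with S(2) show ?thesis unfolding term_eq by simp
qed

end

section \<open>From uniform convergence to coefficients\<close>

text \<open>
  A holomorphic logarithm exists on a convex set, and a continuous function with values in
  \<open>2 \<pi> i \<int>\<close> is constant.
\<close>
lemma continuous_log_imp_holomorphic:
  assumes S: "open S" "convex S" and hol: "F holomorphic_on S" and cont: "continuous_on S \<Lambda>"
    and exp: "\<And>t. t \<in> S \<Longrightarrow> exp (\<Lambda> t) = F t"
  shows "\<Lambda> holomorphic_on S"
proof -
  have "F t \<noteq> 0" if "t \<in> S" for t using exp[OF that] by (metis exp_not_eq_zero)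
  then obtain g where g: "g holomorphic_on S" "\<And>t. t \<in> S \<Longrightarrow> F t = exp (g t)"
    using contractible_imp_holomorphic_log[OF hol convex_imp_contractible[OF S(2)]] by metis
  have "(\<lambda>t. \<Lambda> t - g t) constant_on S"
  proof (rule continuous_discrete_range_constant)
    show "connected S" using S(2) by (rule convex_connected)
    show "continuous_on S (\<lambda>t. \<Lambda> t - g t)"
      using cont holomorphic_on_imp_continuous_on[OF g(1)] by (intro continuous_intros)
    fix x assume x: "x \<in> S"
    have val: "\<exists>n. \<Lambda> t - g t = of_int (2 * n) * of_real pi * \<i>" if "t \<in> S" for t
    proof -
      have "exp (\<Lambda> t - g t) = 1" using exp[OF that] g(2)[OF that] by (simp add: exp_diff)
      then obtain n :: int where "Re (\<Lambda> t - g t) = 0" "Im (\<Lambda> t - g t) = of_int (2 * n) * pi"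
        using exp_eq_1 by blast
      then show ?thesis by (intro exI[of _ n] complex_eqI) simp_all
    qed
    show "\<exists>e>0. \<forall>y. y \<in> S \<and> \<Lambda> y - g y \<noteq> \<Lambda> x - g x \<longrightarrow> e \<le> cmod (\<Lambda> y - g y - (\<Lambda> x - g x))"
    proof (intro exI[of _ 1] conjI allI impI)
      fix y assume y: "y \<in> S \<and> \<Lambda> y - g y \<noteq> \<Lambda> x - g x"
      obtain m n where m: "\<Lambda> y - g y = of_int (2 * m) * of_real pi * \<i>" and n: "\<Lambda> x - g x = of_int (2 * n) * of_real pi * \<i>"
        using val x y by blast
      then have "m \<noteq> n" using y by auto
      have "cmod (\<Lambda> y - g y - (\<Lambda> x - g x)) = \<bar>of_int (2 * (m - n))\<bar> * pi"
      proof -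
        have "\<Lambda> y - g y - (\<Lambda> x - g x) = of_real (of_int (2 * (m - n)) * pi) * \<i>"
          unfolding m n by (simp add: algebra_simps)
        then show ?thesis by (simp only: norm_mult norm_of_real abs_mult norm_ii) simp
      qed
      also have "\<dots> \<ge> 1 * 1"
        using \<open>m \<noteq> n\<close> pi_ge_two by (intro mult_mono) auto
      finally show "1 \<le> cmod (\<Lambda> y - g y - (\<Lambda> x - g x))" by simp
    qed simp
  qed
  then obtain c where c: "\<And>t. t \<in> S \<Longrightarrow> \<Lambda> t - g t = c" unfolding constant_on_def by blast
  have "(\<lambda>t. g t + c) holomorphic_on S" using g(1) by (intro holomorphic_intros)
  then show ?thesis by (rule holomorphic_transform) (use c in \<open>auto simp: algebra_simps\<close>)
qed

text \<open>
  Both the formal logarithm \<open>R\<close> and the Taylor series of the continuous branch have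
  logarithmic derivative \<open>Q'/Q\<close> and no constant term.
\<close>
lemma log_has_fps_expansion:
  fixes Q R :: "complex fps"
  assumes \<delta>: "0 < \<delta>" and sums: "\<And>t. cmod t < \<delta> \<Longrightarrow> (\<lambda>n. fps_nth Q n * t ^ n) sums F t"
    and cont: "continuous_on (ball 0 \<delta>) \<Lambda>" and exp: "\<And>t. t \<in> ball 0 \<delta> \<Longrightarrow> exp (\<Lambda> t) = F t" and \<Lambda>0: "\<Lambda> 0 = 0"
    and R: "fps_X * fps_deriv R * Q = fps_X * fps_deriv Q" and R0: "fps_nth R 0 = 0"
  shows "\<Lambda> holomorphic_on ball 0 \<delta>" "\<Lambda> has_fps_expansion R"
proof -
  have holF: "F holomorphic_on ball 0 \<delta>"
    by (rule power_series_holomorphic[where a = "fps_nth Q"]) (auto intro: sums)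
  show hol: "\<Lambda> holomorphic_on ball 0 \<delta>"
    by (rule continuous_log_imp_holomorphic[OF _ _ holF cont exp]) auto
  have FQ: "F has_fps_expansion Q"
  proof (rule has_fps_expansionI)
    have "eventually (\<lambda>t. t \<in> ball 0 \<delta>) (nhds (0 :: complex))"
      using \<delta> by (intro eventually_nhds_in_open) auto
    then show "\<forall>\<^sub>F t in nhds 0. (\<lambda>n. fps_nth Q n * t ^ n) sums F t"
      by eventually_elim (auto intro: sums)
  qed
  define Lf where "Lf = fps_expansion \<Lambda> 0"
  have LfE: "\<Lambda> has_fps_expansion Lf"
    unfolding Lf_def using \<delta> by (intro has_fps_expansion_fps_expansion[OF _ _ hol]) auto
  have "deriv F has_fps_expansion fps_deriv Lf * Q"
  proof (rule has_fps_expansion_cong[THEN iffD1, OF _ refl])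
    show "(\<lambda>t. deriv \<Lambda> t * F t) has_fps_expansion fps_deriv Lf * Q"
      by (intro fps_expansion_intros LfE FQ)
    have "eventually (\<lambda>t. t \<in> ball 0 \<delta>) (nhds (0 :: complex))"
      using \<delta> by (intro eventually_nhds_in_open) auto
    then show "\<forall>\<^sub>F t in nhds 0. deriv \<Lambda> t * F t = deriv F t"
    proof eventually_elim
      case (elim t)
      have "(\<Lambda> has_field_derivative deriv \<Lambda> t) (at t)"
        using hol elim by (intro holomorphic_derivI[of _ "ball 0 \<delta>"]) auto
      then have "((\<lambda>t. exp (\<Lambda> t)) has_field_derivative exp (\<Lambda> t) * deriv \<Lambda> t) (at t)"
        by (auto intro!: derivative_eq_intros)
      then have "(F has_field_derivative exp (\<Lambda> t) * deriv \<Lambda> t) (at t)"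
        by (rule has_field_derivative_transform_within_open[where S = "ball 0 \<delta>"]) (use elim exp in auto)
      then show ?case using exp[OF elim] by (simp add: DERIV_imp_deriv mult.commute)
    qed
  qed
  moreover have "deriv F has_fps_expansion fps_deriv Q" by (intro fps_expansion_intros FQ)
  ultimately have eq: "fps_deriv Lf * Q = fps_deriv Q" by (rule fps_expansion_unique_complex)
  have "F 0 \<noteq> 0" using exp[of 0] \<delta> by (metis centre_in_ball exp_not_eq_zero)
  then have Q0: "Q \<noteq> 0" using has_fps_expansion_imp_0_eq_fps_nth_0[OF FQ] by auto
  have "fps_X * fps_deriv R * Q = fps_X * fps_deriv Lf * Q" using R eq by (simp add: mult.assoc)
  then have "fps_deriv R = fps_deriv Lf" using Q0 by simp
  moreover have "fps_nth Lf 0 = 0" using has_fps_expansion_imp_0_eq_fps_nth_0[OF LfE] \<Lambda>0 by simp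
  ultimately have "R = Lf" using R0 by (simp add: fps_deriv_eq_iff)
  then show "\<Lambda> has_fps_expansion R" using LfE by simp
qed

lemma sum_digits_less: "(\<And>i. i < r \<Longrightarrow> d i < B) \<Longrightarrow> (\<Sum>i<r. d i * B ^ i) < (B::nat) ^ r"
proof (induction r)
  case (Suc r)
  then have "(\<Sum>i<r. d i * B ^ i) < B ^ r" by simp
  moreover have "d r * B ^ r \<le> (B - 1) * B ^ r" using Suc.prems[of r] by (intro mult_right_mono) auto
  moreover have "(B - 1) * B ^ r + B ^ r = B ^ Suc r"
    using Suc.prems[of r] by (cases B) auto
  ultimately show ?case unfolding sum.lessThan_Suc by linarith
qed simp

lemma digits_unique:
  assumes "\<And>i. i < r \<Longrightarrow> d i < (B::nat)" "\<And>i. i < r \<Longrightarrow> d' i < B"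
    "(\<Sum>i<r. d i * B ^ i) = (\<Sum>i<r. d' i * B ^ i)" "i < r"
  shows "d i = d' i"
  using assms
proof (induction r)
  case (Suc r)
  have lt: "(\<Sum>i<r. d i * B ^ i) < B ^ r" "(\<Sum>i<r. d' i * B ^ i) < B ^ r"
    using Suc.prems(1,2) by (auto intro!: sum_digits_less)
  have eq: "(\<Sum>i<r. d i * B ^ i) + d r * B ^ r = (\<Sum>i<r. d' i * B ^ i) + d' r * B ^ r"
    using Suc.prems(3) by simp
  have pos: "B ^ r \<noteq> 0" using lt(1) by linarith
  have "((\<Sum>i<r. d i * B ^ i) + d r * B ^ r) div B ^ r = d r" using lt(1) pos by (subst div_mult_self1) auto
  moreover have "((\<Sum>i<r. d' i * B ^ i) + d' r * B ^ r) div B ^ r = d' r" using lt(2) pos by (subst div_mult_self1) auto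
  ultimately have top: "d r = d' r" using eq by simp
  show ?case
  proof (cases "i = r")
    case False
    then show ?thesis using Suc.IH Suc.prems top eq by simp
  qed (use top in simp)
qed simp

lemma sum_roots_of_unity:
  assumes D: "0 < D" and ab: "a < D" "b < D"
  shows "(\<Sum>j<D. exp (2 * of_real pi * \<i> * of_nat a / of_nat D) ^ j / exp (2 * of_real pi * \<i> * of_nat b / of_nat D) ^ j)
      = (if a = b then of_nat D else (0 :: complex))"
proof -
  define z where "z = exp (2 * of_real pi * \<i> * of_nat a / of_nat D) / exp (2 * of_real pi * \<i> * of_nat b / of_nat D)"
  have root: "exp (2 * of_real pi * \<i> * of_nat c / of_nat D) ^ D = 1" for c
  proof -
    have "exp (2 * of_real pi * \<i> * of_nat c / of_nat D) ^ D = exp (of_nat D * (2 * of_real pi * \<i> * of_nat c / of_nat D))"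
      by (rule exp_of_nat_mult[symmetric])
    also have "of_nat D * (2 * of_real pi * \<i> * of_nat c / of_nat D) = 2 * of_real pi * \<i> * of_nat c" using D by simp
    also have "exp (2 * of_real pi * \<i> * of_nat c) = 1"
      using exp_integer_2pi[of "of_nat c"] by (simp add: mult_ac)
    finally show ?thesis .
  qed
  have zD: "z ^ D = 1" unfolding z_def power_divide root by simp
  have "(\<Sum>j<D. exp (2 * of_real pi * \<i> * of_nat a / of_nat D) ^ j / exp (2 * of_real pi * \<i> * of_nat b / of_nat D) ^ j) = (\<Sum>j<D. z ^ j)"
    by (simp add: z_def power_divide)
  also have "\<dots> = (if a = b then of_nat D else 0)"
  proof (cases "a = b")
    case True
    then show ?thesis by (simp add: z_def)
  next
    case False
    then have "z \<noteq> 1" unfolding z_def using complex_root_unity_eq[of D a b] D ab by simp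
    then have "(\<Sum>j<D. z ^ j) = (z ^ D - 1) / (z - 1)" by (rule geometric_sum)
    then show ?thesis using zD False by simp
  qed
  finally show ?thesis .
qed

text \<open>
  Kronecker's substitution \<open>y_i = \<zeta>^(B^i)\<close> with \<open>B = n + 1\<close> and a
  root of unity \<open>\<zeta>\<close> of order \<open>B^r\<close> sends the monomials of degree
  \<open>n\<close> to distinct powers of \<open>\<zeta>\<close>, because the exponents of a monomial
  are digits in base \<open>B\<close>. The discrete Fourier transform then isolates a single
  coefficient by evaluations at finitely many points.
\<close>
lemma coefficients_tendsto_0:
  fixes u :: "nat \<Rightarrow> nat multiset \<Rightarrow> complex"
  assumes conv: "\<And>y. (\<And>i. i < r \<Longrightarrow> cmod (y i) \<le> 1) \<Longrightarrow> (\<And>i. r \<le> i \<Longrightarrow> y i = 0) \<Longrightarrow>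
      (\<lambda>N. \<Sum>m\<in>msets r n. u N m * (\<Prod>i\<in>#m. y i)) \<longlonglongrightarrow> 0"
    and m0: "set_mset m0 \<subseteq> {..<r}" "size m0 = n"
  shows "(\<lambda>N. u N m0) \<longlonglongrightarrow> 0"
proof -
  let ?S = "msets r n"
  define B where "B = Suc n"
  define D where "D = B ^ r"
  have D: "0 < D" by (simp add: D_def B_def)
  define K where "K m = (\<Sum>i<r. count m i * B ^ i)" for m
  define \<omega> where "\<omega> k = exp (2 * of_real pi * \<i> * of_nat k / of_nat D)" for k :: nat
  have \<omega>_add: "\<omega> (a + b) = \<omega> a * \<omega> b" for a b
    by (simp add: \<omega>_def exp_add[symmetric] add_divide_distrib distrib_left)
  have \<omega>_mult: "\<omega> (a * b) = \<omega> a ^ b" for a b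
    by (induction b) (auto simp: \<omega>_add, simp add: \<omega>_def)
  have \<omega>_norm: "cmod (\<omega> k) = 1" for k
  proof -
    have "2 * complex_of_real pi * \<i> * of_nat k / of_nat D = \<i> * of_real (2 * pi * real k / real D)" by (simp add: field_simps)
    then show ?thesis unfolding \<omega>_def by (metis norm_exp_i_times)
  qed
  have digit: "count m i < B" if "m \<in> ?S" for m i
    using that count_le_size[of m i] by (auto simp: B_def less_Suc_eq_le)
  have KD: "K m < D" if "m \<in> ?S" for m
    unfolding K_def D_def by (rule sum_digits_less) (use digit[OF that] in auto)
  have Kinj: "m = m'" if "m \<in> ?S" "m' \<in> ?S" "K m = K m'" for m m'
  proof (rule multiset_eqI)
    fix i
    show "count m i = count m' i"
    proof (cases "i < r")
      case True
      show ?thesis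
        by (rule digits_unique[of r "count m" B "count m'"]) (use digit that True in \<open>auto simp: K_def\<close>)
    next
      case False
      then have "i \<notin># m" "i \<notin># m'" using that by auto
      then show ?thesis by (simp add: not_in_iff)
    qed
  qed
  define y where "y j i = (if i < r then \<omega> (B ^ i) ^ j else 0)" for j i :: nat
  have prod: "(\<Prod>i\<in>#m. y j i) = \<omega> (K m) ^ j" if "m \<in> ?S" for m j
  proof -
    have "(\<Prod>i\<in>#m. y j i) = (\<Prod>i<r. \<omega> (B ^ i * count m i)) ^ j" if "set_mset m \<subseteq> {..<r}" for m
      using that
    proof (induction m)
      case empty
      have "\<omega> 0 = 1" by (simp add: \<omega>_def)
      then show ?case by simp
    next
      case (add x m)
      then have x: "x < r" and IH: "(\<Prod>i\<in>#m. y j i) = (\<Prod>i<r. \<omega> (B ^ i * count m i)) ^ j" by auto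
      have "(\<Prod>i<r. \<omega> (B ^ i * count (add_mset x m) i)) = (\<Prod>i<r. \<omega> (B ^ i * count m i) * (if i = x then \<omega> (B ^ x) else 1))"
        by (intro prod.cong refl) (auto simp: \<omega>_add distrib_left)
      also have "\<dots> = (\<Prod>i<r. \<omega> (B ^ i * count m i)) * \<omega> (B ^ x)"
        using x by (simp add: prod.distrib)
      finally show ?case using IH x by (simp add: y_def power_mult_distrib mult.commute)
    qed
    moreover have "(\<Prod>i\<in>I. \<omega> (f i)) = \<omega> (\<Sum>i\<in>I. f i)" if "finite I" for I :: "nat set" and f
      using that
    proof (induction I rule: finite_induct)
      case empty
      show ?case by (simp add: \<omega>_def)
    qed (simp add: \<omega>_add)
    ultimately show ?thesis using \<open>m \<in> ?S\<close> by (simp add: K_def mult.commute)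
  qed
  have extracted: "(\<Sum>j<D. (\<Sum>m\<in>?S. u N m * (\<Prod>i\<in>#m. y j i)) / \<omega> (K m0) ^ j) = of_nat D * u N m0" for N
  proof -
    have m0S: "m0 \<in> ?S" using m0 by simp
    have "(\<Sum>j<D. (\<Sum>m\<in>?S. u N m * (\<Prod>i\<in>#m. y j i)) / \<omega> (K m0) ^ j)
        = (\<Sum>j<D. \<Sum>m\<in>?S. u N m * (\<omega> (K m) ^ j / \<omega> (K m0) ^ j))"
      by (simp add: sum_divide_distrib prod)
    also have "\<dots> = (\<Sum>m\<in>?S. u N m * (\<Sum>j<D. \<omega> (K m) ^ j / \<omega> (K m0) ^ j))"
      by (subst sum.swap) (simp add: sum_distrib_left)
    also have "\<dots> = (\<Sum>m\<in>?S. if m = m0 then of_nat D * u N m0 else 0)"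
    proof (intro sum.cong refl)
      fix m assume m: "m \<in> ?S"
      have "(\<Sum>j<D. \<omega> (K m) ^ j / \<omega> (K m0) ^ j) = (if K m = K m0 then of_nat D else 0)"
        unfolding \<omega>_def by (rule sum_roots_of_unity[OF D KD[OF m] KD[OF m0S]])
      then show "u N m * (\<Sum>j<D. \<omega> (K m) ^ j / \<omega> (K m0) ^ j) = (if m = m0 then of_nat D * u N m0 else 0)"
        using Kinj[OF m m0S] by auto
    qed
    also have "\<dots> = of_nat D * u N m0" using m0S by (simp add: finite_msets_size)
    finally show ?thesis .
  qed
  have "(\<lambda>N. (\<Sum>j<D. (\<Sum>m\<in>?S. u N m * (\<Prod>i\<in>#m. y j i)) / \<omega> (K m0) ^ j)) \<longlonglongrightarrow> (\<Sum>j<D. 0 / \<omega> (K m0) ^ j)"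
  proof (intro tendsto_intros conv)
    show "cmod (y j i) \<le> 1" if "i < r" for j i using that by (simp add: y_def norm_power \<omega>_norm)
    show "y j i = 0" if "r \<le> i" for j i using that by (simp add: y_def)
    show "\<omega> (K m0) ^ j \<noteq> 0" for j by (simp add: \<omega>_def)
  qed
  then have "(\<lambda>N. of_nat D * u N m0) \<longlonglongrightarrow> 0" unfolding extracted by simp
  then have "(\<lambda>N. of_nat D * u N m0 / of_nat D) \<longlonglongrightarrow> 0 / of_nat D" using D by (intro tendsto_divide) auto
  then show ?thesis using D by simp
qed

section \<open>The limit theorem\<close>

lemma analytic_at_0_ball:
  assumes "\<Psi> analytic_on {0 :: complex}"
  obtains \<delta> where "0 < \<delta>" "\<Psi> holomorphic_on ball 0 \<delta>"
  using assms unfolding analytic_on_def by auto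

lemma scaled_fps_expansion:
  assumes \<delta>: "0 < \<delta>" and hol: "\<Psi> holomorphic_on ball 0 \<delta>" and c: "cmod c \<le> 1"
  shows "(\<lambda>t. \<Psi> (t * c)) holomorphic_on ball 0 \<delta>"
    and "(\<lambda>t. \<Psi> (t * c)) has_fps_expansion Abs_fps (\<lambda>n. fps_nth (fps_expansion \<Psi> 0) n * c ^ n)"
proof -
  have sub: "c * t \<in> ball 0 \<delta>" if "t \<in> ball 0 \<delta>" for t
  proof -
    have "cmod (c * t) \<le> 1 * cmod t" unfolding norm_mult using c by (intro mult_right_mono) auto
    then show ?thesis using that by simp
  qed
  have "(\<Psi> \<circ> (\<lambda>t. t * c)) holomorphic_on ball 0 \<delta>"
    by (rule holomorphic_on_compose_gen[OF _ hol]) (use sub in \<open>auto intro!: holomorphic_intros simp: mult.commute\<close>)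
  then show hol': "(\<lambda>t. \<Psi> (t * c)) holomorphic_on ball 0 \<delta>" by (simp add: comp_def)
  have "(\<lambda>t. \<Psi> (t * c)) has_fps_expansion fps_expansion (\<lambda>t. \<Psi> (t * c)) 0"
    using \<delta> by (intro has_fps_expansion_fps_expansion[OF open_ball _ hol']) auto
  moreover have "fps_expansion (\<lambda>t. \<Psi> (t * c)) 0 = Abs_fps (\<lambda>n. fps_nth (fps_expansion \<Psi> 0) n * c ^ n)"
  proof (rule fps_ext)
    fix n
    have "(deriv ^^ n) (\<lambda>t. \<Psi> (c * t)) 0 = c ^ n * (deriv ^^ n) \<Psi> (c * 0)"
      using \<delta> sub by (intro higher_deriv_compose_linear[OF hol open_ball[of 0 \<delta>] open_ball]) auto
    then show "fps_nth (fps_expansion (\<lambda>t. \<Psi> (t * c)) 0) n = fps_nth (Abs_fps (\<lambda>n. fps_nth (fps_expansion \<Psi> 0) n * c ^ n)) n"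
      by (simp add: fps_expansion_def mult.commute)
  qed
  ultimately show "(\<lambda>t. \<Psi> (t * c)) has_fps_expansion Abs_fps (\<lambda>n. fps_nth (fps_expansion \<Psi> 0) n * c ^ n)"
    by simp
qed

text \<open>
  On every complex line through the origin the hypothesis is about functions of one variable, where
  uniform convergence of holomorphic functions implies convergence of all Taylor coefficients. The
  Taylor coefficient of order \<open>n\<close> along the line through \<open>y\<close> is the value
  at \<open>y\<close> of the homogeneous part of degree \<open>n\<close>, and from these values at
  all \<open>y\<close> the individual coefficients are recovered. The logarithm is thus known to
  have coefficients \<open>N a_n + b_n + o(1)\<close> at \<open>x_i^n\<close> and
  \<open>o(1)\<close> at mixed monomials.
\<close>
lemma log_coefficients_tendsto:
  fixes P :: "nat \<Rightarrow> 'a measure" and L :: "nat \<Rightarrow> (nat \<Rightarrow> complex) \<Rightarrow> complex"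
    and l :: "nat \<Rightarrow> 'a \<Rightarrow> nat \<Rightarrow> real"
  assumes r: "1 \<le> r" and e: "0 < e" and \<rho>: "0 < \<rho>"
    and RS: "\<forall>\<^sub>F N in sequentially. random_spectrum (\<mu> N) N (P N) (l N) \<rho>"
    and L: "\<forall>\<^sub>F N in sequentially. log_branch (polydisc r e) (\<lambda>x. \<integral>\<omega>. HC (\<mu> N) N x (l N \<omega>) \<partial>P N) (L N)"
    and ul: "uniform_limit (polydisc r e)
          (\<lambda>N x. of_nat N * (1 / of_nat N * L N x - (\<Sum>i<r. \<Psi> (x i))))
          (\<lambda>x. \<Sum>i<r. \<Phi> (x i)) sequentially"
    and \<Psi>: "\<Psi> analytic_on {0}" and \<Phi>: "\<Phi> analytic_on {0}"
    and m: "set_mset m \<subseteq> {..<r}" "size m = n" and n: "1 \<le> n"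
  shows "(\<lambda>N. mcoeff (mlog (random_spectrum.gser (\<mu> N) N (P N) (l N) 0 0)) m
     - (if \<exists>i. m = replicate_mset n i then of_nat N * fps_nth (fps_expansion \<Psi> 0) n + fps_nth (fps_expansion \<Phi> 0) n else 0)) \<longlonglongrightarrow> 0"
proof (rule coefficients_tendsto_0[OF _ m, where u = "\<lambda>N m. mcoeff (mlog (random_spectrum.gser (\<mu> N) N (P N) (l N) 0 0)) m
     - (if \<exists>i. m = replicate_mset n i then of_nat N * fps_nth (fps_expansion \<Psi> 0) n + fps_nth (fps_expansion \<Phi> 0) n else 0)"])
  fix y :: "nat \<Rightarrow> complex"
  assume y: "\<And>i. i < r \<Longrightarrow> cmod (y i) \<le> 1" "\<And>i. r \<le> i \<Longrightarrow> y i = 0"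
  let ?S = "msets r n"
  define f where "f N = random_spectrum.gser (\<mu> N) N (P N) (l N) 0 0" for N
  define a where "a = fps_nth (fps_expansion \<Psi> 0)"
  define b where "b = fps_nth (fps_expansion \<Phi> 0)"
  obtain \<delta>1 where \<delta>1: "0 < \<delta>1" "\<Psi> holomorphic_on ball 0 \<delta>1" using analytic_at_0_ball[OF \<Psi>] .
  obtain \<delta>2 where \<delta>2: "0 < \<delta>2" "\<Phi> holomorphic_on ball 0 \<delta>2" using analytic_at_0_ball[OF \<Phi>] .
  define \<delta> where "\<delta> = min (min e (\<rho> / real r)) (min \<delta>1 \<delta>2)"
  have \<delta>: "0 < \<delta>" "\<delta> \<le> e" "\<delta> \<le> \<rho> / real r" "ball 0 \<delta> \<subseteq> ball (0::complex) \<delta>1" "ball 0 \<delta> \<subseteq> ball (0::complex) \<delta>2"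
    using r e \<rho> \<delta>1 \<delta>2 by (auto simp: \<delta>_def)
  have hol: "\<Psi> holomorphic_on ball 0 \<delta>" "\<Phi> holomorphic_on ball 0 \<delta>"
    using \<delta>1(2) \<delta>2(2) \<delta>(4,5) holomorphic_on_subset by blast+
  have poly: "(\<lambda>i. t * y i) \<in> polydisc r e" if "t \<in> ball 0 \<delta>" for t
  proof -
    have "cmod (t * y i) < e" if "i < r" for i
    proof -
      have "cmod (t * y i) \<le> cmod t * 1" unfolding norm_mult using y(1)[OF that] by (intro mult_left_mono) auto
      then show ?thesis using \<open>t \<in> ball 0 \<delta>\<close> \<delta>(2) by simp
    qed
    then show ?thesis using y(2) by (auto simp: polydisc_def)
  qed
  define G where "G N t = of_nat N * (1 / of_nat N * L N (\<lambda>i. t * y i) - (\<Sum>i<r. \<Psi> (t * y i)))" for N t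
  define G' where "G' t = (\<Sum>i<r. \<Phi> (t * y i))" for t
  have ulG: "uniform_limit (ball 0 \<delta>) G G' sequentially"
    using ul poly unfolding uniform_limit_iff G_def G'_def by (fast elim: eventually_mono)
  have G'_exp: "G' has_fps_expansion (\<Sum>i<r. Abs_fps (\<lambda>n. b n * y i ^ n))"
    unfolding G'_def[abs_def] b_def
    by (intro has_fps_expansion_sum scaled_fps_expansion(2)[OF \<delta>(1) hol(2)] y) auto
  have ev: "\<forall>\<^sub>F N in sequentially. G N holomorphic_on ball 0 \<delta> \<and>
      (deriv ^^ n) (G N) 0 = fact n * (fps_nth (mline r y (mlog (f N))) n - of_nat N * (\<Sum>i<r. a n * y i ^ n))"
    using RS L eventually_ge_at_top[of r]
  proof eventually_elim
    case (elim N)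
    interpret R: random_spectrum "\<mu> N" N "P N" "l N" \<rho> by (rule elim(1))
    interpret M: moment_series N R.gser R.qser "R.gser 0 0" by (rule R.moment_series)
    have fN: "f N = R.gser 0 0" by (simp add: f_def)
    define \<Lambda> where "\<Lambda> t = L N (\<lambda>i. t * y i)" for t
    have cont: "continuous_on (ball 0 \<delta>) \<Lambda>"
    proof -
      have "continuous_on (polydisc r e) (L N)" using elim(2) by (simp add: log_branch_def)
      then have "continuous_on (ball 0 \<delta>) (\<lambda>t. L N ((\<lambda>t i. t * y i) t))"
        by (rule continuous_on_compose2) (use poly in \<open>auto intro!: continuous_on_coordinatewise_then_product continuous_intros\<close>)
      then show ?thesis by (simp add: \<Lambda>_def[abs_def])
    qed
    have "\<Lambda> holomorphic_on ball 0 \<delta> \<and> \<Lambda> has_fps_expansion mline r y (mlog (f N))"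
    proof -
      have sums: "(\<lambda>n. fps_nth (mline r y (f N)) n * t ^ n) sums (\<integral>\<omega>. HC (\<mu> N) N (\<lambda>i. t * y i) (l N \<omega>) \<partial>P N)"
        if "cmod t < \<delta>" for t
      proof -
        have "cmod t \<le> \<rho> / real r" using that \<delta>(3) by simp
        then have "cmod t * real r \<le> \<rho>" using r by (simp add: pos_le_divide_eq)
        then show ?thesis unfolding fN by (intro R.expected_HC_series elim(3) y)
      qed
      have exp: "exp (\<Lambda> t) = (\<integral>\<omega>. HC (\<mu> N) N (\<lambda>i. t * y i) (l N \<omega>) \<partial>P N)" if "t \<in> ball 0 \<delta>" for t
        using elim(2) poly[OF that] by (simp add: log_branch_def \<Lambda>_def)
      have "\<Lambda> 0 = 0" using elim(2) by (simp add: log_branch_def \<Lambda>_def)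
      moreover have "fps_X * fps_deriv (mline r y (mlog (f N))) * mline r y (f N) = fps_X * fps_deriv (mline r y (f N))"
        unfolding mline_mEuler[symmetric] mline_mult[symmetric] fN mEuler_mlog[OF M.f_0] ..
      moreover have "fps_nth (mline r y (mlog (f N))) 0 = 0"
      proof -
        have "msets r 0 = {{#}}" by auto
        then show ?thesis by (simp add: mline_def mlog_def Mser_inverse Let_def)
      qed
      ultimately show ?thesis using log_has_fps_expansion[OF \<delta>(1) sums cont exp] by blast
    qed
    then have \<Lambda>: "\<Lambda> holomorphic_on ball 0 \<delta>" "\<Lambda> has_fps_expansion mline r y (mlog (f N))" by auto
    have N0: "0 < N" by (rule R.N_pos)
    have G_eq: "G N = (\<lambda>t. \<Lambda> t - of_nat N * (\<Sum>i<r. \<Psi> (t * y i)))"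
      using N0 by (auto simp: G_def \<Lambda>_def fun_eq_iff right_diff_distrib)
    have "G N holomorphic_on ball 0 \<delta>"
      unfolding G_eq by (intro holomorphic_intros \<Lambda> scaled_fps_expansion(1)[OF \<delta>(1) hol(1)] y) auto
    moreover have "G N has_fps_expansion mline r y (mlog (f N)) - fps_const (of_nat N) * (\<Sum>i<r. Abs_fps (\<lambda>n. a n * y i ^ n))"
      unfolding G_eq a_def
      by (intro has_fps_expansion_diff has_fps_expansion_cmult_left has_fps_expansion_sum \<Lambda> scaled_fps_expansion(2)[OF \<delta>(1) hol(1)] y) auto
    from fps_nth_fps_expansion[OF this, of n]
    have "(deriv ^^ n) (G N) 0 = fact n * (fps_nth (mline r y (mlog (f N))) n - of_nat N * (\<Sum>i<r. a n * y i ^ n))"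
      by (simp add: fps_sum_nth field_simps)
    ultimately show ?case by blast
  qed
  have "(\<lambda>N. (deriv ^^ n) (G N) 0) \<longlonglongrightarrow> (deriv ^^ n) G' 0"
    by (rule higher_deriv_complex_uniform_limit[OF ulG]) (use ev \<delta>(1) in \<open>auto elim: eventually_mono\<close>)
  also have "(deriv ^^ n) G' 0 = fact n * (\<Sum>i<r. b n * y i ^ n)"
    using fps_nth_fps_expansion[OF G'_exp, of n] by (simp add: fps_sum_nth field_simps)
  finally have "(\<lambda>N. (deriv ^^ n) (G N) 0 / fact n - (\<Sum>i<r. b n * y i ^ n)) \<longlonglongrightarrow> fact n * (\<Sum>i<r. b n * y i ^ n) / fact n - (\<Sum>i<r. b n * y i ^ n)"
    by (intro tendsto_intros) auto
  then have lim: "(\<lambda>N. (deriv ^^ n) (G N) 0 / fact n - (\<Sum>i<r. b n * y i ^ n)) \<longlonglongrightarrow> 0" by simp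
  have pow_sum: "(\<Sum>m\<in>?S. (if \<exists>i. m = replicate_mset n i then c else 0) * (\<Prod>i\<in>#m. y i)) = (\<Sum>i<r. c * y i ^ n)" for c
  proof -
    have "(\<Sum>m\<in>?S. (if \<exists>i. m = replicate_mset n i then c else 0) * (\<Prod>i\<in>#m. y i))
        = (\<Sum>m\<in>replicate_mset n ` {..<r}. c * (\<Prod>i\<in>#m. y i))"
    proof (rule sum.mono_neutral_cong_right[OF finite_msets_size])
      show "\<forall>m\<in>?S - replicate_mset n ` {..<r}. (if \<exists>i. m = replicate_mset n i then c else 0) * (\<Prod>i\<in>#m. y i) = 0"
      proof
        fix m assume m: "m \<in> ?S - replicate_mset n ` {..<r}"
        have "m \<noteq> replicate_mset n i" for i
        proof
          assume "m = replicate_mset n i"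
          moreover then have "i < r" using m n by (auto split: if_splits)
          ultimately show False using m by auto
        qed
        then show "(if \<exists>i. m = replicate_mset n i then c else 0) * (\<Prod>i\<in>#m. y i) = 0" by simp
      qed
    qed (auto split: if_splits)
    also have "\<dots> = (\<Sum>i<r. c * (\<Prod>j\<in>#replicate_mset n i. y j))"
    proof (rule sum.reindex_cong[OF _ refl refl])
      show "inj_on (replicate_mset n) {..<r}"
      proof (rule inj_onI)
        fix i j assume "replicate_mset n i = replicate_mset n j"
        then have "set_mset (replicate_mset n i) = set_mset (replicate_mset n j)" by simp
        then show "i = j" using n by (simp split: if_splits)
      qed
    qed
    finally show ?thesis by simp
  qed
  have "\<forall>\<^sub>F N in sequentially. (deriv ^^ n) (G N) 0 / fact n - (\<Sum>i<r. b n * y i ^ n)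
      = (\<Sum>m\<in>?S. (mcoeff (mlog (f N)) m - (if \<exists>i. m = replicate_mset n i then of_nat N * a n + b n else 0)) * (\<Prod>i\<in>#m. y i))"
    using ev
  proof eventually_elim
    case (elim N)
    have "(\<Sum>m\<in>?S. (mcoeff (mlog (f N)) m - (if \<exists>i. m = replicate_mset n i then of_nat N * a n + b n else 0)) * (\<Prod>i\<in>#m. y i))
        = fps_nth (mline r y (mlog (f N))) n - (\<Sum>i<r. (of_nat N * a n + b n) * y i ^ n)"
      unfolding left_diff_distrib sum_subtractf pow_sum by (simp add: mline_def)
    also have "(\<Sum>i<r. (of_nat N * a n + b n) * y i ^ n) = of_nat N * (\<Sum>i<r. a n * y i ^ n) + (\<Sum>i<r. b n * y i ^ n)"
      by (simp add: distrib_right sum.distrib sum_distrib_left mult.assoc)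
    finally show ?case using elim by simp
  qed
  from tendsto_cong[OF this] lim
  show "(\<lambda>N. \<Sum>m\<in>?S. (mcoeff (mlog (random_spectrum.gser (\<mu> N) N (P N) (l N) 0 0)) m
       - (if \<exists>i. m = replicate_mset n i then of_nat N * fps_nth (fps_expansion \<Psi> 0) n + fps_nth (fps_expansion \<Phi> 0) n else 0)) * (\<Prod>i\<in>#m. y i)) \<longlonglongrightarrow> 0"
    unfolding f_def a_def b_def by blast
qed

theorem theorem2:
  fixes P :: "nat \<Rightarrow> 'a measure"
    and A :: "nat \<Rightarrow> 'a \<Rightarrow> complex mat"
    and haar :: "nat \<Rightarrow> complex mat measure"
    and \<Psi> \<Phi> :: "complex \<Rightarrow> complex"
  assumes haar: "\<And>N. N \<ge> 1 \<Longrightarrow> haar_prob N (haar N)"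
    and A: "\<And>N. N \<ge> 1 \<Longrightarrow> random_hermitian N (P N) (A N)"
    and \<Psi>: "\<Psi> analytic_on {0}"
    and \<Phi>: "\<Phi> analytic_on {0}"
    and conv: "\<And>r. r \<ge> 1 \<Longrightarrow> \<exists>e>0. \<exists>L :: nat \<Rightarrow> (nat \<Rightarrow> complex) \<Rightarrow> complex.
        (\<forall>\<^sub>F N in sequentially.
           (\<forall>x\<in>polydisc r e. integrable (P N) (\<lambda>\<omega>. HC (haar N) N x (eigval (A N \<omega>)))) \<and>
           log_branch (polydisc r e) (\<lambda>x. \<integral>\<omega>. HC (haar N) N x (eigval (A N \<omega>)) \<partial>P N) (L N)) \<and>
        uniform_limit (polydisc r e)
          (\<lambda>N x. of_nat N * (1 / of_nat N * L N x - (\<Sum>i<r. \<Psi> (x i))))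
          (\<lambda>x. \<Sum>i<r. \<Phi> (x i)) sequentially"
  shows "\<forall>k\<ge>1.
      (\<forall>\<^sub>F N in sequentially. integrable (P N) (\<lambda>\<omega>. \<Sum>i<N. eigval (A N \<omega>) i ^ k)) \<and>
      (\<lambda>N. of_nat N *
          (complex_of_real (1 / real N ^ (k + 1) * (\<integral>\<omega>. (\<Sum>i<N. eigval (A N \<omega>) i ^ k) \<partial>P N))
            - mu_coeff \<Psi> k))
        \<longlonglongrightarrow> mu'_coeff \<Psi> \<Phi> k"
proof (intro allI impI)
  fix k :: nat assume k: "k \<ge> 1"
  define l where "l N \<omega> = eigval (A N \<omega>)" for N \<omega>
  obtain e1 where e1: "0 < e1" "\<forall>\<^sub>F N in sequentially. \<forall>x\<in>polydisc 1 e1. integrable (P N) (\<lambda>\<omega>. HC (haar N) N x (l N \<omega>))"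
    using conv[of 1] unfolding l_def by (auto simp: eventually_conj_iff)
  (* Strictly inside the polydisc in one variable, on which the integrability is assumed. *)
  define \<rho> where "\<rho> = e1 / 2"
  have \<rho>: "0 < \<rho>" "\<rho> < e1" using e1 by (auto simp: \<rho>_def)
  have RS: "\<forall>\<^sub>F N in sequentially. random_spectrum (haar N) N (P N) (l N) \<rho>"
    using e1(2) eventually_ge_at_top[of 1]
  proof eventually_elim
    case (elim N)
    have "haar_measure (haar N) N"
      using haar[OF elim(2)] unfolding haar_measure_def haar_measure_axioms_def by (simp add: haar_prob_def)
    moreover have "prob_space (P N)" using A[OF elim(2)] by (simp add: random_hermitian_def)
    moreover have "random_spectrum_axioms (haar N) N (P N) (l N) \<rho>"
    proof
      show "0 < N" using elim(2) by simp
      show "0 < \<rho>" by (rule \<rho>)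
      show "(\<lambda>\<omega>. l N \<omega> i) \<in> borel_measurable (P N)" if "i < N" for i
        unfolding l_def by (rule measurable_eigval[OF A[OF elim(2)] that])
      have "(only0 (of_real c)) \<in> polydisc 1 e1" if "\<bar>c\<bar> < e1" for c
        using that by (auto simp: polydisc_def)
      then show "integrable (P N) (\<lambda>\<omega>. HC (haar N) N (only0 (of_real \<rho>)) (l N \<omega>))"
        "integrable (P N) (\<lambda>\<omega>. HC (haar N) N (only0 (of_real (- \<rho>))) (l N \<omega>))"
        using elim(1) \<rho> by auto
    qed
    ultimately show ?case by (simp add: random_spectrum_def)
  qed
  define g where "g N = random_spectrum.gser (haar N) N (P N) (l N)" for N
  define q where "q N = random_spectrum.qser (haar N) N (P N) (l N)" for N
  define a where "a = fps_nth (fps_expansion \<Psi> 0)"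
  define b where "b = fps_nth (fps_expansion \<Phi> 0)"
  have ms: "\<forall>\<^sub>F N in sequentially. moment_series N (g N) (q N) (g N 0 0)"
    using RS by eventually_elim (simp add: g_def q_def random_spectrum.moment_series)
  have logc: "(\<lambda>N. mcoeff (mlog (g N 0 0)) m - (if \<exists>i. m = replicate_mset n i then of_nat N * a n + b n else 0)) \<longlonglongrightarrow> 0"
    if m: "set_mset m \<subseteq> {..<r}" "size m = n" and n: "1 \<le> n" and r: "1 \<le> r" for m n r
  proof -
    obtain e L where "0 < e" "\<forall>\<^sub>F N in sequentially. log_branch (polydisc r e) (\<lambda>x. \<integral>\<omega>. HC (haar N) N x (l N \<omega>) \<partial>P N) (L N)"
      "uniform_limit (polydisc r e)
          (\<lambda>N x. of_nat N * (1 / of_nat N * L N x - (\<Sum>i<r. \<Psi> (x i))))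
          (\<lambda>x. \<Sum>i<r. \<Phi> (x i)) sequentially"
      using conv[OF r] unfolding l_def by (auto simp: eventually_conj_iff)
    from log_coefficients_tendsto[OF r this(1) \<rho>(1) RS this(2,3) \<Psi> \<Phi> m n]
    show ?thesis unfolding g_def a_def b_def .
  qed
  define \<psi> where "\<psi> p = of_nat (Suc p) * a (Suc p)" for p
  define \<phi> where "\<phi> p = of_nat (Suc p) * b (Suc p)" for p
  have deriv_exp: "deriv F has_fps_expansion Abs_fps (\<lambda>p. of_nat (Suc p) * fps_nth (fps_expansion F 0) (Suc p))"
    if "F analytic_on {0}" for F
  proof -
    have "deriv F has_fps_expansion fps_deriv (fps_expansion F 0)"
      by (intro has_fps_expansion_deriv analytic_at_imp_has_fps_expansion_0 that)
    moreover have "fps_deriv (fps_expansion F 0) = Abs_fps (\<lambda>p. of_nat (Suc p) * fps_nth (fps_expansion F 0) (Suc p))"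
      by (rule fps_ext) simp
    ultimately show ?thesis by simp
  qed
  have d\<Psi>: "deriv \<Psi> has_fps_expansion Abs_fps \<psi>" and d\<Phi>: "deriv \<Phi> has_fps_expansion Abs_fps \<phi>"
    using deriv_exp[OF \<Psi>] deriv_exp[OF \<Phi>] unfolding \<psi>_def[abs_def] \<phi>_def[abs_def] a_def b_def by simp_all
  have lim1: "(\<lambda>N. of_nat N * (mcoeff (g N k 0) {#} / of_nat N ^ k - alpha (\<lambda>p. \<psi> p + 1 / of_nat N * \<phi> p) k 0)) \<longlonglongrightarrow> 0"
    unfolding \<psi>_def \<phi>_def
  proof (rule moment_series_asymptotics[OF ms])
    fix n :: nat assume "1 \<le> n"
    show "(\<lambda>N. mcoeff (mlog (g N 0 0)) (pur n) - (of_nat N * a n + b n)) \<longlonglongrightarrow> 0"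
    proof -
      have "\<exists>i. pur n = replicate_mset n i" by blast
      moreover have "set_mset (pur n) \<subseteq> {..<1}" by auto
      ultimately show ?thesis using logc[of "pur n" 1 n] \<open>1 \<le> n\<close> by (simp only: if_True size_replicate_mset)
    qed
  next
    fix u assume u: "others u \<noteq> {}" "0 \<in># u"
    define r where "r = Suc (Max (set_mset u))"
    have "set_mset u \<subseteq> {..<r}" by (auto simp: r_def less_Suc_eq_le)
    moreover have "1 \<le> size u" using u(2) by (metis One_nat_def Suc_leI size_eq_0_iff_empty empty_iff set_mset_empty gr0I)
    moreover have "\<not> (\<exists>i. u = replicate_mset (size u) i)"
    proof
      assume "\<exists>i. u = replicate_mset (size u) i"
      then obtain i where "set_mset u \<subseteq> {i}" by (metis set_mset_replicate_mset_subset subset_singleton_iff order_refl)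
      then show False using u by (auto simp: others_def)
    qed
    ultimately show "(\<lambda>N. mcoeff (mlog (g N 0 0)) u) \<longlonglongrightarrow> 0"
      using logc[of u r "size u"] by (simp add: r_def)
  qed
  have lim: "(\<lambda>N. of_nat N * (mcoeff (g N k 0) {#} / of_nat N ^ k - mu_coeff \<Psi> k)) \<longlonglongrightarrow> mu'_coeff \<Psi> \<Phi> k"
    using tendsto_add[OF lim1 alpha_perturbation[OF d\<Psi> d\<Phi> k]]
    unfolding mu_coeff_eq_alpha[OF d\<Psi> k] distrib_left[symmetric] by simp
  have ev: "\<forall>\<^sub>F N in sequentially. of_nat N * (complex_of_real (1 / real N ^ (k + 1) * (\<integral>\<omega>. (\<Sum>i<N. eigval (A N \<omega>) i ^ k) \<partial>P N)) - mu_coeff \<Psi> k)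
      = of_nat N * (mcoeff (g N k 0) {#} / of_nat N ^ k - mu_coeff \<Psi> k)"
    using RS
  proof eventually_elim
    case (elim N)
    interpret R: random_spectrum "haar N" N "P N" "l N" \<rho> by (rule elim)
    have "complex_of_real (1 / real N ^ (k + 1) * (\<integral>\<omega>. (\<Sum>i<N. eigval (A N \<omega>) i ^ k) \<partial>P N))
        = 1 / of_nat N ^ (k + 1) * complex_of_real (\<integral>\<omega>. (\<Sum>i<N. l N \<omega> i ^ k) \<partial>P N)"
      by (simp add: l_def)
    also have "\<dots> = mcoeff (g N k 0) {#} / of_nat N ^ k"
      unfolding R.expected_power_sum(2) using R.N_pos by (simp add: g_def)
    finally show ?case by simp
  qed
  show "(\<forall>\<^sub>F N in sequentially. integrable (P N) (\<lambda>\<omega>. \<Sum>i<N. eigval (A N \<omega>) i ^ k)) \<and>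
      (\<lambda>N. of_nat N *
          (complex_of_real (1 / real N ^ (k + 1) * (\<integral>\<omega>. (\<Sum>i<N. eigval (A N \<omega>) i ^ k) \<partial>P N))
            - mu_coeff \<Psi> k))
        \<longlonglongrightarrow> mu'_coeff \<Psi> \<Phi> k"
  proof
    show "\<forall>\<^sub>F N in sequentially. integrable (P N) (\<lambda>\<omega>. \<Sum>i<N. eigval (A N \<omega>) i ^ k)"
      using RS
    proof eventually_elim
      case (elim N)
      then show ?case using random_spectrum.expected_power_sum(1)[OF elim, of k] by (simp add: l_def)
    qed
    show "(\<lambda>N. of_nat N *
          (complex_of_real (1 / real N ^ (k + 1) * (\<integral>\<omega>. (\<Sum>i<N. eigval (A N \<omega>) i ^ k) \<partial>P N))
            - mu_coeff \<Psi> k))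
        \<longlonglongrightarrow> mu'_coeff \<Psi> \<Phi> k"
      using tendsto_cong[OF ev] lim by blast
  qed
qed

end
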